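(* Let $E=(\mathbb{G}_a^d,\phi)$ be a $d$-dimensional $t$-module defined over a global function field $L$. Given $P_1,\dots,P_\ell\in E(L)=\mathrm{Mat}_{d\times 1}(L)$, let $$\mathcal{R}=\{(a_1,\dots,a_\ell)\in\mathbb{F}_q[t]^{\oplus\ell}\mid \phi_{a_1}(P_1)+\cdots+\phi_{a_\ell}(P_\ell)=0\}.$$ Then there is an explicitly constructed matrix $\mathbb{B}\in\mathrm{Mat}_{m\times n}(\mathbb{F}_q[t])$ with $\deg_t(\mathbb{B})\leq 1$, where $n\geq\ell$ is an effectively computable number depending on $E,P_1,\dots,P_\ell,L$, and $m\geq 0$ is some integer, such that the projection map $$\mathrm{Ker}(\mathbb{B})\to\mathcal{R},\qquad (b_1,\dots,b_{n-\ell},a_1,\dots,a_\ell)^{\mathrm{tr}}\mapsto(a_1,\dots,a_\ell)$$ is a well-defined surjective $\mathbb{F}_q[t]$-module homomorphism, where $\mathrm{Ker}(\mathbb{B})$ is the set of column vectors $\bm{x}\in\mathrm{Mat}_{n\times 1}(\mathbb{F}_q[t])$ with $\mathbb{B}\bm{x}=0$. In particular, there is an algorithm that determines the relation module $\mathcal{R}$.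
   Context: $\mathbb{F}_q$ is a finite field with $q$ elements, $K=\mathbb{F}_q(\theta)$ is the rational function field, $K_\infty=\mathbb{F}_q(\!(1/\theta)\!)$, and $\mathbb{C}_\infty$ is the completion of an algebraic closure of $K_\infty$. A global function field $L$ here means a finite extension of $K$ with $L\subset\mathbb{C}_\infty$. $L[\tau]$ is the twisted polynomial ring with $\tau\alpha=\alpha^q\tau$ for $\alpha\in L$. For a column vector $\bm{v}$ over $L$, $\bm{v}^{(i)}$ is obtained by raising each entry to the $q^i$-th power, and $A=\sum_i A_i\tau^i\in\mathrm{Mat}_{d\times d}(L[\tau])$ (with $A_i\in\mathrm{Mat}_{d\times d}(L)$) acts on $\mathrm{Mat}_{d\times 1}(L)$ by $A(\bm{v})=\sum_i A_i\bm{v}^{(i)}$. For $d>0$, a $d$-dimensional $t$-module defined over $L$ is a pair $E=(\mathbb{G}_a^d,\phi)$, where $\phi:\mathbb{F}_q[t]\to\mathrm{Mat}_{d\times d}(L[\tau])$, $a\mapsto\phi_a$, is an $\mathbb{F}_q$-algebra homomorphism such that $\partial\phi_t-\theta\,\mathrm{Id}_d$ is nilpotent; here $\partial\phi_t\in\mathrm{Mat}_{d\times d}(L)$ is the constant ($\tau^0$) coefficient of $\phi_t$. No further assumption (e.g. abelianness) is made on $E$. $E(L)=\mathrm{Mat}_{d\times 1}(L)$ carries the $\mathbb{F}_q[t]$-module structure $a\cdot P=\phi_a(P)$. $\deg_t(\mathbb{B})$ is the maximum of the $t$-degrees of the entries of $\mathbb{B}$. *)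

theory Defs
  imports
    "HOL-Computational_Algebra.Formal_Laurent_Series"
    "HOL-Library.Nat_Bijection"
    "HOL-Library.Countable"
    "HOL-Library.Cardinality"
    "HOL-Algebra.Embedded_Algebras"
    "Jordan_Normal_Form.Matrix_Kernel"
begin

hide_const (open) up_ring.coeff up_ring.monom Module.smult

section \<open>The fields\<close>

text \<open>
  The field of Laurent series in \<open>1/\<theta>\<close> is the type \<open>'f fls\<close>, its variable \<open>fls_X\<close> playing the
  role of \<open>1/\<theta>\<close>; so \<open>\<theta>\<close> is \<open>fls_X_inv\<close>. The completion of an algebraic closure of it is
  described axiomatically: \<open>'c\<close> is complete with respect to an absolute value extending the one of
  \<open>'f fls\<close> (normalised by giving \<open>\<theta>\<close> the value \<open>q\<close>), and the elements of \<open>'c\<close> that are algebraic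
  over \<open>'f fls\<close> form an algebraically closed field that is dense in \<open>'c\<close>.
\<close>

definition algebraic_part :: "('f::field fls \<Rightarrow> 'c::field) \<Rightarrow> 'c set" where
  "algebraic_part emb = {x. \<exists>p. p \<noteq> 0 \<and> poly (map_poly emb p) x = 0}"

locale C_infinity = field_hom emb
  for emb :: "'f::{finite,field} fls \<Rightarrow> 'c::field" +
  fixes absv :: "'c \<Rightarrow> real"
  assumes absv_nonneg: "0 \<le> absv x"
    and absv_eq_0: "absv x = 0 \<longleftrightarrow> x = 0"
    and absv_mult: "absv (x * y) = absv x * absv y"
    and absv_ultrametric: "absv (x + y) \<le> max (absv x) (absv y)"
    and absv_emb: "f \<noteq> 0 \<Longrightarrow> absv (emb f) = real CARD('f) powi (- fls_subdegree f)"
    and complete: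
      "(\<And>e. e > 0 \<Longrightarrow> \<exists>N. \<forall>m\<ge>N. \<forall>n\<ge>N. absv (s m - s n) < e) \<Longrightarrow>
        \<exists>x. (\<lambda>n. absv (s n - x)) \<longlonglongrightarrow> 0"
    and algebraic_part_closed:
      "set (coeffs p) \<subseteq> algebraic_part emb \<Longrightarrow> degree p > 0 \<Longrightarrow>
        \<exists>x\<in>algebraic_part emb. poly p x = 0"
    and algebraic_part_dense: "e > 0 \<Longrightarrow> \<exists>y\<in>algebraic_part emb. absv (x - y) < e"

definition theta :: "('f::field fls \<Rightarrow> 'c::field) \<Rightarrow> 'c" where
  "theta emb = emb fls_X_inv"

definition const :: "('f::field fls \<Rightarrow> 'c::field) \<Rightarrow> 'f \<Rightarrow> 'c" where
  "const emb c = emb (fls_const c)"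

definition ratfun :: "('f::field fls \<Rightarrow> 'c::field) \<Rightarrow> 'f poly \<times> 'f poly \<Rightarrow> 'c" where
  "ratfun emb = (\<lambda>(p, s).
     poly (map_poly (const emb) p) (theta emb) / poly (map_poly (const emb) s) (theta emb))"

definition ratfun_field :: "('f::field fls \<Rightarrow> 'c::field) \<Rightarrow> 'c set" where
  "ratfun_field emb = {ratfun emb (p, s) |p s. s \<noteq> 0}"

definition global_function_field :: "('f::field fls \<Rightarrow> 'c::field) \<Rightarrow> 'c set \<Rightarrow> bool" where
  "global_function_field emb L \<longleftrightarrow>
     subfield L (class_ring :: 'c ring) \<and> ratfun_field emb \<subseteq> L \<and>
     ring.finite_dimension (class_ring :: 'c ring) (ratfun_field emb) L"


section \<open>Twisted polynomial matrices and t-modules\<close>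

definition mat_degree :: "'a::zero poly mat \<Rightarrow> nat" where
  "mat_degree A = Max (insert 0 (degree ` elements_mat A))"

text \<open>
  A matrix of twisted polynomials in \<open>\<tau>\<close> has the type \<open>'c poly mat\<close>. The type \<open>'c poly\<close> only serves
  to store the (left) coefficients: products are formed by the following operations, not by those
  of \<open>'c poly\<close>. The parameter \<open>q\<close> is the exponent in \<open>\<tau> \<alpha> = \<alpha> ^ q \<tau>\<close>.
\<close>

definition twisted_mult :: "nat \<Rightarrow> 'c::comm_ring_1 poly \<Rightarrow> 'c poly \<Rightarrow> 'c poly" where
  "twisted_mult q f g =
     (\<Sum>i\<le>degree f. \<Sum>j\<le>degree g. monom (coeff f i * coeff g j ^ (q ^ i)) (i + j))"

definition twisted_mat_mult ::
  "nat \<Rightarrow> 'c::comm_ring_1 poly mat \<Rightarrow> 'c poly mat \<Rightarrow> 'c poly mat" where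
  "twisted_mat_mult q A B =
     mat (dim_row A) (dim_col B) (\<lambda>(i, j). \<Sum>k<dim_col A. twisted_mult q (A $$ (i, k)) (B $$ (k, j)))"

definition twisted_mat_ring :: "nat \<Rightarrow> 'c::comm_ring_1 set \<Rightarrow> nat \<Rightarrow> 'c poly mat ring" where
  "twisted_mat_ring q L d =
     \<lparr>carrier = {A \<in> carrier_mat d d. \<forall>f\<in>elements_mat A. set (coeffs f) \<subseteq> L},
      mult = twisted_mat_mult q, one = 1\<^sub>m d, zero = 0\<^sub>m d d, add = (+)\<rparr>"

definition tau_coeff :: "'c::zero poly mat \<Rightarrow> nat \<Rightarrow> 'c mat" where
  "tau_coeff A i = map_mat (\<lambda>f. coeff f i) A"

definition twisted_apply :: "nat \<Rightarrow> 'c::comm_ring_1 poly mat \<Rightarrow> 'c vec \<Rightarrow> 'c vec" where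
  "twisted_apply q A v =
     finsum_vec TYPE('c) (dim_row A)
       (\<lambda>i. tau_coeff A i *\<^sub>v map_vec (\<lambda>x. x ^ (q ^ i)) v) {..mat_degree A}"

text \<open>The variable \<open>t\<close> of the polynomial ring \<open>'f poly\<close> is \<open>[:0, 1:]\<close>.\<close>

definition t_module ::
  "('f::{finite,field} fls \<Rightarrow> 'c::field) \<Rightarrow> 'c set \<Rightarrow> nat \<Rightarrow> ('f poly \<Rightarrow> 'c poly mat) \<Rightarrow> bool" where
  "t_module emb L d \<phi> \<longleftrightarrow>
     d > 0 \<and>
     \<phi> \<in> Ring.ring_hom (class_ring :: 'f poly ring) (twisted_mat_ring CARD('f) L d) \<and>
     (\<forall>c a. \<phi> (smult c a) = map_mat (smult (const emb c)) (\<phi> a)) \<and>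
     (\<exists>k. (tau_coeff (\<phi> [:0, 1:]) 0 - theta emb \<cdot>\<^sub>m 1\<^sub>m d) ^\<^sub>m k = 0\<^sub>m d d)"

definition rational_points :: "'c set \<Rightarrow> nat \<Rightarrow> 'c vec set" where
  "rational_points L d = {v \<in> carrier_vec d. set\<^sub>v v \<subseteq> L}"

definition relation_set ::
  "nat \<Rightarrow> ('f::{finite,field} poly \<Rightarrow> 'c::field poly mat) \<Rightarrow> 'c vec list \<Rightarrow> 'f poly vec set" where
  "relation_set d \<phi> P =
     {a \<in> carrier_vec (length P).
        finsum_vec TYPE('c) d (\<lambda>i. twisted_apply CARD('f) (\<phi> (a $ i)) (P ! i)) {..<length P}
        = 0\<^sub>v d}"

definition relation_module ::
  "nat \<Rightarrow> ('f::{finite,field} poly \<Rightarrow> 'c::field poly mat) \<Rightarrow> 'c vec list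
     \<Rightarrow> ('f poly, 'f poly vec) module" where
  "relation_module d \<phi> P =
     (module_vec TYPE('f poly) (length P)) \<lparr>carrier := relation_set d \<phi> P\<rparr>"

definition kernel_module :: "'a::comm_ring_1 mat \<Rightarrow> ('a, 'a vec) module" where
  "kernel_module B = (module_vec TYPE('a) (dim_col B)) \<lparr>carrier := mat_kernel B\<rparr>"


section \<open>Algorithms\<close>

text \<open>
  Partial recursive functions in one argument, tuples being coded by \<open>prod_encode\<close>; \<open>None\<close>
  means divergence.
\<close>

inductive partial_recursive :: "(nat \<rightharpoonup> nat) \<Rightarrow> bool" where
  pr_zero: "partial_recursive (\<lambda>_. Some 0)"
| pr_succ: "partial_recursive (\<lambda>n. Some (Suc n))"
| pr_left: "partial_recursive (\<lambda>n. Some (fst (prod_decode n)))"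
| pr_right: "partial_recursive (\<lambda>n. Some (snd (prod_decode n)))"
| pr_pair: "partial_recursive f \<Longrightarrow> partial_recursive g \<Longrightarrow>
    partial_recursive
      (\<lambda>n. Option.bind (f n) (\<lambda>x. Option.bind (g n) (\<lambda>y. Some (prod_encode (x, y)))))"
| pr_comp: "partial_recursive f \<Longrightarrow> partial_recursive g \<Longrightarrow>
    partial_recursive (\<lambda>n. Option.bind (f n) g)"
| pr_prec: "partial_recursive f \<Longrightarrow> partial_recursive g \<Longrightarrow>
    partial_recursive
      (\<lambda>n. case prod_decode n of (a, k) \<Rightarrow>
         rec_nat (f a)
           (\<lambda>i r. Option.bind r (\<lambda>y. g (prod_encode (a, prod_encode (i, y))))) k)"
| pr_search: "partial_recursive f \<Longrightarrow>
    partial_recursive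
      (\<lambda>a. if \<exists>k. f (prod_encode (a, k)) = Some 0 \<and> (\<forall>i<k. f (prod_encode (a, i)) \<noteq> None)
           then Some (LEAST k. f (prod_encode (a, k)) = Some 0) else None)"

text \<open>
  Input of an algorithm: a field \<open>L\<close> is given by the multiplication table of a basis over the
  rational function field, an element of \<open>L\<close> by its coordinates in that basis, a coordinate by
  numerator and denominator, and a polynomial over the finite field by its coefficients. The
  enumeration \<open>to_nat\<close> of the finite field is immaterial, two enumerations of a finite type
  being computable from each other.
\<close>

type_synonym 'f elt = "('f poly \<times> 'f poly) list"

definition represents ::
  "('f::field fls \<Rightarrow> 'c::field) \<Rightarrow> 'c list \<Rightarrow> 'f elt \<Rightarrow> 'c \<Rightarrow> bool" where
  "represents emb bs xs x \<longleftrightarrow>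
     length xs = length bs \<and> (\<forall>(p, s)\<in>set xs. s \<noteq> 0) \<and>
     x = (\<Sum>i<length bs. ratfun emb (xs ! i) * bs ! i)"

definition presents_field ::
  "('f::field fls \<Rightarrow> 'c::field) \<Rightarrow> 'c list \<Rightarrow> 'f elt list list \<Rightarrow> 'c set \<Rightarrow> bool" where
  "presents_field emb bs tab L \<longleftrightarrow>
     ring.independent (class_ring :: 'c ring) (ratfun_field emb) bs \<and>
     ring.Span (class_ring :: 'c ring) (ratfun_field emb) bs = L \<and>
     list_all2 (list_all2 (represents emb bs)) tab (map (\<lambda>b. map (\<lambda>b'. b * b') bs) bs)"

text \<open>A t-module is given by the coefficient matrices of \<open>\<phi>\<^sub>t\<close>, which determine \<open>\<phi>\<close>.\<close>

definition presents_t_module ::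
  "('f::field fls \<Rightarrow> 'c::field) \<Rightarrow> 'c list \<Rightarrow> 'f elt list list list
     \<Rightarrow> ('f poly \<Rightarrow> 'c poly mat) \<Rightarrow> bool" where
  "presents_t_module emb bs T \<phi> \<longleftrightarrow>
     mat_degree (\<phi> [:0, 1:]) < length T \<and>
     list_all2 (list_all2 (list_all2 (represents emb bs))) T
       (map (\<lambda>i. mat_to_list (tau_coeff (\<phi> [:0, 1:]) i)) [0..<length T])"

definition presents_points ::
  "('f::field fls \<Rightarrow> 'c::field) \<Rightarrow> 'c list \<Rightarrow> 'f elt list list \<Rightarrow> 'c vec list \<Rightarrow> bool" where
  "presents_points emb bs X P \<longleftrightarrow>
     list_all2 (list_all2 (represents emb bs)) X (map list_of_vec P)"

definition code_list :: "('a \<Rightarrow> nat) \<Rightarrow> 'a list \<Rightarrow> nat" where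
  "code_list c xs = list_encode (map c xs)"

definition code_poly :: "'f::{finite,zero} poly \<Rightarrow> nat" where
  "code_poly p = code_list to_nat (coeffs p)"

definition code_elt :: "'f::{finite,zero} elt \<Rightarrow> nat" where
  "code_elt = code_list (\<lambda>(p, s). prod_encode (code_poly p, code_poly s))"

definition code_input ::
  "nat \<Rightarrow> 'f::{finite,zero} elt list list \<Rightarrow> 'f elt list list list \<Rightarrow> 'f elt list list \<Rightarrow> nat" where
  "code_input d tab T X =
     code_list id
       [d, code_list (code_list code_elt) tab,
        code_list (code_list (code_list code_elt)) T,
        code_list (code_list code_elt) X]"

definition code_poly_mat :: "'f::{finite,zero} poly mat \<Rightarrow> nat" where
  "code_poly_mat B =
     prod_encode (dim_col B, code_list (code_list code_poly) (mat_to_list B))"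

definition code_poly_vecs :: "'f::{finite,zero} poly vec list \<Rightarrow> nat" where
  "code_poly_vecs gs = code_list (code_list code_poly) (map list_of_vec gs)"

text \<open>
  \<open>valid_input emb L d \<phi> P c\<close>: the number \<open>c\<close> describes the field \<open>L\<close>, the \<open>d\<close>-dimensional
  t-module given by \<open>\<phi>\<close> over \<open>L\<close> and the list \<open>P\<close> of \<open>L\<close>-rational points on it.
\<close>

definition valid_input ::
  "('f::{finite,field} fls \<Rightarrow> 'c::field) \<Rightarrow> 'c set \<Rightarrow> nat \<Rightarrow> ('f poly \<Rightarrow> 'c poly mat)
     \<Rightarrow> 'c vec list \<Rightarrow> nat \<Rightarrow> bool" where
  "valid_input emb L d \<phi> P c \<longleftrightarrow>
     (\<exists>bs tab T X. presents_field emb bs tab L \<and> presents_t_module emb bs T \<phi> \<and>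
        presents_points emb bs X P \<and> c = code_input d tab T X)"

end

theory Submission
  imports Defs "Jordan_Normal_Form.Char_Poly"
begin

text \<open>
  Let \<open>K = F\<^sub>q(\<theta>)\<close>. A basis of \<open>L\<close> over \<open>K\<close> turns \<open>E(L)\<close> into \<open>K\<^sup>N\<close> with \<open>N = d [L : K]\<close>, and the
  action of \<open>t\<close> into an \<open>F\<^sub>q\<close>-linear map \<open>F(x) = \<Sum>\<^sub>j A\<^sub>j \<tau>\<^sup>j x\<close> with matrices \<open>A\<^sub>j\<close> over \<open>K\<close>. A vector
  \<open>a\<close> of polynomials in \<open>t\<close> is evaluated at \<open>P\<^sub>1, \<dots>, P\<^sub>\<ell>\<close> by a Horner scheme, whose intermediate
  values are the values of the truncations \<open>a div t\<^sup>m\<close>. They are called the states of \<open>a\<close>.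

  The proof bounds the number of states of a relation and then argues by pigeonhole. If two states
  of a relation \<open>a\<close> agree, then the difference of the two truncations is a relation, and a multiple
  of it by a power of \<open>t\<close> cancels the leading terms of \<open>a\<close>. So if no relation has more than \<open>Q\<close>
  states, the relations of degree at most \<open>Q\<close> generate all of them (\<open>small_relations_generate\<close>).

  The states \<open>b\<^sub>m\<close> of a relation are the coefficients of a vector \<open>b \<in> K[t]\<^sup>N\<close> that solves
  \<open>F(b) - t b = - \<Sum>\<^sub>i a\<^sub>i P\<^sub>i\<close>, where \<open>\<tau>\<close> acts on \<open>K[t]\<close> through the coefficients and so commutes with
  the \<open>a\<^sub>i\<close>. A count of parameters over \<open>F\<^sub>q\<close> (Siegel's lemma over a finite field) gives a row vector
  \<open>u\<close> of twisted polynomials of bounded height for which \<open>u (F - t)\<close> involves only one prescribed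
  coordinate (\<open>ex_eliminating_operator\<close>), and this product is not zero because the constant term of
  \<open>F - t\<close> has the invertible leading coefficient \<open>- 1\<close> in \<open>t\<close> (\<open>operator_coeff_nonzero\<close>). That
  coordinate \<open>b\<^sub>k\<close> therefore satisfies a scalar equation \<open>\<Sum>\<^sub>s c\<^sub>s \<tau>\<^sup>s b\<^sub>k = G\<close>. The Frobenius makes the
  term of highest order dominate the others at every place: Gauss' lemma bounds the denominator of
  \<open>b\<^sub>k\<close> by the content of the top coefficient, and the Gauss norm at infinity bounds its numerator
  (\<open>scalar_bound\<close>). Hence all states lie in a finite set of explicitly bounded size
  (\<open>states_bound\<close>). The bound does not depend on the degree of the relation.

  The algorithm lists the relations of degree at most \<open>Q\<close>: it runs through all numbers below a
  computable bound and keeps those that code a relation, which it tests by the Horner scheme on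
  coordinates. That these computations are partial recursive follows from closure properties of
  computable functions between coded types (\<open>computable_intros\<close>).

  The matrix \<open>B\<close> comes from the generators \<open>g\<^sub>1, g\<^sub>2, \<dots>\<close> so obtained. Instead of one unknown \<open>y\<^sub>j\<close>
  with the equations \<open>a = \<Sum>\<^sub>j g\<^sub>j y\<^sub>j\<close>, there is one unknown for each \<open>t\<^sup>s y\<^sub>j\<close>. The equations then have
  constant coefficients, and the equations between successive unknowns have degree one
  (\<open>linear_matrix\<close>).
\<close>

hide_const (open) up_ring.coeff up_ring.monom Module.smult

section \<open>The Frobenius map\<close>

lemma card_field_gt_1: "CARD('f::{finite,field}) > 1"
proof -
  have "card {0, 1 :: 'f} \<le> CARD('f)" by (rule card_mono) auto
  then show ?thesis by simp
qed

lemma finite_field_power_CARD: "(x :: 'f::{finite,field}) ^ CARD('f) = x"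
proof (cases "x = 0")
  case False
  have "(\<Prod>y\<in>UNIV-{0}. x * y) = (\<Prod>y\<in>UNIV-{0}. y)"
    by (rule prod.reindex_bij_witness[of _ "\<lambda>y. y / x" "\<lambda>y. x * y"]) (use False in auto)
  then have "x ^ (CARD('f) - 1) * \<Prod>(UNIV - {0 :: 'f}) = \<Prod>(UNIV - {0})"
    by (simp add: prod.distrib)
  moreover have "\<Prod>(UNIV - {0 :: 'f}) \<noteq> 0" by simp
  ultimately have "x ^ (CARD('f) - 1) = 1" by simp
  then show ?thesis
    using card_field_gt_1[where 'f = 'f] power_Suc[of x "CARD('f) - 1"] by simp
qed (use card_field_gt_1[where 'f = 'f] in auto)

text \<open>
  The polynomial \<open>(X + 1)\<^sup>q - X\<^sup>q - 1\<close> has degree less than \<open>q\<close> and vanishes at all \<open>q\<close> elements of the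
  field, so all its coefficients are zero.
\<close>

lemma binomial_CARD_eq_0:
  assumes "0 < i" "i < CARD('f::{finite,field})"
  shows "of_nat (CARD('f) choose i) = (0 :: 'f)"
proof -
  define q where "q = CARD('f)"
  have q: "q > 1" unfolding q_def by (rule card_field_gt_1)
  define g :: "'f poly" where "g = [:1, 1:] ^ q - monom 1 q - 1"
  have "coeff g i = (if i = q then 0 else of_nat (q choose i) - (if i = 0 then 1 else 0))" for i
    using q by (cases "i \<le> q")
      (auto simp: g_def coeff_linear_poly_power coeff_eq_0 degree_linear_power binomial_eq_0)
  then have coeff_g: "coeff g i = (if i = 0 \<or> i = q then 0 else of_nat (q choose i))" for i
    using q by (cases "i = 0") auto
  have "g = 0"
  proof (rule ccontr)
    assume "g \<noteq> 0"
    have "degree g < q"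
    proof -
      have "degree g \<le> q - 1"
        by (rule degree_le) (use q in \<open>auto simp: coeff_g binomial_eq_0\<close>)
      then show ?thesis using q by simp
    qed
    moreover have "poly g x = 0" for x
      by (simp add: g_def poly_monom finite_field_power_CARD q_def)
    then have "{x. poly g x = 0} = UNIV" by auto
    ultimately show False
      using card_poly_roots_bound[OF \<open>g \<noteq> 0\<close>] by (simp add: q_def)
  qed
  then show ?thesis using coeff_g[of i] assms by (simp add: q_def)
qed

text \<open>
  The homomorphism \<open>e\<close> transports the vanishing of the binomial coefficients from the finite field to
  \<open>'r\<close>.
\<close>

lemma frobenius_add:
  fixes e :: "'f::{finite,field} \<Rightarrow> 'r::comm_ring_1"
  assumes "comm_ring_hom e"
  shows "((x :: 'r) + y) ^ CARD('f) = x ^ CARD('f) + y ^ CARD('f)"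
proof -
  interpret comm_ring_hom e by fact
  define q where "q = CARD('f)"
  have q: "q > 1" unfolding q_def by (rule card_field_gt_1)
  have "of_nat (q choose i) = (0 :: 'r)" if "0 < i" "i < q" for i
    using arg_cong[OF binomial_CARD_eq_0[OF that[unfolded q_def]], of e]
    by (simp add: q_def hom_distribs)
  then have "(\<Sum>k\<le>q. of_nat (q choose k) * x ^ k * y ^ (q - k))
      = (\<Sum>k\<in>{0, q}. of_nat (q choose k) * x ^ k * y ^ (q - k))"
    by (intro sum.mono_neutral_right) (auto simp: le_less)
  then show ?thesis
    using q unfolding q_def[symmetric] by (subst binomial_ring) (simp add: add.commute)
qed

lemma frobenius_iterate_hom:
  fixes e :: "'f::{finite,field} \<Rightarrow> 'r::comm_ring_1"
  assumes "comm_ring_hom e"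
  shows "comm_ring_hom (\<lambda>x::'r. x ^ (CARD('f) ^ k))"
proof
  show "(x + y) ^ CARD('f) ^ k = x ^ CARD('f) ^ k + y ^ CARD('f) ^ k" for x y :: 'r
    by (induction k) (simp_all add: power_Suc2 power_mult frobenius_add[OF assms] del: power_Suc)
  have "CARD('f) ^ k > 0" using card_field_gt_1[where 'f = 'f] by simp
  then show "(0 :: 'r) ^ CARD('f) ^ k = 0" by (rule zero_power)
qed (simp_all add: power_mult_distrib)


section \<open>Heights of the solutions of a scalar twisted equation\<close>

text \<open>
  In the type \<open>'a poly poly\<close> the outer variable is \<open>t\<close> and the inner one is \<open>\<theta>\<close>. With \<open>m = q\<^sup>k\<close>, \<open>twist m\<close> is
  the \<open>k\<close>-th power of \<open>\<tau>\<close>, which raises the coefficients to a power and fixes \<open>t\<close>.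
\<close>

abbreviation twist :: "nat \<Rightarrow> 'a::comm_ring_1 poly \<Rightarrow> 'a poly" where
  "twist m \<equiv> map_poly (\<lambda>x. x ^ m)"

text \<open>
  The height is the degree in \<open>\<theta>\<close>.
\<close>

definition height_le :: "nat \<Rightarrow> 'a::zero poly poly \<Rightarrow> bool" where
  "height_le m F \<longleftrightarrow> (\<forall>n. degree (coeff F n) \<le> m)"

lemma height_le_0 [simp]: "height_le m 0"
  by (simp add: height_le_def)

lemma height_le_mono: "height_le m F \<Longrightarrow> m \<le> k \<Longrightarrow> height_le k F"
  unfolding height_le_def using order_trans by blast

lemma height_le_add: "height_le m F \<Longrightarrow> height_le m G \<Longrightarrow> height_le m (F + G)"
  unfolding height_le_def by (auto intro: degree_add_le)

lemma height_le_minus: "height_le m F \<Longrightarrow> height_le m (G :: 'a::ab_group_add poly poly) \<Longrightarrow> height_le m (F - G)"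
  unfolding height_le_def by (auto intro: degree_diff_le)

lemma height_le_sum: "(\<And>i. i \<in> I \<Longrightarrow> height_le m (F i)) \<Longrightarrow> height_le m (sum F I)"
  by (induction I rule: infinite_finite_induct) (auto intro: height_le_add)

lemma height_le_mult:
  assumes "height_le m F" "height_le k G"
  shows "height_le (m + k) (F * G :: 'a::comm_semiring_0 poly poly)"
  unfolding height_le_def coeff_mult
proof (intro allI degree_sum_le)
  fix n i
  show "degree (coeff F i * coeff G (n - i)) \<le> m + k"
    using degree_mult_le[of "coeff F i" "coeff G (n - i)"] assms
    by (meson add_mono height_le_def order_trans)
qed auto

lemma height_le_smult:
  assumes "degree a \<le> m" "height_le k G"
  shows "height_le (m + k) (smult a G :: 'a::comm_semiring_0 poly poly)"
proof -
  have "height_le m [:a:]" using assms(1) by (simp add: height_le_def coeff_pCons split: nat.splits)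
  from height_le_mult[OF this assms(2)] show ?thesis by simp
qed

lemma coeff_twist: "m > 0 \<Longrightarrow> coeff (twist m p) n = coeff p n ^ m"
  by (subst coeff_map_poly) (auto simp: zero_power)

lemma height_le_twist:
  assumes "height_le k F" "m > 0"
  shows "height_le (m * k) (twist m F :: 'a::idom poly poly)"
  using assms unfolding height_le_def by (auto simp: coeff_twist degree_power_eq degree_power_le
      intro!: order.trans[OF degree_power_le] simp: mult.commute[of m])

text \<open>
  The height is the logarithm of the Gauss norm at infinity. It is additive because the leading
  coefficients with respect to \<open>\<theta>\<close>, which are polynomials in \<open>t\<close>, multiply.
\<close>

lemma map_top_coeff_mult:
  fixes F G :: "'a::comm_semiring_0 poly poly"
  assumes "height_le m F" "height_le k G"
  shows "map_poly (\<lambda>x. coeff x (m + k)) (F * G) = map_poly (\<lambda>x. coeff x m) F * map_poly (\<lambda>x. coeff x k) G"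
proof (rule poly_eqI)
  have *: "coeff (a * b) (m + k) = coeff a m * coeff b k" if "degree a \<le> m" "degree b \<le> k" for a b :: "'a poly"
  proof -
    have "coeff a i * coeff b (m + k - i) = 0" if "i \<noteq> m" for i
    proof (cases "i < m")
      case True
      then have "coeff b (m + k - i) = 0" using \<open>degree b \<le> k\<close> by (intro coeff_eq_0) linarith
      then show ?thesis by simp
    next
      case False
      then have "coeff a i = 0" using that \<open>degree a \<le> m\<close> by (intro coeff_eq_0) linarith
      then show ?thesis by simp
    qed
    then have "(\<Sum>i\<le>m + k. coeff a i * coeff b (m + k - i))
        = (\<Sum>i\<in>{m}. coeff a i * coeff b (m + k - i))"
      by (intro sum.mono_neutral_right) auto
    then show ?thesis by (simp add: coeff_mult)
  qed
  fix n
  show "coeff (map_poly (\<lambda>x. coeff x (m + k)) (F * G)) n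
      = coeff (map_poly (\<lambda>x. coeff x m) F * map_poly (\<lambda>x. coeff x k) G) n"
    using assms
    by (simp add: coeff_map_poly coeff_mult[of F G] coeff_mult[of "map_poly _ F"] coeff_sum * height_le_def)
qed

lemma exact_height:
  assumes "F \<noteq> 0"
  obtains m n where "height_le m F" "coeff F n \<noteq> 0" "degree (coeff F n) = m"
proof -
  define D where "D = (\<lambda>n. degree (coeff F n)) ` {n. coeff F n \<noteq> 0}"
  have "{n. coeff F n \<noteq> 0} \<subseteq> {..degree F}" by (auto intro: le_degree)
  then have fin: "finite D" unfolding D_def by (intro finite_imageI) (rule finite_subset, auto)
  have "lead_coeff F \<noteq> 0" using assms by simp
  then have ne: "D \<noteq> {}" unfolding D_def by blast
  obtain n where "coeff F n \<noteq> 0" "degree (coeff F n) = Max D"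
    using Max_in[OF fin ne] by (auto simp: D_def)
  moreover have "degree (coeff F k) \<le> Max D" for k
    by (cases "coeff F k = 0") (use Max_ge[OF fin] in \<open>auto simp: D_def\<close>)
  ultimately show ?thesis using that[of "Max D" n] by (auto simp: height_le_def)
qed

lemma height_mult_ge:
  fixes F G :: "'a::idom poly poly"
  assumes "height_le m F" "coeff F i \<noteq> 0" "degree (coeff F i) = m"
    and "height_le k G" "coeff G j \<noteq> 0" "degree (coeff G j) = k"
    and "height_le B (F * G)"
  shows "m + k \<le> B"
proof (rule ccontr)
  assume "\<not> m + k \<le> B"
  then have "map_poly (\<lambda>x. coeff x (m + k)) (F * G) = 0"
    using assms(7) by (intro poly_eqI) (auto simp: coeff_map_poly height_le_def
        intro!: coeff_eq_0 intro: le_less_trans)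
  then have "map_poly (\<lambda>x. coeff x m) F = 0 \<or> map_poly (\<lambda>x. coeff x k) G = 0"
    using map_top_coeff_mult[OF assms(1,4)] by simp
  then show False
    using assms(2,3,5,6) coeff_map_poly[of "\<lambda>x. coeff x m" F i] coeff_map_poly[of "\<lambda>x. coeff x k" G j]
    by auto
qed

lemma ex_irreducible_dvd:
  fixes p :: "'a::field poly"
  assumes "degree p > 0"
  shows "\<exists>r. irreducible r \<and> r dvd p"
  using assms
proof (induction "degree p" arbitrary: p rule: less_induct)
  case less
  show ?case
  proof (cases "irreducible p")
    case False
    then obtain a b where ab: "p = a * b" "\<not> a dvd 1" "\<not> b dvd 1"
      using less.prems by (auto simp: irreducible_def is_unit_iff_degree)
    then have "a \<noteq> 0" "b \<noteq> 0" using less.prems by auto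
    then have "degree a > 0" "degree a < degree p"
      using ab by (auto simp: is_unit_iff_degree degree_mult_eq)
    from less.hyps[OF this(2,1)] show ?thesis using ab(1) by (auto intro: dvd_mult2)
  qed auto
qed

text \<open>
  A form of Gauss' lemma: an irreducible factor of \<open>d\<close> is prime as a constant polynomial and does not
  divide \<open>G\<close>, so it divides \<open>F\<close>, and it can be cancelled.
\<close>

lemma const_dvd_cancel:
  fixes d :: "'a::field poly"
  assumes "d \<noteq> 0" "[:d:] dvd F * G" "\<And>r. irreducible r \<Longrightarrow> r dvd d \<Longrightarrow> \<not> [:r:] dvd G"
  shows "[:d:] dvd F"
  using assms
proof (induction "degree d" arbitrary: d F rule: less_induct)
  case less
  show ?case
  proof (cases "degree d = 0")
    case True
    then have "d dvd 1" using less.prems(1) by (simp add: is_unit_iff_degree)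
    then show ?thesis by (simp add: const_poly_dvd_iff dvd_trans[of d 1])
  next
    case False
    then obtain r where r: "irreducible r" "r dvd d" using ex_irreducible_dvd[of d] by auto
    obtain e where e: "d = r * e" using r(2) by (rule dvdE)
    have "r \<noteq> 0" "\<not> r dvd 1" using r(1) by (auto simp: irreducible_def)
    then have "degree r > 0" by (simp add: is_unit_iff_degree)
    moreover have "e \<noteq> 0" using e less.prems(1) by auto
    ultimately have deg: "degree e < degree d" using e \<open>r \<noteq> 0\<close> by (simp add: degree_mult_eq)
    have split: "[:d:] = [:r:] * [:e:]" by (simp add: e)
    have "prime_elem [:r:]"
      by (intro lift_prime_elem_poly field_poly_irreducible_imp_prime r)
    moreover have "[:r:] dvd F * G" using less.prems(2) split by (metis dvd_mult_left)
    ultimately have "[:r:] dvd F"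
      using less.prems(3)[OF r] by (auto simp: prime_elem_dvd_mult_iff)
    then obtain F' where F': "F = [:r:] * F'" by (auto elim: dvdE)
    have "[:r:] * [:e:] dvd [:r:] * (F' * G)" using less.prems(2) split F' by (simp only: mult.assoc)
    moreover have "[:r:] \<noteq> 0" using \<open>r \<noteq> 0\<close> by simp
    ultimately have "[:e:] dvd F' * G" using dvd_mult_cancel_left[of "[:r:]"] by blast
    then have "[:e:] dvd F'"
      using less.hyps[OF deg \<open>e \<noteq> 0\<close>, of F'] less.prems(3) e by auto
    then show ?thesis unfolding split F' by (rule mult_dvd_mono[OF dvd_refl])
  qed
qed


text \<open>
  The map \<open>h\<close> stands for the embedding of \<open>F\<^sub>q[\<theta>]\<close> into \<open>C\<^sub>\<infinity>\<close>.
\<close>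

locale polynomial_embedding = inj_comm_ring_hom h
  for h :: "'f::{finite,field} poly \<Rightarrow> 'c::field" +
  fixes q :: nat
  assumes q_eq: "q = CARD('f)"
begin

lemma q_gt_1: "q > 1"
  unfolding q_eq by (rule card_field_gt_1)

lemma q_pos [simp]: "q > 0"
  using q_gt_1 by simp

lemma frobenius_hom: "comm_ring_hom (\<lambda>x::'c. x ^ q ^ k)"
  unfolding q_eq
proof (rule frobenius_iterate_hom)
  show "comm_ring_hom (\<lambda>c. h [:c:])"
    by standard (simp_all add: hom_add[symmetric] hom_mult[symmetric] one_poly_def[symmetric] mult.commute
        del: hom_add hom_mult)
qed

sublocale hp: map_poly_inj_comm_ring_hom h ..

lemma hp_twist: "map_poly h (twist (q ^ k) F) = twist (q ^ k) (map_poly h F)"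
  by (rule poly_eqI) (simp add: coeff_twist hom_power)

lemma twist_smult: "twist (q ^ k) (smult a F) = smult (a ^ q ^ k) (twist (q ^ k) (F :: 'c poly))"
  by (rule poly_eqI) (simp add: coeff_twist power_mult_distrib)

lemma hp_smult: "map_poly h (smult a F) = smult (h a) (map_poly h F)"
  by (rule poly_eqI) (simp add: coeff_map_poly hom_mult)

definition fraction_le :: "nat \<Rightarrow> 'c \<Rightarrow> bool" where
  "fraction_le H x \<longleftrightarrow> (\<exists>p s. s \<noteq> 0 \<and> degree p \<le> H \<and> degree s \<le> H \<and> x = h p / h s)"

text \<open>
  Write \<open>b = \<beta> / \<delta>\<close> in lowest terms and let \<open>Q = q\<^sup>S\<close>. Multiplication of the equation by \<open>\<delta>\<^sup>Q\<close> makes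
  every term except the top one divisible by \<open>\<delta>\<close>, since \<open>\<tau>\<^sup>s b\<close> has the denominator \<open>\<delta>\<close> to the power
  \<open>q\<^sup>s < Q\<close>. So \<open>\<delta>\<close> divides the product of \<open>c\<^sub>S\<close> and \<open>\<tau>\<^sup>S \<beta>\<close>, hence \<open>c\<^sub>S\<close>. The height of \<open>\<beta>\<close> is bounded in
  the same way: if it were large, the top term would have a larger height than all the others.
\<close>

lemma scalar_bound:
  fixes c :: "nat \<Rightarrow> 'f poly poly"
  assumes cS: "c S \<noteq> 0" and c: "\<And>s. s \<le> S \<Longrightarrow> height_le H (c s)" and G: "height_le H G"
    and \<delta>: "\<delta> \<noteq> 0" "smult (h \<delta>) b = map_poly h \<beta>"
    and eq: "(\<Sum>s\<le>S. map_poly h (c s) * twist (q ^ s) b) = map_poly h G"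
  shows "fraction_le (2 * H) (coeff b n)"
proof -
  define P where "P \<delta> \<beta> \<longleftrightarrow> \<delta> \<noteq> 0 \<and> smult (h \<delta>) b = map_poly h \<beta>" for \<delta> \<beta>
  have "\<exists>k \<delta> \<beta>. P \<delta> \<beta> \<and> degree \<delta> = k" using \<delta> by (auto simp: P_def)
  then obtain k where k: "\<exists>\<delta> \<beta>. P \<delta> \<beta> \<and> degree \<delta> = k"
    and k_min: "\<And>k'. k' < k \<Longrightarrow> \<not> (\<exists>\<delta> \<beta>. P \<delta> \<beta> \<and> degree \<delta> = k')"
    using exists_least_iff[of "\<lambda>k. \<exists>\<delta> \<beta>. P \<delta> \<beta> \<and> degree \<delta> = k"] by blast
  from k obtain d B where P: "P d B" "degree d = k" by blast
  then have d: "d \<noteq> 0" "smult (h d) b = map_poly h B" by (auto simp: P_def)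
  show ?thesis
  proof (cases "b = 0")
    case True
    then show ?thesis unfolding fraction_le_def by (intro exI[of _ 0] exI[of _ 1]) simp
  next
    case False
    then have "B \<noteq> 0" using d by auto
    have hd: "h d \<noteq> 0" using d by simp
    define Q where "Q = q ^ S"
    have qs: "q ^ s < Q" if "s < S" for s
      unfolding Q_def using that q_gt_1 by (intro power_strict_increasing)
    have twist_b: "smult (h d ^ q ^ s) (twist (q ^ s) b) = map_poly h (twist (q ^ s) B)" for s
      by (simp add: hp_twist d(2)[symmetric] twist_smult)
    have "map_poly h (\<Sum>s\<le>S. smult (d ^ (Q - q ^ s)) (c s * twist (q ^ s) B)) = map_poly h (smult (d ^ Q) G)"
    proof -
      have "smult (h d ^ (Q - q ^ s)) (map_poly h (c s) * map_poly h (twist (q ^ s) B))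
          = smult (h d ^ Q) (map_poly h (c s) * twist (q ^ s) b)" if "s \<le> S" for s
      proof -
        have "q ^ s \<le> Q" unfolding Q_def using that q_gt_1 by (intro power_increasing) auto
        then have "h d ^ Q = h d ^ (Q - q ^ s) * h d ^ q ^ s" by (simp add: power_add[symmetric])
        then show ?thesis by (simp add: twist_b[symmetric])
      qed
      then have "map_poly h (\<Sum>s\<le>S. smult (d ^ (Q - q ^ s)) (c s * twist (q ^ s) B))
          = (\<Sum>s\<le>S. smult (h d ^ Q) (map_poly h (c s) * twist (q ^ s) b))"
        by (simp add: hp.hom_sum hp_smult hp.hom_mult hom_power)
      also have "\<dots> = smult (h d ^ Q) (map_poly h G)" by (simp add: eq[symmetric] smult_sum2)
      finally show ?thesis by (simp add: hp_smult hom_power)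
    qed
    then have "(\<Sum>s\<le>S. smult (d ^ (Q - q ^ s)) (c s * twist (q ^ s) B)) = smult (d ^ Q) G"
      using hp.injectivity by blast
    moreover have "{..S} = insert S {..<S}" by auto
    ultimately have key: "c S * twist Q B = smult (d ^ Q) G
        - (\<Sum>s<S. smult (d ^ (Q - q ^ s)) (c s * twist (q ^ s) B))"
      by (simp add: Q_def[symmetric] algebra_simps)
    \<comment> \<open>a common prime factor of \<open>d\<close> and of the twist of \<open>B\<close> would divide \<open>B\<close>, against the minimality of \<open>d\<close>\<close>
    have const_dvd: "[:d:] dvd smult (d ^ m) F" if "m > 0" for m F
    proof -
      have "smult (d ^ m) F = [:d:] * smult (d ^ (m - 1)) F" using power_minus_mult[OF that, of d] by simp
      then show ?thesis by (rule dvdI)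
    qed
    have "[:d:] dvd c S * twist Q B"
      unfolding key using qs by (intro dvd_diff dvd_sum const_dvd) (auto simp: Q_def)
    then have "[:d:] dvd c S"
    proof (rule const_dvd_cancel[OF d(1)])
      fix r assume r: "irreducible r" "r dvd d"
      show "\<not> [:r:] dvd twist Q B"
      proof
        assume *: "[:r:] dvd twist Q B"
        have "r dvd coeff B n" for n
        proof -
          have "r dvd coeff B n ^ Q"
            using * by (simp add: const_poly_dvd_iff coeff_twist Q_def)
          then show ?thesis
            using field_poly_irreducible_imp_prime[OF r(1)] prime_elem_dvd_power by blast
        qed
        then have "[:r:] dvd B" by (simp add: const_poly_dvd_iff)
        then obtain B' where B': "B = smult r B'" by (auto elim: dvdE)
        obtain d' where d': "d = r * d'" using r(2) by (rule dvdE)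
        have "r \<noteq> 0" "\<not> r dvd 1" using r(1) by (auto simp: irreducible_def)
        then have "degree r > 0" by (simp add: is_unit_iff_degree)
        moreover have "d' \<noteq> 0" using d(1) d' by auto
        ultimately have "degree d' < k"
          using P(2) d' \<open>r \<noteq> 0\<close> by (simp add: degree_mult_eq)
        moreover have "smult (h r) (smult (h d') b) = smult (h r) (map_poly h B')"
          using d(2) by (simp add: d' B' hp_smult hom_mult)
        then have "smult (h d') b = map_poly h B'" using \<open>r \<noteq> 0\<close> by (simp add: smult_eq_iff)
        ultimately show False using k_min \<open>d' \<noteq> 0\<close> by (auto simp: P_def)
      qed
    qed
    then have "d dvd coeff (c S) (degree (c S))" by (simp add: const_poly_dvd_iff)
    then have "degree d \<le> degree (coeff (c S) (degree (c S)))" using cS by (intro dvd_imp_degree_le) auto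
    then have deg_d: "degree d \<le> H" using c[of S] by (auto simp: height_le_def intro: order_trans)
    \<comment> \<open>a height of \<open>B\<close> above \<open>H + degree d\<close> would make the top term larger than the rest of \<open>key\<close>\<close>
    obtain m i where m: "height_le m B" "coeff B i \<noteq> 0" "degree (coeff B i) = m"
      using exact_height[OF \<open>B \<noteq> 0\<close>] by blast
    obtain k j where k: "height_le k (c S)" "coeff (c S) j \<noteq> 0" "degree (coeff (c S) j) = k"
      using exact_height[OF cS] by blast
    have "Q > 0" by (simp add: Q_def)
    have "m \<le> H + degree d"
    proof (rule ccontr)
      assume "\<not> m \<le> H + degree d"
      then have m_gt: "H + degree d + 1 \<le> m" by simp
      have deg_pow: "degree (d ^ r) \<le> r * degree d" for r by (simp add: degree_power_eq d(1))
      have "height_le (Q * m - 1) (c S * twist Q B)"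
        unfolding key
      proof (intro height_le_minus height_le_sum)
        have "height_le (Q * degree d + H) (smult (d ^ Q) G)"
          by (intro height_le_smult deg_pow G)
        have "Q * (H + degree d + 1) \<le> Q * m" using m_gt by (rule mult_le_mono2)
        then have "Q * H + Q * degree d + Q \<le> Q * m" by (simp add: algebra_simps)
        moreover have "H \<le> Q * H" using \<open>Q > 0\<close> by simp
        ultimately have "Q * degree d + H \<le> Q * m - 1" using \<open>Q > 0\<close> by linarith
        with \<open>height_le (Q * degree d + H) (smult (d ^ Q) G)\<close>
        show "height_le (Q * m - 1) (smult (d ^ Q) G)" by (rule height_le_mono)
      next
        fix s assume s: "s \<in> {..<S}"
        define Qs where "Qs = q ^ s"
        have "Qs < Q" using qs s by (simp add: Qs_def)
        then obtain e where e: "Q = Qs + e" "e > 0" using less_imp_add_positive by blast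
        have "height_le (e * degree d + (H + Qs * m)) (smult (d ^ (Q - Qs)) (c s * twist Qs B))"
          using s m(1) by (intro height_le_smult height_le_mult height_le_twist c)
            (auto simp: e Qs_def deg_pow intro!: deg_pow)
        note height_summand = this
        have "e * (H + degree d + 1) \<le> e * m" using m_gt by (rule mult_le_mono2)
        then have "e * H + e * degree d + e + Qs * m \<le> Q * m" using e by (simp add: algebra_simps)
        moreover have "H \<le> e * H" using \<open>e > 0\<close> by simp
        ultimately have "e * degree d + (H + Qs * m) \<le> Q * m - 1" using \<open>e > 0\<close> by linarith
        with height_summand show "height_le (Q * m - 1) (smult (d ^ (Q - q ^ s)) (c s * twist (q ^ s) B))"
          unfolding Qs_def by (rule height_le_mono)
      qed
      moreover have "height_le (Q * m) (twist Q B)" by (intro height_le_twist m \<open>Q > 0\<close>)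
      moreover have "coeff (twist Q B) i \<noteq> 0" "degree (coeff (twist Q B) i) = Q * m"
        using m \<open>Q > 0\<close> by (simp_all add: coeff_twist degree_power_eq)
      ultimately have "k + Q * m \<le> Q * m - 1" by (intro height_mult_ge[OF k])
      moreover have "Q * m > 0" using m_gt \<open>Q > 0\<close> by simp
      ultimately show False by linarith
    qed
    then have "degree (coeff B n) \<le> 2 * H"
      using m(1) deg_d by (auto simp: height_le_def intro: order_trans[of _ m])
    moreover have "h d * coeff b n = h (coeff B n)"
      using arg_cong[OF d(2), of "\<lambda>p. coeff p n"] by (simp add: coeff_map_poly)
    then have "coeff b n = h (coeff B n) / h d" using hd by (simp add: field_simps)
    ultimately show ?thesis
      using d(1) deg_d unfolding fraction_le_def by (intro exI[of _ "coeff B n"] exI[of _ d]) simp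
  qed
qed

end

section \<open>Eliminating all unknowns but one\<close>

text \<open>
  The parameters of the elimination, for \<open>N\<close> equations of order at most \<open>r\<close> in \<open>\<tau>\<close> with coefficients of
  height at most \<open>H\<close>: the number of coefficients of each entry of the eliminating operator, the number
  of coefficients that have to vanish, and the height of the eliminating operator. The length is
  chosen to leave more unknowns than conditions over \<open>K(t)\<close>; the height is chosen so that the
  same remains true for a count over \<open>F\<^sub>q\<close> (\<open>elim_count\<close>).
\<close>

definition elim_length :: "nat \<Rightarrow> nat \<Rightarrow> nat" where
  "elim_length N r = N * r + 1"

definition elim_conditions :: "nat \<Rightarrow> nat \<Rightarrow> nat" where
  "elim_conditions N r = (elim_length N r + r) * (N - 1)"

definition elim_height :: "nat \<Rightarrow> nat \<Rightarrow> nat \<Rightarrow> nat \<Rightarrow> nat" where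
  "elim_height q N r H = 4 * elim_conditions N r * (q ^ elim_length N r * H) + 1"

definition solution_height :: "nat \<Rightarrow> nat \<Rightarrow> nat \<Rightarrow> nat \<Rightarrow> nat" where
  "solution_height q N r H = 2 * (elim_height q N r H + q ^ elim_length N r * H)"

text \<open>
  Here \<open>Y\<close> and \<open>X\<close> are strict bounds for the degrees of the unknown coefficients in \<open>t\<close> and \<open>\<theta>\<close>; the coefficients that
  have to vanish have degrees up to \<open>Y\<close> and below \<open>X + g\<close>.
\<close>

lemma elim_count:
  assumes "N > 0" "C = elim_conditions N r" "M = elim_length N r"
    and that: "Y = 2 * C + 1" "X = 4 * C * g + 1"
  shows "(M + r) * (N - 1) * (Y + 1) * (X + g) < M * N * Y * X"
proof -
  have C: "C = (M + r) * (N - 1)" using assms by (simp add: elim_conditions_def)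
  have "C + 1 \<le> M * N"
  proof -
    obtain n where n: "N = Suc n" using assms(1) by (cases N) auto
    have "M = n * r + r + 1" using assms(3) by (simp add: elim_length_def n)
    then show ?thesis unfolding C n by (simp add: algebra_simps)
  qed
  have "C * (Y + 1) * (X + g) < (C + 1) * Y * X"
  proof -
    have pos: "X > 0" "Y > 0" using that by simp_all
    have "C * g * 1 \<le> C * g * Y" using pos by (intro mult_le_mono2) simp
    then have *: "2 * (C * g) \<le> 2 * (C * g * Y)" by linarith
    have "2 * (C * (g * Y + X + g)) = 2 * (C * g * Y) + 2 * (C * X) + 2 * (C * g)"
      by (simp only: distrib_left mult.assoc)
    also have "\<dots> < 2 * (C * X) + X + (2 * (C * g * Y) + 2 * (C * g * Y) + Y)"
      using * pos by linarith
    also have "\<dots> = (2 * C + 1) * X + (4 * C * g + 1) * Y"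
      by (simp only: distrib_right mult.assoc mult_1)
    also have "\<dots> = 2 * (Y * X)" unfolding that[symmetric] by (simp only: mult.commute[of X Y] mult_2)
    finally have "C * (g * Y + X + g) < Y * X" by (simp only: mult_less_cancel1)
    then have less: "C * (Y * X) + C * (g * Y + X + g) < C * (Y * X) + Y * X"
      by (rule add_strict_left_mono)
    have expand: "C * (Y + 1) * (X + g) = C * (Y * X) + C * (g * Y + X + g)"
      by (simp add: distrib_left distrib_right mult_ac)
    have expand': "(C + 1) * Y * X = C * (Y * X) + Y * X"
      by (simp add: distrib_left distrib_right mult_ac)
    show ?thesis unfolding expand expand' by (rule less)
  qed
  also have "\<dots> \<le> M * N * Y * X" using \<open>C + 1 \<le> M * N\<close> by (intro mult_le_mono) auto
  finally show ?thesis by (simp add: C)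
qed

lemma map_poly_pCons_pair:
  "(m::nat) > 0 \<Longrightarrow> twist m [:a, b:] = [:a ^ m, b ^ m:]"
  by (rule poly_eqI) (auto simp: coeff_twist coeff_pCons zero_power split: nat.splits)

context polynomial_embedding
begin

text \<open>
  The coefficient of \<open>\<tau>\<^sup>s\<close> in column \<open>c\<close> of the product \<open>(\<Sum>\<^sub>i u\<^sub>i \<tau>\<^sup>i) (\<Sum>\<^sub>j \<Psi>\<^sub>j \<tau>\<^sup>j)\<close> of a row of twisted
  polynomials with a matrix of twisted polynomials.
\<close>

definition operator_coeff ::
  "'i set \<Rightarrow> nat \<Rightarrow> nat \<Rightarrow> (nat \<Rightarrow> 'i \<Rightarrow> 'i \<Rightarrow> 'f poly poly) \<Rightarrow> (nat \<Rightarrow> 'i \<Rightarrow> 'f poly poly)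
     \<Rightarrow> nat \<Rightarrow> 'i \<Rightarrow> 'f poly poly" where
  "operator_coeff I M r \<Psi> u s c =
     (\<Sum>i<M. \<Sum>j\<le>r. if i + j = s then \<Sum>k\<in>I. u i k * twist (q ^ i) (\<Psi> j k c) else 0)"

lemma operator_coeff_diff:
  "operator_coeff I M r \<Psi> (\<lambda>i k. u i k - v i k) s c =
    operator_coeff I M r \<Psi> u s c - operator_coeff I M r \<Psi> v s c"
  unfolding operator_coeff_def sum_subtractf[symmetric]
  by (intro sum.cong refl) (simp add: left_diff_distrib sum_subtractf)

lemma operator_coeff_beyond: "s \<ge> M + r \<Longrightarrow> operator_coeff I M r \<Psi> u s c = 0"
  unfolding operator_coeff_def by (intro sum.neutral ballI) auto

lemma height_operator_coeff:
  assumes "\<And>i k. height_le X (u i k)" "\<And>j k. height_le H (\<Psi> j k c)"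
  shows "height_le (X + q ^ M * H) (operator_coeff I M r \<Psi> u s c)"
  unfolding operator_coeff_def
proof (intro height_le_sum)
  fix i j assume i: "i \<in> {..<M}"
  have "height_le (X + q ^ M * H) (u i k * twist (q ^ i) (\<Psi> j k c))" for k
  proof (intro height_le_mult assms)
    have "height_le (q ^ i * H) (twist (q ^ i) (\<Psi> j k c))"
      by (intro height_le_twist assms) simp
    moreover have "q ^ i \<le> q ^ M" using i q_gt_1 by (intro power_increasing) auto
    ultimately show "height_le (q ^ M * H) (twist (q ^ i) (\<Psi> j k c))"
      by (rule height_le_mono[OF _ mult_le_mono1])
  qed
  then show "height_le (X + q ^ M * H)
      (if i + j = s then \<Sum>k\<in>I. u i k * twist (q ^ i) (\<Psi> j k c) else 0)"
    by (auto intro: height_le_sum)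
qed

lemma degree_operator_coeff:
  assumes "\<And>i k. degree (u i k) \<le> Y" "\<And>j k. \<Psi> j k c = [:\<alpha> j k, \<gamma> j k:]"
  shows "degree (operator_coeff I M r \<Psi> u s c) \<le> Y + 1"
  unfolding operator_coeff_def
proof (intro degree_sum_le)
  fix i j
  have "degree (u i k * twist (q ^ i) (\<Psi> j k c)) \<le> Y + 1" for k
  proof -
    have "degree (u i k * twist (q ^ i) (\<Psi> j k c)) \<le> degree (u i k) + degree (twist (q ^ i) (\<Psi> j k c))"
      by (rule degree_mult_le)
    also have "\<dots> \<le> Y + 1" using assms(1)
      by (intro add_mono) (simp_all add: assms(2) map_poly_pCons_pair)
    finally show ?thesis .
  qed
  then show "degree (if i + j = s then \<Sum>k\<in>I. u i k * twist (q ^ i) (\<Psi> j k c) else 0) \<le> Y + 1"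
    by (cases "finite I") (auto intro: degree_sum_le)
qed auto

text \<open>
  There are more rows \<open>u\<close> with coefficients in a box than there are possible values for the
  coefficients of \<open>u \<Psi>\<close> outside column \<open>k0\<close>. Two different rows with the same values exist, and their
  difference has the desired property.
\<close>

lemma ex_eliminating_operator:
  fixes I :: "'i set" and \<Psi> :: "nat \<Rightarrow> 'i \<Rightarrow> 'i \<Rightarrow> 'f poly poly"
  assumes I: "finite I" "k0 \<in> I"
    and \<Psi>: "\<And>j k c. \<Psi> j k c = [:\<alpha> j k c, \<gamma> j k c:]" "\<And>j k c. height_le H (\<Psi> j k c)"
    and M: "M = elim_length (card I) r" and X: "X = elim_height q (card I) r H"
  shows "\<exists>u. (\<forall>i k. height_le X (u i k)) \<and> (\<exists>i<M. \<exists>k\<in>I. u i k \<noteq> 0) \<and>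
    (\<forall>s. \<forall>c\<in>I - {k0}. operator_coeff I M r \<Psi> u s c = 0)"
proof -
  define N where "N = card I"
  have N: "N > 0" using I by (auto simp: N_def card_gt_0_iff)
  define C where "C = elim_conditions N r"
  define g where "g = q ^ M * H"
  define Y where "Y = 2 * C + 1"
  have X': "X = 4 * C * g + 1" by (simp add: X elim_height_def C_def g_def M N_def)
  define U where "U = {..<M} \<times> I \<times> {..<Y} \<times> {..<X}"
  define V where "V = {..<M + r} \<times> (I - {k0}) \<times> {..Y} \<times> {..<X + g}"
  define poly_of :: "(nat \<times> 'i \<times> nat \<times> nat \<Rightarrow> 'f) \<Rightarrow> nat \<Rightarrow> 'i \<Rightarrow> 'f poly poly" where
    "poly_of f i k = (\<Sum>y<Y. monom (\<Sum>x<X. monom (f (i, k, y, x)) x) y)" for f i k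
  have coeff_poly_of: "coeff (coeff (poly_of f i k) y) x = (if y < Y \<and> x < X then f (i, k, y, x) else 0)"
    for f i k y x
    by (simp add: poly_of_def coeff_sum if_distrib[of "\<lambda>p. coeff p x"] cong: if_cong)
  have height_poly_of: "height_le (X - 1) (poly_of f i k)" for f i k
    unfolding height_le_def by (auto intro!: degree_le simp: coeff_poly_of)
  have degree_poly_of: "degree (poly_of f i k) \<le> Y - 1" for f i k
    by (rule degree_le) (auto intro!: poly_eqI simp: coeff_poly_of)
  define T where "T = (\<lambda>f. restrict (\<lambda>(s, c, y, x).
      coeff (coeff (operator_coeff I M r \<Psi> (poly_of f) s c) y) x) V)"
  define S where "S = (U \<rightarrow>\<^sub>E (UNIV :: 'f set))"
  have finU: "finite U" and finV: "finite V" using I by (auto simp: U_def V_def)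
  have cardU: "card U = M * N * Y * X" by (simp add: U_def N_def card_cartesian_product)
  have cardV: "card V = (M + r) * (N - 1) * (Y + 1) * (X + g)"
    using I by (simp add: V_def N_def card_cartesian_product distrib_left distrib_right)
  have "card V < card U"
    unfolding cardU cardV using N X' by (intro elim_count[of N C r]) (auto simp: C_def M N_def Y_def)
  then have less: "q ^ card V < q ^ card U" using q_gt_1 by (intro power_strict_increasing) auto
  have "\<not> inj_on T S"
  proof
    assume "inj_on T S"
    moreover have "T ` S \<subseteq> V \<rightarrow>\<^sub>E (UNIV :: 'f set)" by (auto simp: T_def)
    moreover have "finite (V \<rightarrow>\<^sub>E (UNIV :: 'f set))" by (intro finite_PiE finV) auto
    ultimately have "card S \<le> card (V \<rightarrow>\<^sub>E (UNIV :: 'f set))" by (rule card_inj_on_le)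
    then show False using less finU finV by (simp add: S_def card_PiE q_eq)
  qed
  then obtain f f' where f: "f \<in> S" "f' \<in> S" "f \<noteq> f'" "T f = T f'" by (auto simp: inj_on_def)
  define u where "u = (\<lambda>i k. poly_of f i k - poly_of f' i k)"
  obtain z where z: "f z \<noteq> f' z" using f(3) by blast
  have "z \<in> U" using z PiE_arb[of f U _ z] PiE_arb[of f' U _ z] f(1,2) unfolding S_def by metis
  then obtain i k y x where z_eq: "z = (i, k, y, x)" and ik: "i < M" "k \<in> I" "y < Y" "x < X"
    by (auto simp: U_def)
  have "coeff (coeff (u i k) y) x \<noteq> 0" using z z_eq ik by (simp add: u_def coeff_poly_of)
  then have "u i k \<noteq> 0" by auto
  moreover have "height_le X (u i k)" for i k
    unfolding u_def by (intro height_le_minus height_le_mono[OF height_poly_of]) auto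
  moreover have "operator_coeff I M r \<Psi> u s c = 0" if c: "c \<in> I - {k0}" for s c
  proof -
    have "coeff (coeff (operator_coeff I M r \<Psi> (poly_of f) s c) y) x
        = coeff (coeff (operator_coeff I M r \<Psi> (poly_of f') s c) y) x" for y x
    proof (cases "(s, c, y, x) \<in> V")
      case True
      then show ?thesis using fun_cong[OF f(4), of "(s, c, y, x)"] by (simp add: T_def)
    next
      case False
      have "coeff (coeff (operator_coeff I M r \<Psi> (poly_of f) s c) y) x = 0" for f
      proof -
        have h: "height_le (X - 1 + g) (operator_coeff I M r \<Psi> (poly_of f) s c)"
          unfolding g_def by (intro height_operator_coeff height_poly_of \<Psi>)
        have d: "degree (operator_coeff I M r \<Psi> (poly_of f) s c) \<le> Y - 1 + 1"
          by (rule degree_operator_coeff[where \<alpha> = "\<lambda>j k. \<alpha> j k c" and \<gamma> = "\<lambda>j k. \<gamma> j k c"])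
            (rule degree_poly_of, rule \<Psi>(1))
        have "s \<ge> M + r \<or> y > Y \<or> x \<ge> X + g" using False c by (auto simp: V_def)
        then show ?thesis
        proof (elim disjE)
          assume "y > Y"
          then show ?thesis using d by (subst coeff_eq_0[of _ y]) (auto simp: Y_def)
        next
          assume "x \<ge> X + g"
          then have "degree (coeff (operator_coeff I M r \<Psi> (poly_of f) s c) y) < x"
            using h X' by (auto simp: height_le_def intro: le_less_trans)
          then show ?thesis by (rule coeff_eq_0)
        qed (simp add: operator_coeff_beyond)
      qed
      then show ?thesis by simp
    qed
    then show ?thesis unfolding u_def operator_coeff_diff by (intro poly_eqI) simp
  qed
  ultimately show ?thesis using ik(1,2) by blast
qed


lemma twist_hom: "map_poly_comm_ring_hom (\<lambda>x::'c. x ^ q ^ k)"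
  by (intro map_poly_comm_ring_hom.intro frobenius_hom)

lemma twist_mult: "twist (q ^ k) (F * G :: 'c poly) = twist (q ^ k) F * twist (q ^ k) G"
proof -
  interpret tw: map_poly_comm_ring_hom "\<lambda>x::'c. x ^ q ^ k" by (rule twist_hom)
  show ?thesis by (rule tw.hom_mult)
qed

lemma twist_sum: "twist (q ^ k) (\<Sum>i\<in>S. F i :: 'c poly) = (\<Sum>i\<in>S. twist (q ^ k) (F i))"
proof -
  interpret tw: map_poly_comm_ring_hom "\<lambda>x::'c. x ^ q ^ k" by (rule twist_hom)
  show ?thesis by (rule tw.hom_sum)
qed

lemma twist_twist: "twist (q ^ i) (twist (q ^ j) F) = twist (q ^ (i + j)) (F :: 'c poly)"
  by (rule poly_eqI) (simp add: coeff_twist power_add mult.commute flip: power_mult)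

text \<open>
  Applying the operator \<open>u\<close> to the equations of a system gives the equation with operator \<open>u \<Psi>\<close>.
\<close>

lemma operator_coeff_apply:
  fixes b :: "'i \<Rightarrow> 'c poly"
  assumes "\<And>k. k \<in> I \<Longrightarrow> (\<Sum>j\<le>r. \<Sum>c\<in>I. map_poly h (\<Psi> j k c) * twist (q ^ j) (b c)) = map_poly h (g k)"
  shows "(\<Sum>s<M + r. \<Sum>c\<in>I. map_poly h (operator_coeff I M r \<Psi> u s c) * twist (q ^ s) (b c))
    = map_poly h (\<Sum>i<M. \<Sum>k\<in>I. u i k * twist (q ^ i) (g k))" (is "?L = ?R")
proof -
  define f where "f i j k c = map_poly h (u i k * twist (q ^ i) (\<Psi> j k c)) * twist (q ^ (i + j)) (b c)"
    for i j k c
  have "?R = (\<Sum>i<M. \<Sum>k\<in>I. map_poly h (u i k) *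
      twist (q ^ i) (\<Sum>j\<le>r. \<Sum>c\<in>I. map_poly h (\<Psi> j k c) * twist (q ^ j) (b c)))"
    by (simp add: hp.hom_sum hp.hom_mult hp_twist assms)
  also have "\<dots> = (\<Sum>i<M. \<Sum>k\<in>I. \<Sum>j\<le>r. \<Sum>c\<in>I. f i j k c)"
    by (simp add: f_def twist_sum twist_mult twist_twist sum_distrib_left hp.hom_mult hp_twist mult.assoc)
  finally have R: "?R = (\<Sum>i<M. \<Sum>k\<in>I. \<Sum>j\<le>r. \<Sum>c\<in>I. f i j k c)" .
  have "?L = (\<Sum>s<M + r. \<Sum>c\<in>I. \<Sum>i<M. \<Sum>j\<le>r. if i + j = s then \<Sum>k\<in>I. f i j k c else 0)"
    by (intro sum.cong refl)
      (auto simp: operator_coeff_def f_def hp.hom_sum sum_distrib_right if_distrib[of "map_poly h"]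
        intro!: sum.cong)
  also have "\<dots> = (\<Sum>c\<in>I. \<Sum>s<M + r. \<Sum>i<M. \<Sum>j\<le>r. if i + j = s then \<Sum>k\<in>I. f i j k c else 0)"
    by (rule sum.swap)
  also have "\<dots> = (\<Sum>c\<in>I. \<Sum>i<M. \<Sum>s<M + r. \<Sum>j\<le>r. if i + j = s then \<Sum>k\<in>I. f i j k c else 0)"
    by (rule sum.cong[OF refl], rule sum.swap)
  also have "\<dots> = (\<Sum>c\<in>I. \<Sum>i<M. \<Sum>j\<le>r. \<Sum>s<M + r. if i + j = s then \<Sum>k\<in>I. f i j k c else 0)"
    by (rule sum.cong[OF refl], rule sum.cong[OF refl], rule sum.swap)
  also have "\<dots> = (\<Sum>c\<in>I. \<Sum>i<M. \<Sum>j\<le>r. \<Sum>k\<in>I. f i j k c)"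
    by (intro sum.cong refl) (auto simp: sum.delta)
  also have "\<dots> = (\<Sum>i<M. \<Sum>c\<in>I. \<Sum>j\<le>r. \<Sum>k\<in>I. f i j k c)" by (rule sum.swap)
  also have "\<dots> = (\<Sum>i<M. \<Sum>k\<in>I. \<Sum>j\<le>r. \<Sum>c\<in>I. f i j k c)"
  proof (rule sum.cong[OF refl])
    fix i
    have "(\<Sum>c\<in>I. \<Sum>j\<le>r. \<Sum>k\<in>I. f i j k c) = (\<Sum>j\<le>r. \<Sum>c\<in>I. \<Sum>k\<in>I. f i j k c)"
      by (rule sum.swap)
    also have "\<dots> = (\<Sum>j\<le>r. \<Sum>k\<in>I. \<Sum>c\<in>I. f i j k c)"
      by (rule sum.cong[OF refl], rule sum.swap)
    also have "\<dots> = (\<Sum>k\<in>I. \<Sum>j\<le>r. \<Sum>c\<in>I. f i j k c)" by (rule sum.swap)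
    finally show "(\<Sum>c\<in>I. \<Sum>j\<le>r. \<Sum>k\<in>I. f i j k c) = (\<Sum>k\<in>I. \<Sum>j\<le>r. \<Sum>c\<in>I. f i j k c)" .
  qed
  finally show ?thesis using R by simp
qed

text \<open>
  Take the lowest power \<open>\<tau>\<^sup>m\<close> in \<open>u\<close> and, among the entries of its coefficient, one of maximal degree \<open>y\<close> in
  \<open>t\<close>, say in column \<open>c\<close>. The coefficient of \<open>\<tau>\<^sup>m t\<^sup>y\<^sup>+\<^sup>1\<close> in column \<open>c\<close> of the product then comes only from the
  term \<open>\<gamma> t\<close> on the diagonal of \<open>\<Psi>\<^sub>0\<close>.
\<close>

lemma operator_coeff_nonzero:
  assumes I: "finite I" and u: "i < M" "k \<in> I" "u i k \<noteq> 0"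
    and \<Psi>: "\<And>j k c. \<Psi> j k c = [:\<alpha> j k c, if j = 0 \<and> k = c then \<gamma> else 0:]" and "\<gamma> \<noteq> 0"
  shows "\<exists>s<M + r. \<exists>c\<in>I. operator_coeff I M r \<Psi> u s c \<noteq> 0"
proof -
  let ?P = "\<lambda>i. i < M \<and> (\<exists>k\<in>I. u i k \<noteq> 0)"
  obtain m where m: "?P m" "\<And>i. i < m \<Longrightarrow> \<not> ?P i"
    using exists_least_iff[of ?P] u by blast
  define K where "K = {k \<in> I. u m k \<noteq> 0}"
  have K: "finite K" "K \<noteq> {}" using m(1) I by (auto simp: K_def)
  define y where "y = Max ((\<lambda>k. degree (u m k)) ` K)"
  have "y \<in> (\<lambda>k. degree (u m k)) ` K" unfolding y_def using K by (intro Max_in) auto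
  then obtain c where c: "c \<in> K" "degree (u m c) = y" by auto
  have y_max: "degree (u m k) \<le> y" if "k \<in> I" for k
    using that K by (cases "u m k = 0") (auto simp: y_def K_def)
  have zero: "u i k = 0" if "i < m" "k \<in> I" for i k
    using m(2)[OF that(1)] m(1) that by auto
  have "operator_coeff I M r \<Psi> u m c = (\<Sum>i<M. \<Sum>j\<le>r. if i = m \<and> j = 0
      then \<Sum>k\<in>I. u m k * twist (q ^ m) (\<Psi> 0 k c) else 0)"
    unfolding operator_coeff_def
    by (intro sum.cong refl) (auto simp: zero intro!: sum.neutral)
  also have "\<dots> = (\<Sum>i<M. if i = m then \<Sum>k\<in>I. u m k * twist (q ^ m) (\<Psi> 0 k c) else 0)"
    by (intro sum.cong refl) (simp add: sum.delta')
  also have "\<dots> = (\<Sum>k\<in>I. u m k * twist (q ^ m) (\<Psi> 0 k c))"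
    using m(1) by (simp add: sum.delta')
  finally have "coeff (operator_coeff I M r \<Psi> u m c) (Suc y)
      = (\<Sum>k\<in>I. coeff (u m k * twist (q ^ m) (\<Psi> 0 k c)) (Suc y))" by (simp add: coeff_sum)
  also have "\<dots> = (\<Sum>k\<in>I. if k = c then coeff (u m c) y * \<gamma> ^ q ^ m else 0)"
  proof (intro sum.cong refl)
    fix k assume k: "k \<in> I"
    have "coeff (u m k) (Suc y) = 0" using y_max[OF k] by (intro coeff_eq_0) simp
    then show "coeff (u m k * twist (q ^ m) (\<Psi> 0 k c)) (Suc y)
        = (if k = c then coeff (u m c) y * \<gamma> ^ q ^ m else 0)"
      by (simp add: \<Psi> map_poly_pCons_pair zero_power mult.commute)
  qed
  also have "\<dots> = coeff (u m c) y * \<gamma> ^ q ^ m" using c I by (simp add: K_def)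
  also have "\<dots> \<noteq> 0" using c \<open>\<gamma> \<noteq> 0\<close> by (auto simp: K_def)
  finally have "operator_coeff I M r \<Psi> u m c \<noteq> 0" by auto
  moreover have "m < M + r" "c \<in> I" using m(1) c by (auto simp: K_def)
  ultimately show ?thesis by blast
qed

text \<open>
  An eliminating operator for the coordinate \<open>k0\<close> reduces the system to a scalar equation. The factor
  \<open>D\<close> is a common denominator of the matrices of the system.
\<close>

lemma system_bound:
  fixes b :: "'i \<Rightarrow> 'c poly"
  assumes I: "finite I" "k0 \<in> I"
    and D: "D \<noteq> 0" "degree D \<le> H" and A: "\<And>j k c. degree (A j k c) \<le> H"
    and g: "\<And>k. height_le H (g k)"
    and frac: "\<delta> \<noteq> 0" "smult (h \<delta>) (b k0) = map_poly h \<beta>"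
    and eq: "\<And>k. k \<in> I \<Longrightarrow> (\<Sum>j\<le>r. \<Sum>c\<in>I. smult (h (A j k c)) (twist (q ^ j) (b c)))
      - smult (h D) (pCons 0 (b k)) = map_poly h (g k)"
  shows "fraction_le (solution_height q (card I) r H) (coeff (b k0) n)"
proof -
  define N where "N = card I"
  define M where "M = elim_length N r"
  define X where "X = elim_height q N r H"
  define \<Psi> where "\<Psi> = (\<lambda>j k c. [:A j k c, if j = 0 \<and> k = c then - D else 0:])"
  have height_\<Psi>: "height_le H (\<Psi> j k c)" for j k c
    using A D(2) by (auto simp: height_le_def \<Psi>_def coeff_pCons split: nat.splits)
  obtain u where u: "\<And>i k. height_le X (u i k)" "\<exists>i<M. \<exists>k\<in>I. u i k \<noteq> 0"
    and u0: "\<And>s c. c \<in> I - {k0} \<Longrightarrow> operator_coeff I M r \<Psi> u s c = 0"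
    using ex_eliminating_operator[OF I, where \<Psi> = \<Psi> and \<alpha> = A and H = H and r = r and M = M
        and X = X and \<gamma> = "\<lambda>j k c. if j = 0 \<and> k = c then - D else 0", OF _ height_\<Psi>]
    unfolding M_def N_def X_def \<Psi>_def by blast
  have row: "(\<Sum>j\<le>r. \<Sum>c\<in>I. map_poly h (\<Psi> j k c) * twist (q ^ j) (b c)) = map_poly h (g k)"
    if k: "k \<in> I" for k
  proof -
    have "(\<Sum>j\<le>r. \<Sum>c\<in>I. map_poly h (\<Psi> j k c) * twist (q ^ j) (b c))
      = (\<Sum>j\<le>r. \<Sum>c\<in>I. smult (h (A j k c)) (twist (q ^ j) (b c)))
        + (\<Sum>j\<le>r. \<Sum>c\<in>I. if c = k then if j = 0 then - smult (h D) (pCons 0 (b k)) else 0 else 0)"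
      unfolding sum.distrib[symmetric]
    proof (intro sum.cong refl)
      fix j c
      have [simp]: "map_poly h [:a, e:] = [:h a, h e:]" "map_poly h [:a:] = [:h a:]" for a e
        by (rule poly_eqI, simp add: coeff_map_poly coeff_pCons split: nat.splits)+
      have [simp]: "twist (Suc 0) (b k) = b k" by (rule poly_eqI) (simp add: coeff_twist)
      show "map_poly h (\<Psi> j k c) * twist (q ^ j) (b c) = smult (h (A j k c)) (twist (q ^ j) (b c))
        + (if c = k then if j = 0 then - smult (h D) (pCons 0 (b k)) else 0 else 0)"
        by (auto simp: \<Psi>_def hom_uminus)
    qed
    also have "\<dots> = map_poly h (g k)"
      using k I(1) by (simp add: sum.delta eq[OF k, symmetric])
    finally show ?thesis .
  qed
  define T where "T = (\<lambda>s. operator_coeff I M r \<Psi> u s k0)"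
  define G where "G = (\<Sum>i<M. \<Sum>k\<in>I. u i k * twist (q ^ i) (g k))"
  have "(\<Sum>c\<in>I. map_poly h (operator_coeff I M r \<Psi> u s c) * twist (q ^ s) (b c))
      = map_poly h (T s) * twist (q ^ s) (b k0)" for s
    using I u0 by (subst sum.remove[OF I]) (simp add: T_def sum.neutral)
  then have scalar: "(\<Sum>s<M + r. map_poly h (T s) * twist (q ^ s) (b k0)) = map_poly h G"
    using operator_coeff_apply[where I = I and r = r and \<Psi> = \<Psi> and b = b and g = g and M = M and u = u, OF row] by (simp add: G_def)
  obtain i k where ik: "i < M" "k \<in> I" "u i k \<noteq> 0" using u(2) by blast
  obtain s c where s: "s < M + r" "c \<in> I" "operator_coeff I M r \<Psi> u s c \<noteq> 0"
    using operator_coeff_nonzero[where I = I and i = i and M = M and k = k and u = u and \<Psi> = \<Psi>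
        and \<alpha> = A and \<gamma> = "- D" and r = r] I ik D(1) by (auto simp: \<Psi>_def)
  then have "T s \<noteq> 0" using u0[of c s] by (cases "c = k0") (auto simp: T_def)
  define S where "S = Max {s. s < M + r \<and> T s \<noteq> 0}"
  have "S \<in> {s. s < M + r \<and> T s \<noteq> 0}"
    unfolding S_def using s(1) \<open>T s \<noteq> 0\<close> by (intro Max_in) auto
  then have S: "S < M + r" "T S \<noteq> 0" by auto
  have S_max: "T s = 0" if "s < M + r" "S < s" for s
  proof (rule ccontr)
    assume "T s \<noteq> 0"
    then have "s \<le> S" unfolding S_def using that(1) by (intro Max_ge) auto
    then show False using that(2) by simp
  qed
  have "(\<Sum>s\<le>S. map_poly h (T s) * twist (q ^ s) (b k0)) = map_poly h G"
    unfolding scalar[symmetric] using S(1) S_max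
    by (intro sum.mono_neutral_left) (auto simp: not_le)
  moreover have "height_le (X + q ^ M * H) (T s)" for s
    unfolding T_def by (intro height_operator_coeff u height_\<Psi>)
  moreover have "height_le (X + q ^ M * H) G"
    unfolding G_def
  proof (intro height_le_sum height_le_mult u)
    fix i k assume "i \<in> {..<M}"
    then have "q ^ i * H \<le> q ^ M * H" using q_gt_1 by (intro mult_le_mono1 power_increasing) auto
    with height_le_twist[OF g] show "height_le (q ^ M * H) (twist (q ^ i) (g k))"
      by (rule height_le_mono) simp
  qed
  ultimately have "fraction_le (2 * (X + q ^ M * H)) (coeff (b k0) n)"
    using frac S(2) by (intro scalar_bound[where c = T and S = S and G = G and \<delta> = \<delta> and \<beta> = \<beta>])
  then show ?thesis by (simp add: solution_height_def X_def M_def N_def)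
qed

end

section \<open>Coordinates over the rational function field\<close>

definition eval_theta :: "('f::field fls \<Rightarrow> 'c::field) \<Rightarrow> 'f poly \<Rightarrow> 'c" where
  "eval_theta emb p = poly (map_poly (const emb) p) (theta emb)"

lemma ratfun_eq: "ratfun emb (p, s) = eval_theta emb p / eval_theta emb s"
  by (simp add: ratfun_def eval_theta_def)

text \<open>
  The element \<open>\<theta>\<close> is transcendental: in a polynomial in \<open>\<theta>\<close> the coefficients can be read off from the
  Laurent series.
\<close>

lemma eval_theta_embedding:
  assumes "field_hom (emb :: 'f::{finite,field} fls \<Rightarrow> 'c::field)"
  shows "polynomial_embedding (eval_theta emb) CARD('f)"
proof -
  interpret field_hom emb by fact
  have const_hom: "comm_ring_hom (const emb)"
    by standard (simp_all add: const_def hom_distribs fls_plus_const[symmetric] fls_const_mult_const[symmetric]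
        del: fls_const_mult_const)
  interpret c: map_poly_comm_ring_hom "const emb" by (intro map_poly_comm_ring_hom.intro const_hom)
  have inj: "p = 0" if "eval_theta emb p = 0" for p
  proof -
    have "eval_theta emb p = (\<Sum>i\<le>degree p. theta emb ^ i * const emb (coeff p i))"
      unfolding eval_theta_def eval_poly_def[symmetric] by (rule eval_poly_as_sum) (simp add: const_def)
    also have "\<dots> = emb (\<Sum>i\<le>degree p. fls_const (coeff p i) * fls_X_inv ^ i)"
      by (simp add: hom_sum hom_mult hom_power const_def theta_def mult.commute)
    finally have "(\<Sum>i\<le>degree p. fls_const (coeff p i) * fls_X_inv ^ i) = 0"
      using that by simp
    then have "fls_nth (\<Sum>i\<le>degree p. fls_const (coeff p i) * fls_X_inv ^ i) (- int n) = 0" for n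
      by simp
    then have "(\<Sum>i\<le>degree p. coeff p i * (if n = i then 1 else 0)) = 0" for n
      by (simp add: fls_nth_sum)
    from this[of "degree p"] show "p = 0" by (simp add: if_distrib cong: if_cong)
  qed
  show ?thesis
  proof unfold_locales
    show "p = 0" if "eval_theta emb p = 0" for p by (rule inj[OF that])
  qed (simp_all add: eval_theta_def c.hom_add c.hom_mult)
qed

locale coordinates =
  fixes emb :: "'f::{finite,field} fls \<Rightarrow> 'c::field" and bs :: "'c list"
  assumes emb_hom: "field_hom emb"
    and basis: "ring.independent (class_ring :: 'c ring) (ratfun_field emb) bs"
begin

definition q :: nat where "q = CARD('f)"

sublocale polynomial_embedding "eval_theta emb" q
  unfolding q_def by (rule eval_theta_embedding[OF emb_hom])

abbreviation K :: "'c set" where "K \<equiv> ratfun_field emb"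
abbreviation num :: "'f poly \<Rightarrow> 'c" where "num \<equiv> eval_theta emb"

lemma K_def: "K = {num p / num s |p s. s \<noteq> 0}"
  by (simp add: ratfun_field_def ratfun_eq)

lemma K_I: "x = num p / num s \<Longrightarrow> s \<noteq> 0 \<Longrightarrow> x \<in> K"
  unfolding K_def by blast

lemma K_E: assumes "x \<in> K" obtains p s where "x = num p / num s" "s \<noteq> 0"
  using assms unfolding K_def by blast

lemma K_num [simp]: "num p \<in> K"
  by (rule K_I[of _ p 1]) simp_all

lemma K_0 [simp]: "0 \<in> K" and K_1 [simp]: "1 \<in> K"
  using K_num[of 0] K_num[of 1] by simp_all

lemma K_add: assumes "x \<in> K" "y \<in> K" shows "x + y \<in> K"
proof -
  obtain p s where p: "x = num p / num s" "s \<noteq> 0" using assms(1) by (rule K_E)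
  obtain p' s' where p': "y = num p' / num s'" "s' \<noteq> 0" using assms(2) by (rule K_E)
  show ?thesis
    by (rule K_I[of _ "p * s' + p' * s" "s * s'"])
      (use p p' in \<open>simp_all add: hom_distribs add_frac_eq\<close>)
qed

lemma K_mult: assumes "x \<in> K" "y \<in> K" shows "x * y \<in> K"
proof -
  obtain p s where p: "x = num p / num s" "s \<noteq> 0" using assms(1) by (rule K_E)
  obtain p' s' where p': "y = num p' / num s'" "s' \<noteq> 0" using assms(2) by (rule K_E)
  show ?thesis
    by (rule K_I[of _ "p * p'" "s * s'"]) (use p p' in \<open>simp_all add: hom_distribs\<close>)
qed

lemma K_uminus: "x \<in> K \<Longrightarrow> - x \<in> K"
  using K_mult[OF K_num[of "-1"], of x] by (simp add: hom_uminus)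

lemma K_diff: "x \<in> K \<Longrightarrow> y \<in> K \<Longrightarrow> x - y \<in> K"
  using K_add[OF _ K_uminus] by simp

lemma K_power: "x \<in> K \<Longrightarrow> x ^ n \<in> K"
  by (induction n) (auto intro: K_mult)

lemma K_inverse: assumes "x \<in> K" "x \<noteq> 0" shows "inverse x \<in> K"
proof -
  obtain p s where p: "x = num p / num s" "s \<noteq> 0" using assms(1) by (rule K_E)
  then show ?thesis by (intro K_I[of _ s p]) (use assms(2) in auto)
qed

lemma K_sum: "(\<And>i. i \<in> I \<Longrightarrow> f i \<in> K) \<Longrightarrow> sum f I \<in> K"
  by (induction I rule: infinite_finite_induct) (auto intro: K_add)

lemma subfield_K: "subfield K (class_ring :: 'c ring)"
proof -
  have field: "field (class_ring :: 'c ring)" by (rule class_field)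
  have ring: "ring (class_ring :: 'c ring)" by unfold_locales
  have a_inv: "a_inv (class_ring :: 'c ring) x = - x" for x
    by (simp add: class_ring_simps)
  have "subring K (class_ring :: 'c ring)"
    by (rule ring.subringI[OF ring]) (auto simp: a_inv intro: K_uminus K_mult K_add)
  moreover have "m_inv (class_ring :: 'c ring) x = inverse x" if "x \<noteq> 0" for x
    using that by (simp add: class_ring_simps)
  ultimately show ?thesis
    by (intro field.subfieldI'[OF field]) (auto intro: K_inverse)
qed

lemma combine_eq_sum:
  "length ks = length us \<Longrightarrow> ring.combine (class_ring :: 'c ring) ks us = (\<Sum>i<length us. ks ! i * us ! i)"
proof (induction ks us rule: list_induct2)
  case Nil
  have "ring (class_ring :: 'c ring)" by unfold_locales
  then show ?case by (simp add: ring.combine.simps)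
next
  case (Cons k ks u us)
  have "ring (class_ring :: 'c ring)" by unfold_locales
  then show ?case using Cons by (simp add: ring.combine.simps sum.lessThan_Suc_shift del: sum.lessThan_Suc)
qed

lemma coordinates_zero:
  assumes "\<And>i. i < length bs \<Longrightarrow> x i \<in> K" "(\<Sum>i<length bs. x i * bs ! i) = 0" "i < length bs"
  shows "x i = 0"
proof -
  have ring: "ring (class_ring :: 'c ring)" by unfold_locales
  let ?ks = "map x [0..<length bs]"
  have "ring.combine (class_ring :: 'c ring) ?ks bs = 0"
    using assms(2) by (subst combine_eq_sum) simp_all
  moreover have "set ?ks \<subseteq> K" using assms(1) by auto
  ultimately have "set (take (length bs) ?ks) \<subseteq> {0}"
    using ring.independent_imp_trivial_combine[OF ring subfield_K basis, of ?ks] by simp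
  then show ?thesis using assms(3) by (simp add: image_subset_iff)
qed

text \<open>
  Equations in \<open>L\<close> may be compared coordinate by coordinate.
\<close>

lemma coordinates_unique:
  assumes "\<And>i. i < length bs \<Longrightarrow> x i \<in> K" "\<And>i. i < length bs \<Longrightarrow> y i \<in> K"
    and "(\<Sum>i<length bs. x i * bs ! i) = (\<Sum>i<length bs. y i * bs ! i)" "i < length bs"
  shows "x i = y i"
proof -
  have "(\<Sum>i<length bs. (x i - y i) * bs ! i) = 0"
    using assms(3) by (simp add: left_diff_distrib sum_subtractf)
  then have "x i - y i = 0"
    using coordinates_zero[where x = "\<lambda>i. x i - y i" and i = i] K_diff assms(1,2,4) by blast
  then show ?thesis by simp
qed

lemma represents_snd:
  assumes "represents emb bs xs v" "e < length bs"
  shows "snd (xs ! e) \<noteq> 0"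
proof -
  have "length xs = length bs" "\<forall>x\<in>set xs. snd x \<noteq> 0"
    using assms(1) by (simp_all add: represents_def case_prod_unfold)
  then show ?thesis using assms(2) by simp
qed

text \<open>
  The product of all denominators is a common denominator, and the sum of all degrees bounds its
  degree and the degrees of the new numerators.
\<close>

lemma common_denominator:
  assumes "finite J" "\<And>j. j \<in> J \<Longrightarrow> snd (f j) \<noteq> 0"
  shows "\<exists>D w. D \<noteq> 0 \<and> degree D \<le> (\<Sum>j\<in>J. degree (fst (f j)) + degree (snd (f j))) \<and>
    (\<forall>j\<in>J. degree (w j) \<le> (\<Sum>j\<in>J. degree (fst (f j)) + degree (snd (f j))) \<and>
      num (w j) = num D * ratfun emb (f j))"
  using assms
proof (induction J)
  case empty
  then show ?case by (intro exI[of _ 1]) simp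
next
  case (insert j J)
  define H where "H = (\<Sum>j\<in>J. degree (fst (f j)) + degree (snd (f j)))"
  obtain D w where D: "D \<noteq> 0" "degree D \<le> H"
    and w: "\<And>j. j \<in> J \<Longrightarrow> degree (w j) \<le> H \<and> num (w j) = num D * ratfun emb (f j)"
    using insert.IH insert.prems unfolding H_def by blast
  obtain p s where ps: "f j = (p, s)" by (cases "f j")
  have s: "s \<noteq> 0" using insert.prems[of j] ps by simp
  define w' where "w' = (\<lambda>i. if i = j then D * p else s * w i)"
  have sum: "(\<Sum>j\<in>insert j J. degree (fst (f j)) + degree (snd (f j))) = degree p + degree s + H"
    using insert.hyps by (simp add: H_def ps)
  show ?case unfolding sum
  proof (intro exI[of _ "s * D"] exI[of _ w'] conjI ballI)
    show "s * D \<noteq> 0" using s D by simp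
    show "degree (s * D) \<le> degree p + degree s + H"
      using degree_mult_le[of s D] D(2) by simp
    fix i assume i: "i \<in> insert j J"
    show "degree (w' i) \<le> degree p + degree s + H"
      using degree_mult_le[of s "w i"] degree_mult_le[of D p] D(2) w[of i] i
      by (auto simp: w'_def)
    show "num (w' i) = num (s * D) * ratfun emb (f i)"
      using w[of i] i s by (auto simp: w'_def hom_mult ps ratfun_eq)
  qed
qed

lemma poly_common_denominator:
  assumes "\<And>n. coeff p n \<in> K"
  shows "\<exists>\<delta> \<beta>. \<delta> \<noteq> 0 \<and> Polynomial.smult (num \<delta>) p = map_poly num \<beta>"
  using assms
proof (induction p)
  case 0
  show ?case by (intro exI[of _ 1] exI[of _ 0]) simp
next
  case (pCons a p)
  have "coeff p n \<in> K" for n using pCons.prems[of "Suc n"] by simp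
  then obtain \<delta> \<beta> where IH: "\<delta> \<noteq> 0" "Polynomial.smult (num \<delta>) p = map_poly num \<beta>"
    using pCons.IH by blast
  obtain r s where a: "a = num r / num s" "s \<noteq> 0" using pCons.prems[of 0] by (auto elim: K_E)
  have "Polynomial.smult (num (s * \<delta>)) (pCons a p) = map_poly num (pCons (\<delta> * r) (Polynomial.smult s \<beta>))"
  proof (rule poly_eqI)
    fix n
    have "num \<delta> * coeff p m = num (coeff \<beta> m)" for m
      using arg_cong[OF IH(2), of "\<lambda>p. coeff p m"] by (simp add: coeff_map_poly)
    then show "coeff (Polynomial.smult (num (s * \<delta>)) (pCons a p)) n
        = coeff (map_poly num (pCons (\<delta> * r) (Polynomial.smult s \<beta>))) n"
      using a by (auto simp: coeff_map_poly coeff_pCons hom_mult split: nat.splits)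
  qed
  then show ?case using IH(1) a(2) by (intro exI[of _ "s * \<delta>"] exI) auto
qed

end

section \<open>The action of a t-module on points\<close>

lemma degree_le_mat_degree:
  assumes "A \<in> carrier_mat d d" "k < d" "j < d"
  shows "degree (A $$ (k, j)) \<le> mat_degree A"
proof -
  have "A $$ (k, j) \<in> elements_mat A" using assms by (intro elements_matI) auto
  then show ?thesis unfolding mat_degree_def by (intro Max_ge) (auto simp: elements_mat_def)
qed

lemma dim_twisted_apply [simp]: "dim_vec (twisted_apply q A v) = dim_row A"
proof -
  have "twisted_apply q A v \<in> carrier_vec (dim_row A)"
    unfolding twisted_apply_def
    by (intro finsum_vec_closed) (auto simp: tau_coeff_def intro!: carrier_vecI)
  then show ?thesis by simp
qed

context coordinates
begin

text \<open>
  The additive polynomial that belongs to a twisted polynomial in \<open>\<tau>\<close>.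
\<close>

definition tau_eval :: "'c poly \<Rightarrow> 'c \<Rightarrow> 'c" where
  "tau_eval f x = (\<Sum>i\<le>degree f. coeff f i * x ^ q ^ i)"

lemma tau_eval_bound: "degree f \<le> n \<Longrightarrow> tau_eval f x = (\<Sum>i\<le>n. coeff f i * x ^ q ^ i)"
  unfolding tau_eval_def by (intro sum.mono_neutral_left) (auto intro: coeff_eq_0)

lemma tau_eval_add_left: "tau_eval (f + g) x = tau_eval f x + tau_eval g x"
proof -
  let ?n = "max (degree f) (degree g)"
  have "degree (f + g) \<le> ?n" by (rule degree_add_le_max)
  then show ?thesis
    by (simp add: tau_eval_bound[of _ ?n] sum.distrib distrib_right)
qed

lemma tau_eval_0 [simp]: "tau_eval 0 x = 0"
  by (simp add: tau_eval_def)

lemma tau_eval_sum_left: "tau_eval (\<Sum>i\<in>I. f i) x = (\<Sum>i\<in>I. tau_eval (f i) x)"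
  by (induction I rule: infinite_finite_induct) (simp_all add: tau_eval_add_left)

lemma tau_eval_monom: "tau_eval (monom c n) x = c * x ^ q ^ n"
  by (subst tau_eval_bound[OF degree_monom_le]) (simp add: if_distrib[of "\<lambda>z. z * _"] cong: if_cong)

lemma frobenius_sum: "(\<Sum>i\<in>I. f i :: 'c) ^ q ^ k = (\<Sum>i\<in>I. f i ^ q ^ k)"
proof -
  interpret fr: comm_ring_hom "\<lambda>x::'c. x ^ q ^ k" by (rule frobenius_hom)
  show ?thesis by (rule fr.hom_sum)
qed

lemma tau_eval_sum: "tau_eval f (\<Sum>i\<in>I. x i) = (\<Sum>i\<in>I. tau_eval f (x i))"
  unfolding tau_eval_def frobenius_sum sum_distrib_left by (rule sum.swap)

lemma tau_eval_arg_0 [simp]: "tau_eval f 0 = 0"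
  using tau_eval_sum[of f "\<lambda>_. 0" "{}"] by simp

lemma const_eq_num: "const emb c = num [:c:]"
proof -
  interpret e: field_hom emb by (rule emb_hom)
  have "map_poly (const emb) [:c:] = [:const emb c:]"
    by (rule poly_eqI) (simp add: coeff_map_poly const_def coeff_pCons split: nat.splits)
  then show ?thesis by (simp add: eval_theta_def)
qed

lemma const_power: "const emb c ^ q ^ k = const emb c"
proof -
  have "[:c:] ^ m = [:c ^ m:]" for m by (induction m) (simp_all add: one_pCons)
  moreover have "c ^ q ^ k = c"
    by (induction k) (simp_all add: power_mult finite_field_power_CARD q_def)
  ultimately show ?thesis by (simp add: const_eq_num hom_power[symmetric] del: hom_power)
qed

lemma tau_eval_const_mult: "tau_eval f (const emb c * x) = const emb c * tau_eval f x"
  by (simp add: tau_eval_def power_mult_distrib const_power sum_distrib_left mult_ac)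

text \<open>
  The twisted product is made for this: it corresponds to the composition of additive polynomials.
\<close>

lemma tau_eval_twisted_mult: "tau_eval (twisted_mult q f g) x = tau_eval f (tau_eval g x)"
proof -
  have "tau_eval (twisted_mult q f g) x
      = (\<Sum>i\<le>degree f. \<Sum>j\<le>degree g. coeff f i * coeff g j ^ q ^ i * x ^ q ^ (i + j))"
    by (simp add: twisted_mult_def tau_eval_sum_left tau_eval_monom)
  also have "\<dots> = (\<Sum>i\<le>degree f. coeff f i * (\<Sum>j\<le>degree g. coeff g j * x ^ q ^ j) ^ q ^ i)"
  proof (intro sum.cong refl)
    fix i
    have "x ^ q ^ (i + j) = (x ^ q ^ j) ^ q ^ i" for j
      by (simp only: power_add power_mult[symmetric] mult.commute)
    then show "(\<Sum>j\<le>degree g. coeff f i * coeff g j ^ q ^ i * x ^ q ^ (i + j))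
        = coeff f i * (\<Sum>j\<le>degree g. coeff g j * x ^ q ^ j) ^ q ^ i"
      by (simp add: frobenius_sum power_mult_distrib sum_distrib_left mult.assoc)
  qed
  finally show ?thesis by (simp add: tau_eval_def)
qed

lemma twisted_apply_index:
  assumes A: "A \<in> carrier_mat d d" and v: "v \<in> carrier_vec d" and k: "k < d"
  shows "twisted_apply q A v $ k = (\<Sum>j<d. tau_eval (A $$ (k, j)) (v $ j))"
proof -
  have "twisted_apply q A v $ k
      = (\<Sum>i\<le>mat_degree A. (tau_coeff A i *\<^sub>v map_vec (\<lambda>x. x ^ q ^ i) v) $ k)"
    unfolding twisted_apply_def using A k
    by (subst index_finsum_vec) (auto simp: tau_coeff_def intro!: carrier_vecI)
  also have "\<dots> = (\<Sum>i\<le>mat_degree A. \<Sum>j<d. coeff (A $$ (k, j)) i * (v $ j) ^ q ^ i)"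
    using A v k by (intro sum.cong refl)
      (simp add: tau_coeff_def scalar_prod_def atLeast0LessThan)
  also have "\<dots> = (\<Sum>j<d. \<Sum>i\<le>mat_degree A. coeff (A $$ (k, j)) i * (v $ j) ^ q ^ i)"
    by (rule sum.swap)
  also have "\<dots> = (\<Sum>j<d. tau_eval (A $$ (k, j)) (v $ j))"
    using A k by (intro sum.cong refl tau_eval_bound[symmetric] degree_le_mat_degree) auto
  finally show ?thesis .
qed

end

text \<open>
  Vectors of \<open>E(L)\<close> are handled as functions on indices below \<open>d\<close>, which saves the bookkeeping of
  dimensions; \<open>twisted_apply_index\<close> gives the translation.
\<close>

locale t_action = coordinates emb bs
  for emb :: "'f::{finite,field} fls \<Rightarrow> 'c::field" and bs +
  fixes L :: "'c set" and d :: nat and \<phi> :: "'f poly \<Rightarrow> 'c poly mat" and P :: "'c vec list"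
  assumes t_module: "t_module emb L d \<phi>"
    and points: "set P \<subseteq> carrier_vec d"
begin

lemma \<phi>_hom: "\<phi> \<in> Ring.ring_hom (class_ring :: 'f poly ring) (twisted_mat_ring q L d)"
  using t_module by (simp add: t_module_def q_def)

lemma \<phi>_carrier: "\<phi> a \<in> carrier_mat d d"
  using ring_hom_closed[OF \<phi>_hom, of a] by (simp add: twisted_mat_ring_def)

lemma \<phi>_add: "\<phi> (a + b) = \<phi> a + \<phi> b"
  using ring_hom_add[OF \<phi>_hom, of a b] by (simp add: twisted_mat_ring_def)

lemma \<phi>_mult: "\<phi> (a * b) = twisted_mat_mult q (\<phi> a) (\<phi> b)"
  using ring_hom_mult[OF \<phi>_hom, of a b] by (simp add: twisted_mat_ring_def)

lemma \<phi>_const: "\<phi> [:c:] = map_mat (Polynomial.smult (const emb c)) (1\<^sub>m d)"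
proof -
  have "\<phi> 1 = 1\<^sub>m d" using ring_hom_one[OF \<phi>_hom] by (simp add: twisted_mat_ring_def)
  moreover have "\<phi> (Polynomial.smult c 1) = map_mat (Polynomial.smult (const emb c)) (\<phi> 1)"
    using t_module unfolding t_module_def by blast
  ultimately show ?thesis by simp
qed

definition act :: "'f poly \<Rightarrow> (nat \<Rightarrow> 'c) \<Rightarrow> nat \<Rightarrow> 'c" where
  "act a v k = (\<Sum>j<d. tau_eval (\<phi> a $$ (k, j)) (v j))"

lemma act_cong: "(\<And>j. j < d \<Longrightarrow> v j = w j) \<Longrightarrow> act a v k = act a w k"
  unfolding act_def by (intro sum.cong) auto

lemma act_add: "k < d \<Longrightarrow> act (a + b) v k = act a v k + act b v k"
  using \<phi>_carrier[of a] \<phi>_carrier[of b]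
  by (simp add: act_def \<phi>_add tau_eval_add_left sum.distrib)

lemma act_mult: "k < d \<Longrightarrow> act (a * b) v k = act a (act b v) k"
proof -
  assume k: "k < d"
  have "act (a * b) v k = (\<Sum>j<d. \<Sum>m<d. tau_eval (\<phi> a $$ (k, m)) (tau_eval (\<phi> b $$ (m, j)) (v j)))"
    using k \<phi>_carrier[of a] \<phi>_carrier[of b]
    by (simp add: act_def \<phi>_mult twisted_mat_mult_def tau_eval_sum_left tau_eval_twisted_mult)
  also have "\<dots> = (\<Sum>m<d. \<Sum>j<d. tau_eval (\<phi> a $$ (k, m)) (tau_eval (\<phi> b $$ (m, j)) (v j)))"
    by (rule sum.swap)
  also have "\<dots> = act a (act b v) k" by (simp add: act_def tau_eval_sum)
  finally show ?thesis .
qed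

lemma act_const: "k < d \<Longrightarrow> act [:c:] v k = const emb c * v k"
proof -
  assume k: "k < d"
  have "act [:c:] v k = (\<Sum>j<d. if j = k then const emb c * v j else 0)"
    unfolding act_def \<phi>_const
  proof (intro sum.cong refl)
    have tau_eval_const: "tau_eval [:b:] x = b * x" for b x by (simp add: tau_eval_def)
    fix j assume "j \<in> {..<d}"
    then show "tau_eval (map_mat (Polynomial.smult (const emb c)) (1\<^sub>m d) $$ (k, j)) (v j)
        = (if j = k then const emb c * v j else 0)"
      using k by (auto simp: tau_eval_const)
  qed
  then show ?thesis using k by simp
qed

lemma act_pCons: "k < d \<Longrightarrow> act (pCons c a) v k = const emb c * v k + act [:0, 1:] (act a v) k"
proof -
  assume k: "k < d"
  have "pCons c a = [:c:] + [:0, 1:] * a" by simp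
  then show ?thesis using k by (simp only: act_add act_const act_mult)
qed

lemma act_sum: "act a (\<lambda>j. \<Sum>i\<in>I. v i j) k = (\<Sum>i\<in>I. act a (v i) k)"
  unfolding act_def tau_eval_sum by (rule sum.swap)

lemma act_zero: "act a (\<lambda>_. 0) k = 0"
  by (simp add: act_def)

text \<open>
  The value \<open>\<Sum>\<^sub>i \<phi>(a\<^sub>i) P\<^sub>i\<close>. It is set to zero at the indices from \<open>d\<close> on, so that equality of values is
  equality of functions.
\<close>

definition combination :: "(nat \<Rightarrow> 'f poly) \<Rightarrow> nat \<Rightarrow> 'c" where
  "combination a k = (if k < d then \<Sum>i<length P. act (a i) (\<lambda>j. P ! i $ j) k else 0)"

lemma combination_cong: "(\<And>i. i < length P \<Longrightarrow> a i = b i) \<Longrightarrow> combination a = combination b"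
  by (intro ext) (simp add: combination_def)

lemma relation_set_iff:
  "a \<in> relation_set d \<phi> P \<longleftrightarrow> a \<in> carrier_vec (length P) \<and> combination (\<lambda>i. a $ i) = (\<lambda>_. 0)"
proof -
  have *: "finsum_vec TYPE('c) d (\<lambda>i. twisted_apply CARD('f) (\<phi> (a $ i)) (P ! i)) {..<length P} $ k
      = combination (\<lambda>i. a $ i) k" if k: "k < d" for k
  proof -
    have "finsum_vec TYPE('c) d (\<lambda>i. twisted_apply CARD('f) (\<phi> (a $ i)) (P ! i)) {..<length P} $ k
        = (\<Sum>i<length P. twisted_apply q (\<phi> (a $ i)) (P ! i) $ k)"
      unfolding q_def[symmetric] using k
      by (subst index_finsum_vec) (auto intro!: carrier_vecI carrier_matD(1)[OF \<phi>_carrier])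
    also have "\<dots> = combination (\<lambda>i. a $ i) k"
      using k points by (auto simp: combination_def act_def intro!: sum.cong twisted_apply_index \<phi>_carrier)
    finally show ?thesis .
  qed
  have "finsum_vec TYPE('c) d (\<lambda>i. twisted_apply CARD('f) (\<phi> (a $ i)) (P ! i)) {..<length P} \<in> carrier_vec d"
    by (intro finsum_vec_closed) (auto intro!: carrier_vecI carrier_matD(1)[OF \<phi>_carrier])
  then have "finsum_vec TYPE('c) d (\<lambda>i. twisted_apply CARD('f) (\<phi> (a $ i)) (P ! i)) {..<length P} = 0\<^sub>v d
      \<longleftrightarrow> (\<forall>k<d. combination (\<lambda>i. a $ i) k = 0)"
    using * by (auto simp: vec_eq_iff)
  also have "\<dots> \<longleftrightarrow> combination (\<lambda>i. a $ i) = (\<lambda>_. 0)"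
    by (auto simp: fun_eq_iff combination_def)
  finally show ?thesis by (auto simp: relation_set_def)
qed

text \<open>
  One step of the Horner scheme: a new lowest coefficient is added after an action of \<open>t\<close>.
\<close>

lemma combination_pCons:
  assumes "k < d"
  shows "combination (\<lambda>i. pCons (c i) (a i)) k
    = (\<Sum>i<length P. const emb (c i) * P ! i $ k) + act [:0, 1:] (combination a) k"
proof -
  have "act [:0, 1:] (combination a) k
      = act [:0, 1:] (\<lambda>j. \<Sum>i<length P. act (a i) (\<lambda>j. P ! i $ j) j) k"
    by (rule act_cong) (simp add: combination_def)
  moreover have "act (pCons (c i) (a i)) v k = const emb (c i) * v k + act [:0, 1:] (act (a i) v) k" for i v
    by (rule act_pCons[OF assms])
  ultimately show ?thesis using assms
    by (simp add: combination_def sum.distrib act_sum)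
qed

lemma combination_add: "combination (\<lambda>i. a i + b i) k = combination a k + combination b k"
  by (simp add: combination_def act_add sum.distrib)

lemma combination_smult:
  "combination (\<lambda>i. Polynomial.smult c (a i)) k = const emb c * combination a k"
proof (cases "k < d")
  case True
  have "act (Polynomial.smult c b) v k = const emb c * act b v k" for b v
    using act_mult[OF True, of "[:c:]" b v] act_const[OF True] by simp
  then show ?thesis by (simp add: combination_def sum_distrib_left)
qed (simp add: combination_def)

lemma combination_diff: "combination (\<lambda>i. a i - b i) k = combination a k - combination b k"
  using combination_add[of "\<lambda>i. a i - b i" b k] by simp

lemma combination_0: "combination (\<lambda>_. 0) = (\<lambda>_. 0)"
  using combination_diff[of "\<lambda>_. 0" "\<lambda>_. 0"] by (simp add: fun_eq_iff)

lemma combination_mult_zero: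
  assumes "combination a = (\<lambda>_. 0)"
  shows "combination (\<lambda>i. b * a i) = (\<lambda>_. 0)"
proof (induction b)
  case 0
  show ?case by (simp add: combination_0)
next
  case (pCons c b)
  have "combination (\<lambda>i. pCons c b * a i) k = 0" for k
  proof (cases "k < d")
    case True
    have "combination (\<lambda>i. pCons c b * a i) k
        = combination (\<lambda>i. Polynomial.smult c (a i)) k + combination (\<lambda>i. pCons 0 (b * a i)) k"
      by (simp add: combination_add)
    also have "\<dots> = 0"
      using True pCons.IH assms const_eq_num[of 0]
      by (simp add: combination_smult combination_pCons act_zero)
    finally show ?thesis .
  qed (simp add: combination_def)
  then show ?case by (auto simp: fun_eq_iff)
qed

end

section \<open>Small relations generate\<close>

context t_action
begin

text \<open>
  The intermediate values of the Horner scheme for \<open>a\<close>.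
\<close>

definition states :: "(nat \<Rightarrow> 'f poly) \<Rightarrow> (nat \<Rightarrow> 'c) set" where
  "states a = (\<lambda>m. combination (\<lambda>i. poly_shift (Suc m) (a i))) ` UNIV"

text \<open>
  Among the \<open>N + 1\<close> states \<open>s m\<close> with \<open>n - N \<le> m \<le> n\<close> of a relation of degree \<open>n > N\<close>, two agree, say for
  \<open>m1 < m2\<close>. The difference \<open>g\<close> of the truncations is a relation of degree at most \<open>N\<close>, and subtracting
  \<open>t\<^sup>m\<^sup>1 g\<close> from \<open>a\<close> removes the terms of degree \<open>n\<close>. The predicate \<open>C\<close> stands for membership in any
  submodule.
\<close>

lemma small_relations_generate:
  assumes states: "\<And>a. combination a = (\<lambda>_. 0) \<Longrightarrow> finite (states a) \<and> card (states a) \<le> N"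
    and add: "\<And>x y. C x \<Longrightarrow> C y \<Longrightarrow> C (\<lambda>i. x i + y i)"
    and mult: "\<And>b x. C x \<Longrightarrow> C (\<lambda>i. b * x i)"
    and small: "\<And>g. combination g = (\<lambda>_. 0) \<Longrightarrow> (\<And>i. i < length P \<Longrightarrow> degree (g i) \<le> N) \<Longrightarrow> C g"
    and a: "combination a = (\<lambda>_. 0)"
  shows "C a"
proof -
  have "\<exists>n. \<forall>i<length P. degree (a i) \<le> n"
    by (intro exI[of _ "\<Sum>i<length P. degree (a i)"] allI impI member_le_sum) auto
  then obtain n where "\<And>i. i < length P \<Longrightarrow> degree (a i) \<le> n" by blast
  with a show ?thesis
  proof (induction n arbitrary: a rule: less_induct)
    case (less n)
    show ?case
    proof (cases "n \<le> N")
      case True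
      then show ?thesis using less.prems by (intro small) (auto intro: order_trans)
    next
      case False
      define s where "s = (\<lambda>m. combination (\<lambda>i. poly_shift m (a i)))"
      have "s m \<in> states a" if "m > 0" for m
        using that by (cases m) (auto simp: states_def s_def)
      then have "s ` {n - N..n} \<subseteq> states a" using False by auto
      then have "card (s ` {n - N..n}) \<le> N"
        using states[OF less.prems(1)] card_mono order_trans by blast
      also have "\<dots> < card {n - N..n}" using False by simp
      finally have "\<not> inj_on s {n - N..n}" using card_image by fastforce
      then obtain m1 m2 where m: "m1 \<in> {n - N..n}" "m2 \<in> {n - N..n}" "m1 < m2" "s m1 = s m2"
        unfolding inj_on_def by (metis linorder_neqE_nat)
      define g where "g = (\<lambda>i. poly_shift m1 (a i) - poly_shift m2 (a i))"
      have coeff_g: "coeff (g i) k = coeff (a i) (k + m1) - coeff (a i) (k + m2)" for i k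
        by (simp add: g_def coeff_poly_shift)
      have g0: "combination g = (\<lambda>_. 0)"
        using m(4) by (simp add: g_def s_def combination_diff fun_eq_iff)
      have "degree (g i) \<le> N" if "i < length P" for i
        by (rule degree_le) (use m less.prems(2)[OF that] in \<open>auto simp: coeff_g coeff_eq_0\<close>)
      with g0 have "C g" by (intro small)
      define a' where "a' = (\<lambda>i. a i - monom 1 m1 * g i)"
      have "combination a' = (\<lambda>_. 0)"
        using combination_mult_zero[OF g0, of "monom 1 m1"] less.prems(1)
        by (simp add: a'_def combination_diff fun_eq_iff)
      moreover have "degree (a' i) \<le> n - 1" if "i < length P" for i
      proof (rule degree_le, intro allI impI)
        fix k assume "n - 1 < k"
        then show "coeff (a' i) k = 0"
          using m less.prems(2)[OF that]
          by (auto simp: a'_def coeff_monom_mult coeff_g coeff_eq_0)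
      qed
      ultimately have "C a'" using False by (intro less.IH[of "n - 1"]) auto
      then have "C (\<lambda>i. a' i + monom 1 m1 * g i)" using \<open>C g\<close> by (intro add mult)
      then show ?thesis by (simp add: a'_def)
    qed
  qed
qed

definition in_span :: "'c \<Rightarrow> bool" where
  "in_span v \<longleftrightarrow> (\<exists>x. (\<forall>e<length bs. x e \<in> K) \<and> v = (\<Sum>e<length bs. x e * bs ! e))"

definition coord :: "'c \<Rightarrow> nat \<Rightarrow> 'c" where
  "coord v = (SOME x. (\<forall>e<length bs. x e \<in> K) \<and> v = (\<Sum>e<length bs. x e * bs ! e))"

lemma coord_K: "in_span v \<Longrightarrow> e < length bs \<Longrightarrow> coord v e \<in> K"
  and coord_sum: "in_span v \<Longrightarrow> (\<Sum>e<length bs. coord v e * bs ! e) = v"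
proof -
  assume "in_span v"
  then have *: "(\<forall>e<length bs. coord v e \<in> K) \<and> v = (\<Sum>e<length bs. coord v e * bs ! e)"
    unfolding in_span_def coord_def by (rule someI_ex)
  then show "e < length bs \<Longrightarrow> coord v e \<in> K" by blast
  show "(\<Sum>e<length bs. coord v e * bs ! e) = v" using * by simp
qed

lemma in_spanI: "(\<And>e. e < length bs \<Longrightarrow> x e \<in> K) \<Longrightarrow> v = (\<Sum>e<length bs. x e * bs ! e) \<Longrightarrow> in_span v"
  unfolding in_span_def by blast

lemma coord_eqI:
  assumes "\<And>e. e < length bs \<Longrightarrow> x e \<in> K" "v = (\<Sum>e<length bs. x e * bs ! e)" "e < length bs"
  shows "coord v e = x e"
proof -
  have "in_span v" by (rule in_spanI[of x]) (use assms in auto)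
  then have "(\<Sum>e<length bs. coord v e * bs ! e) = (\<Sum>e<length bs. x e * bs ! e)"
    using coord_sum[of v] assms(2) by simp
  from coordinates_unique[OF coord_K[OF \<open>in_span v\<close>] assms(1) this assms(3)] show ?thesis .
qed

lemma in_span_0: "in_span 0"
  by (rule in_spanI[of "\<lambda>_. 0"]) simp_all

lemma in_span_add:
  assumes "in_span v" "in_span w" shows "in_span (v + w)"
  by (rule in_spanI[of "\<lambda>e. coord v e + coord w e"])
    (simp_all add: K_add coord_K assms distrib_right sum.distrib coord_sum)

lemma in_span_mult:
  assumes "x \<in> K" "in_span v" shows "in_span (x * v)"
  by (rule in_spanI[of "\<lambda>e. x * coord v e"])
    (simp_all add: K_mult coord_K assms mult.assoc sum_distrib_left[symmetric] coord_sum)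

lemma in_span_sum: "(\<And>i. i \<in> I \<Longrightarrow> in_span (f i)) \<Longrightarrow> in_span (sum f I)"
  by (induction I rule: infinite_finite_induct) (auto intro: in_span_add in_span_0)

lemma coord_0: "e < length bs \<Longrightarrow> coord 0 e = 0"
  by (rule coord_eqI) simp_all

lemma in_span_represents:
  assumes "represents emb bs xs v" shows "in_span v" "e < length bs \<Longrightarrow> coord v e = ratfun emb (xs ! e)"
proof -
  have K: "ratfun emb (xs ! e) \<in> K" if "e < length bs" for e
  proof -
    have "ratfun emb (xs ! e) = num (fst (xs ! e)) / num (snd (xs ! e))"
      by (simp add: ratfun_eq[symmetric])
    then show ?thesis by (rule K_I) (rule represents_snd[OF assms that])
  qed
  have v: "v = (\<Sum>e<length bs. ratfun emb (xs ! e) * bs ! e)" using assms by (simp add: represents_def)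
  show "in_span v" by (rule in_spanI[OF K v])
  show "e < length bs \<Longrightarrow> coord v e = ratfun emb (xs ! e)" by (rule coord_eqI[OF K v])
qed

end

text \<open>
  A bound for the number of vectors in \<open>K\<^sup>N\<close> whose entries are fractions with numerator and denominator
  of degree at most the height of solutions.
\<close>

definition state_bound :: "nat \<Rightarrow> nat \<Rightarrow> nat \<Rightarrow> nat \<Rightarrow> nat" where
  "state_bound q N r H =
     (q ^ Suc (solution_height q N r H) * q ^ Suc (solution_height q N r H)) ^ N"

definition fraction_size :: "'a::zero poly \<times> 'a poly \<Rightarrow> nat" where
  "fraction_size x = degree (fst x) + degree (snd x)"

text \<open>
  The lists \<open>\<alpha> r k j e\<close> describe the action of \<open>t\<close> in coordinates: they represent the image of the
  \<open>e\<close>-th basis element under the \<open>r\<close>-th term of the entry \<open>(k, j)\<close> of \<open>\<phi>\<^sub>t\<close>. The lists \<open>\<xi> i k\<close> represent the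
  entries of the points.
\<close>

locale t_coordinates = t_action emb bs L d \<phi> P
  for emb :: "'f::{finite,field} fls \<Rightarrow> 'c::field" and bs and L :: "'c set" and d
    and \<phi> :: "'f poly \<Rightarrow> 'c poly mat" and P :: "'c vec list" +
  fixes R :: nat and \<alpha> :: "nat \<Rightarrow> nat \<Rightarrow> nat \<Rightarrow> nat \<Rightarrow> 'f elt" and \<xi> :: "nat \<Rightarrow> nat \<Rightarrow> 'f elt"
  assumes degree_less: "k < d \<Longrightarrow> j < d \<Longrightarrow> degree (\<phi> [:0, 1:] $$ (k, j)) < R"
    and \<alpha>: "r < R \<Longrightarrow> k < d \<Longrightarrow> j < d \<Longrightarrow> e < length bs \<Longrightarrow>
      represents emb bs (\<alpha> r k j e) (coeff (\<phi> [:0, 1:] $$ (k, j)) r * (bs ! e) ^ q ^ r)"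
    and \<xi>: "i < length P \<Longrightarrow> k < d \<Longrightarrow> represents emb bs (\<xi> i k) (P ! i $ k)"
begin

abbreviation n :: nat where "n \<equiv> length bs"

lemma action_expand:
  assumes "k < d" "\<And>j. j < d \<Longrightarrow> in_span (v j)"
  shows "act [:0, 1:] v k = (\<Sum>r<R. \<Sum>j<d. \<Sum>e<n.
    coord (v j) e ^ q ^ r * (coeff (\<phi> [:0, 1:] $$ (k, j)) r * (bs ! e) ^ q ^ r))"
proof -
  let ?\<Phi> = "\<lambda>j. \<phi> [:0, 1:] $$ (k, j)"
  have tau: "tau_eval (?\<Phi> j) x = (\<Sum>r<R. coeff (?\<Phi> j) r * x ^ q ^ r)" if "j < d" for j x
  proof -
    have "degree (?\<Phi> j) \<le> R - 1" "R > 0" using degree_less[OF assms(1) that] by simp_all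
    then show ?thesis by (simp add: tau_eval_bound[of _ "R - 1"] lessThan_Suc_atMost[symmetric])
  qed
  have "act [:0, 1:] v k = (\<Sum>j<d. \<Sum>r<R. coeff (?\<Phi> j) r * (\<Sum>e<n. coord (v j) e * bs ! e) ^ q ^ r)"
    using assms(2) by (simp add: act_def tau coord_sum)
  also have "\<dots> = (\<Sum>j<d. \<Sum>r<R. \<Sum>e<n. coord (v j) e ^ q ^ r * (coeff (?\<Phi> j) r * (bs ! e) ^ q ^ r))"
    by (simp add: frobenius_sum power_mult_distrib sum_distrib_left mult.left_commute)
  also have "\<dots> = (\<Sum>r<R. \<Sum>j<d. \<Sum>e<n. coord (v j) e ^ q ^ r * (coeff (?\<Phi> j) r * (bs ! e) ^ q ^ r))"
    by (rule sum.swap)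
  finally show ?thesis .
qed

lemma action_in_span:
  assumes "k < d" "\<And>j. j < d \<Longrightarrow> in_span (v j)"
  shows "in_span (act [:0, 1:] v k)"
proof -
  have "in_span (coeff (\<phi> [:0, 1:] $$ (k, j)) r * (bs ! e) ^ q ^ r)" if "r < R" "j < d" "e < n" for r j e
    using in_span_represents(1)[OF \<alpha>[OF that(1) assms(1) that(2,3)]] .
  moreover have "coord (v j) e ^ q ^ r \<in> K" if "j < d" "e < n" for j e r
    by (rule K_power[OF coord_K[OF assms(2)[OF that(1)] that(2)]])
  moreover have "act [:0, 1:] v k = (\<Sum>r<R. \<Sum>j<d. \<Sum>e<n.
      coord (v j) e ^ q ^ r * (coeff (\<phi> [:0, 1:] $$ (k, j)) r * (bs ! e) ^ q ^ r))"
    using assms by (rule action_expand)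
  ultimately show ?thesis
    by (simp only:) (intro in_span_sum, rule in_span_mult, simp_all)
qed

lemma act_in_span:
  assumes v: "\<And>j. j < d \<Longrightarrow> in_span (v j)"
  shows "k < d \<Longrightarrow> in_span (act b v k)"
proof (induction b arbitrary: k)
  case 0
  have "act 0 v k = const emb 0 * v k" using act_const[OF 0, of 0 v] by (simp only: pCons_0_0)
  also have "\<dots> = 0" by (simp only: const_eq_num pCons_0_0 hom_zero mult_zero_left)
  finally show ?case by (simp only: in_span_0)
next
  case (pCons c b)
  have "in_span (act [:0, 1:] (act b v) k)"
    by (rule action_in_span[OF pCons.prems]) (erule pCons.IH)
  from in_span_add[OF in_span_mult[OF K_num v[OF pCons.prems]] this]
  show ?case unfolding act_pCons[OF pCons.prems, of c] const_eq_num .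
qed

lemma combination_in_span: "in_span (combination a k)"
proof (cases "k < d")
  case True
  have "in_span (act (a i) (\<lambda>j. P ! i $ j) k)" if i: "i < length P" for i
    using True by (rule act_in_span[rotated]) (rule in_span_represents(1)[OF \<xi>[OF i]])
  then have "in_span (\<Sum>i<length P. act (a i) (\<lambda>j. P ! i $ j) k)" by (intro in_span_sum) simp
  then show ?thesis using True by (simp add: combination_def)
qed (simp add: combination_def in_span_0)

lemma combination_coord:
  assumes k: "k < d" and e': "e' < n"
  shows "coord (combination (\<lambda>i. pCons (c i) (a i)) k) e'
    = (\<Sum>i<length P. const emb (c i) * ratfun emb (\<xi> i k ! e'))
      + (\<Sum>r<R. \<Sum>j<d. \<Sum>e<n. ratfun emb (\<alpha> r k j e ! e') * coord (combination a j) e ^ q ^ r)"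
    (is "_ = ?x e'")
proof (rule coord_eqI[OF _ _ e'])
  have \<xi>_K: "ratfun emb (\<xi> i k ! e) \<in> K" if "i < length P" "e < n" for i e
    using coord_K[OF in_span_represents(1)[OF \<xi>[OF that(1) k]] that(2)]
      in_span_represents(2)[OF \<xi>[OF that(1) k] that(2)] by simp
  have \<alpha>_K: "ratfun emb (\<alpha> r k j e ! e') \<in> K" if "r < R" "j < d" "e < n" "e' < n" for r j e e'
    using coord_K[OF in_span_represents(1)[OF \<alpha>[OF that(1) k that(2,3)]] that(4)]
      in_span_represents(2)[OF \<alpha>[OF that(1) k that(2,3)] that(4)] by simp
  show "?x e \<in> K" if "e < n" for e
    using that unfolding const_eq_num
    by (intro K_add K_sum K_mult K_power K_num \<xi>_K \<alpha>_K coord_K combination_in_span) auto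
  have 1: "P ! i $ k = (\<Sum>e<n. ratfun emb (\<xi> i k ! e) * bs ! e)" if "i < length P" for i
    using \<xi>[OF that k] by (simp add: represents_def)
  have 2: "coeff (\<phi> [:0, 1:] $$ (k, j)) r * (bs ! e) ^ q ^ r
      = (\<Sum>e'<n. ratfun emb (\<alpha> r k j e ! e') * bs ! e')" if "r < R" "j < d" "e < n" for r j e
    using \<alpha>[OF that(1) k that(2,3)] by (simp add: represents_def)
  have "(\<Sum>i<length P. const emb (c i) * P ! i $ k)
      = (\<Sum>i<length P. \<Sum>e'<n. const emb (c i) * ratfun emb (\<xi> i k ! e') * bs ! e')"
    by (simp add: 1 sum_distrib_left mult.assoc)
  also have "\<dots> = (\<Sum>e'<n. \<Sum>i<length P. const emb (c i) * ratfun emb (\<xi> i k ! e') * bs ! e')"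
    by (rule sum.swap)
  finally have 3: "(\<Sum>i<length P. const emb (c i) * P ! i $ k)
      = (\<Sum>e'<n. (\<Sum>i<length P. const emb (c i) * ratfun emb (\<xi> i k ! e')) * bs ! e')"
    by (simp add: sum_distrib_right)
  let ?t = "\<lambda>r j e e'. ratfun emb (\<alpha> r k j e ! e') * coord (combination a j) e ^ q ^ r * bs ! e'"
  have "act [:0, 1:] (combination a) k = (\<Sum>r<R. \<Sum>j<d. \<Sum>e<n. \<Sum>e'<n. ?t r j e e')"
    unfolding action_expand[of k "combination a", OF k combination_in_span]
    by (intro sum.cong refl) (simp add: 2 sum_distrib_left, simp add: mult.assoc mult.left_commute)
  also have "\<dots> = (\<Sum>r<R. \<Sum>j<d. \<Sum>e'<n. \<Sum>e<n. ?t r j e e')"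
    by (rule sum.cong[OF refl], rule sum.cong[OF refl], rule sum.swap)
  also have "\<dots> = (\<Sum>r<R. \<Sum>e'<n. \<Sum>j<d. \<Sum>e<n. ?t r j e e')"
    by (rule sum.cong[OF refl], rule sum.swap)
  also have "\<dots> = (\<Sum>e'<n. \<Sum>r<R. \<Sum>j<d. \<Sum>e<n. ?t r j e e')"
    by (rule sum.swap)
  finally show "combination (\<lambda>i. pCons (c i) (a i)) k = (\<Sum>e<n. ?x e * bs ! e)"
    using 3 by (simp add: combination_pCons[OF k] distrib_right sum.distrib sum_distrib_right)
qed

definition size_bound :: nat where
  "size_bound = (\<Sum>r<R. \<Sum>k<d. \<Sum>j<d. \<Sum>e<n. \<Sum>e'<n. fraction_size (\<alpha> r k j e ! e'))
     + (\<Sum>i<length P. \<Sum>k<d. \<Sum>e'<n. fraction_size (\<xi> i k ! e'))"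

text \<open>
  The coordinates of the states are the coefficients of the polynomials \<open>b\<close>, for which the Horner
  recursion is the system of equations of \<open>system_bound\<close>. That \<open>a\<close> is a relation is used for the
  coefficient of \<open>t\<^sup>0\<close>, where the recursion would otherwise have the value of \<open>a\<close> itself as an additional
  term.
\<close>

lemma state_height:
  assumes a: "combination a = (\<lambda>_. 0)" and k0: "k0 < d" "e0 < n"
    and H: "size_bound \<le> H"
  shows "fraction_le (solution_height q (d * n) R H)
    (coord (combination (\<lambda>i. poly_shift (Suc m) (a i)) k0) e0)"
proof -
  define l where "l = length P"
  define I where "I = {..<d} \<times> {..<n}"
  define J1 where "J1 = {..<R} \<times> {..<d} \<times> {..<d} \<times> {..<n} \<times> {..<n}"
  define f1 where "f1 = (\<lambda>(r, k, j, e, e'). \<alpha> r k j e ! e')"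
  define J2 where "J2 = {..<l} \<times> {..<d} \<times> {..<n}"
  define f2 where "f2 = (\<lambda>(i, k, e'). \<xi> i k ! e')"
  define H1 where "H1 = (\<Sum>j\<in>J1. degree (fst (f1 j)) + degree (snd (f1 j)))"
  define H2 where "H2 = (\<Sum>j\<in>J2. degree (fst (f2 j)) + degree (snd (f2 j)))"
  have H12: "H1 + H2 \<le> H"
    using H by (simp add: H1_def H2_def J1_def J2_def f1_def f2_def size_bound_def fraction_size_def
        sum.cartesian_product' l_def)
  have "finite J1" by (simp add: J1_def)
  moreover have "snd (f1 j) \<noteq> 0" if "j \<in> J1" for j
    using that represents_snd[OF \<alpha>] by (auto simp: J1_def f1_def)
  ultimately obtain D1 w1 where D1: "D1 \<noteq> 0" "degree D1 \<le> H1"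
    and w1: "\<And>j. j \<in> J1 \<Longrightarrow> degree (w1 j) \<le> H1 \<and> num (w1 j) = num D1 * ratfun emb (f1 j)"
    using common_denominator[of J1 f1] unfolding H1_def by blast
  have "finite J2" by (simp add: J2_def)
  moreover have "snd (f2 j) \<noteq> 0" if "j \<in> J2" for j
    using that represents_snd[OF \<xi>] by (auto simp: J2_def f2_def l_def)
  ultimately obtain D2 w2 where D2: "D2 \<noteq> 0" "degree D2 \<le> H2"
    and w2: "\<And>j. j \<in> J2 \<Longrightarrow> degree (w2 j) \<le> H2 \<and> num (w2 j) = num D2 * ratfun emb (f2 j)"
    using common_denominator[of J2 f2] unfolding H2_def by blast
  define D where "D = D1 * D2"
  define A where "A = (\<lambda>r (k, e') (j, e). if (r, k, j, e, e') \<in> J1 then D2 * w1 (r, k, j, e, e') else 0)"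
  define W where "W = (\<lambda>i (k, e'). if (i, k, e') \<in> J2 then D1 * w2 (i, k, e') else 0)"
  have deg: "degree (x * y) \<le> H" if "degree x \<le> H1 \<and> degree y \<le> H2 \<or> degree x \<le> H2 \<and> degree y \<le> H1"
    for x y :: "'f poly"
    using degree_mult_le[of x y] that H12 by linarith
  have degree_A: "degree (A r x y) \<le> H" for r x y
    using D2(2) w1 by (cases x; cases y) (auto simp: A_def intro!: deg)
  have degree_W: "degree (W i x) \<le> H" for i x
    using D1(2) w2 by (cases x) (auto simp: W_def intro!: deg)
  define N where "N = Suc (\<Sum>i<l. degree (a i))"
  have shift_0: "poly_shift m (a i) = 0" if "i < l" "m \<ge> N" for i m
  proof (rule poly_eqI)
    fix k
    have "degree (a i) \<le> (\<Sum>i<l. degree (a i))" using that by (intro member_le_sum) auto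
    then have "degree (a i) < k + m" using that by (simp add: N_def)
    then show "coeff (poly_shift m (a i)) k = coeff 0 k" by (simp add: coeff_poly_shift coeff_eq_0)
  qed
  define s where "s m = combination (\<lambda>i. poly_shift m (a i))" for m
  have s_0: "s 0 = (\<lambda>_. 0)" using a by (simp add: s_def poly_shift_0)
  have s_beyond: "s m k = 0" if "m \<ge> N" for m k
    using combination_cong[of "\<lambda>i. poly_shift m (a i)" "\<lambda>_. 0"] shift_0 that
    by (simp add: s_def l_def combination_0)
  have s_span: "in_span (s m k)" for m k unfolding s_def by (rule combination_in_span)
  define b where "b = (\<lambda>(k, e). Poly (map (\<lambda>m. coord (s (Suc m) k) e) [0..<N]))"
  have coeff_b: "coeff (b (k, e)) m = coord (s (Suc m) k) e" if "e < n" for k e m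
    using that by (simp add: b_def nth_default_def s_beyond coord_0)
  define g where "g = (\<lambda>x. - (\<Sum>i<l. Polynomial.smult (W i x) (map_poly (\<lambda>c. [:c:]) (a i))))"
  have coeff_g: "coeff (g x) m = - (\<Sum>i<l. W i x * [:coeff (a i) m:])" for x m
    by (simp add: g_def coeff_sum coeff_map_poly)
  have "height_le H (g x)" for x
    unfolding height_le_def coeff_g degree_minus using degree_W[of _ x]
    by (auto intro!: degree_sum_le intro: order_trans[OF degree_smult_le] simp: mult.commute)
  moreover have "\<exists>\<delta> \<beta>. \<delta> \<noteq> 0 \<and> Polynomial.smult (num \<delta>) (b (k0, e0)) = map_poly num \<beta>"
    using k0 by (intro poly_common_denominator) (simp add: coeff_b coord_K s_span)
  moreover have "(\<Sum>r\<le>R. \<Sum>y\<in>I. Polynomial.smult (num (A r x y)) (twist (q ^ r) (b y)))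
      - Polynomial.smult (num D) (pCons 0 (b x)) = map_poly num (g x)" if x: "x \<in> I" for x
  proof (rule poly_eqI)
    fix m
    obtain k e' where ke: "x = (k, e')" "k < d" "e' < n" using x by (auto simp: I_def)
    have step: "coeff (pCons 0 (b x)) m = coord (s m k) e'"
      using ke by (cases m) (simp_all add: coeff_b s_0 coord_0)
    have "poly_shift m (a i) = pCons (coeff (a i) m) (poly_shift (Suc m) (a i))" for i
      by (rule poly_eqI) (simp add: coeff_poly_shift coeff_pCons split: nat.splits)
    then have rec: "coord (s m k) e' = (\<Sum>i<l. num [:coeff (a i) m:] * ratfun emb (f2 (i, k, e')))
      + (\<Sum>r<R. \<Sum>j<d. \<Sum>e<n. ratfun emb (f1 (r, k, j, e, e')) * coord (s (Suc m) j) e ^ q ^ r)"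
      unfolding s_def using combination_coord[OF ke(2,3), of "\<lambda>i. coeff (a i) m" "\<lambda>i. poly_shift (Suc m) (a i)"]
      by (simp add: l_def f1_def f2_def const_eq_num)
    have W: "num (W i x) = num D * ratfun emb (f2 (i, k, e'))" if "i < l" for i
      using that ke w2[of "(i, k, e')"] by (simp add: W_def J2_def D_def hom_mult)
    have A: "num (A r x (j, e)) = num D * ratfun emb (f1 (r, k, j, e, e'))"
      if "r < R" "j < d" "e < n" for r j e
      using that ke w1[of "(r, k, j, e, e')"] by (simp add: A_def J1_def D_def hom_mult)
    have "A R x y = 0" for y using ke by (cases y) (simp add: A_def J1_def)
    then have "coeff (\<Sum>r\<le>R. \<Sum>y\<in>I. Polynomial.smult (num (A r x y)) (twist (q ^ r) (b y))) m
        = (\<Sum>r<R. \<Sum>y\<in>I. num (A r x y) * coeff (b y) m ^ q ^ r)"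
      by (simp add: lessThan_Suc_atMost[symmetric] coeff_sum coeff_twist)
    also have "\<dots> = (\<Sum>r<R. \<Sum>j<d. \<Sum>e<n. num (A r x (j, e)) * coord (s (Suc m) j) e ^ q ^ r)"
      by (simp add: I_def sum.cartesian_product' coeff_b)
    also have "\<dots> = num D * (\<Sum>r<R. \<Sum>j<d. \<Sum>e<n. ratfun emb (f1 (r, k, j, e, e')) * coord (s (Suc m) j) e ^ q ^ r)"
      by (simp add: A sum_distrib_left mult.assoc)
    finally have lhs: "coeff (\<Sum>r\<le>R. \<Sum>y\<in>I. Polynomial.smult (num (A r x y)) (twist (q ^ r) (b y))) m
        = num D * (\<Sum>r<R. \<Sum>j<d. \<Sum>e<n. ratfun emb (f1 (r, k, j, e, e')) * coord (s (Suc m) j) e ^ q ^ r)" .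
    have "num (coeff (g x) m) = - (\<Sum>i<l. num (W i x) * num [:coeff (a i) m:])"
      by (simp only: coeff_g hom_uminus hom_sum hom_mult)
    also have "\<dots> = - num D * (\<Sum>i<l. num [:coeff (a i) m:] * ratfun emb (f2 (i, k, e')))"
      by (simp add: W sum_distrib_left mult_ac sum_negf)
    finally have rhs: "num (coeff (g x) m) = - num D * (\<Sum>i<l. num [:coeff (a i) m:] * ratfun emb (f2 (i, k, e')))" .
    show "coeff ((\<Sum>r\<le>R. \<Sum>y\<in>I. Polynomial.smult (num (A r x y)) (twist (q ^ r) (b y)))
        - Polynomial.smult (num D) (pCons 0 (b x))) m = coeff (map_poly num (g x)) m"
      unfolding coeff_diff coeff_smult lhs step rec coeff_map_poly[of num, OF hom_zero] rhs
      by (simp add: distrib_left)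
  qed
  ultimately have "fraction_le (solution_height q (card I) R H) (coeff (b (k0, e0)) m)"
    using k0 D1 D2 H12 degree_A deg[of D1 D2]
    by (elim exE conjE, intro system_bound[of I "(k0, e0)" D H A g _ b _ R m])
      (auto simp: I_def D_def)
  then show ?thesis using k0 by (simp add: coeff_b s_def I_def card_cartesian_product)
qed

lemma finite_fractions: "finite {x. fraction_le h x} \<and> card {x. fraction_le h x} \<le> q ^ Suc h * q ^ Suc h"
proof -
  define S where "S = (\<lambda>f. Poly (map f [0..<Suc h])) ` ({..<Suc h} \<rightarrow>\<^sub>E (UNIV :: 'f set))"
  have S: "p \<in> S" if "degree p \<le> h" for p
  proof -
    have "p = Poly (map (restrict (coeff p) {..<Suc h}) [0..<Suc h])"
      using that by (intro poly_eqI) (auto simp: nth_default_def coeff_eq_0 simp del: upt_Suc)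
    then show ?thesis unfolding S_def by (intro image_eqI[of _ _ "restrict (coeff p) {..<Suc h}"]) auto
  qed
  have fin: "finite ({..<Suc h} \<rightarrow>\<^sub>E (UNIV :: 'f set))" by (intro finite_PiE) auto
  have "card S \<le> card ({..<Suc h} \<rightarrow>\<^sub>E (UNIV :: 'f set))"
    unfolding S_def by (rule card_image_le[OF fin])
  then have cardS: "card S \<le> q ^ Suc h" by (simp add: card_PiE q_def)
  have finS: "finite S" using fin by (simp add: S_def)
  have sub: "{x. fraction_le h x} \<subseteq> (\<lambda>(p, s). num p / num s) ` (S \<times> S)"
    using S by (auto simp: fraction_le_def image_iff)
  have "card {x. fraction_le h x} \<le> card (S \<times> S)"
    using card_mono[OF _ sub] card_image_le[of "S \<times> S" "\<lambda>(p, s). num p / num s"] finS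
    by (meson finite_SigmaI finite_imageI order_trans)
  also have "\<dots> \<le> q ^ Suc h * q ^ Suc h"
    unfolding card_cartesian_product by (intro mult_le_mono cardS)
  finally show ?thesis using finite_subset[OF sub] finS by blast
qed

lemma states_bound:
  assumes a: "combination a = (\<lambda>_. 0)" and H: "size_bound \<le> H"
  shows "finite (states a) \<and> card (states a) \<le> state_bound q (d * n) R H"
proof -
  define I where "I = {..<d} \<times> {..<n}"
  define F where "F = {x. fraction_le (solution_height q (d * n) R H) x}"
  define val where "val x k = (if k < d then \<Sum>e<n. x (k, e) * bs ! e else 0)" for x k
  have F: "finite F" "card F \<le> q ^ Suc (solution_height q (d * n) R H) * q ^ Suc (solution_height q (d * n) R H)"
    using finite_fractions[of "solution_height q (d * n) R H"] by (simp_all add: F_def)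
  have fin: "finite (I \<rightarrow>\<^sub>E F)" by (intro finite_PiE) (auto simp: I_def F)
  have sub: "states a \<subseteq> val ` (I \<rightarrow>\<^sub>E F)"
  proof
    fix s assume "s \<in> states a"
    then obtain m where s: "s = combination (\<lambda>i. poly_shift (Suc m) (a i))" by (auto simp: states_def)
    define x where "x = restrict (\<lambda>(k, e). coord (s k) e) I"
    have "x \<in> I \<rightarrow>\<^sub>E F"
      unfolding x_def I_def F_def s
      by (rule restrict_PiE_iff[THEN iffD2]) (auto intro: state_height[OF a _ _ H])
    moreover have "s k = val x k" for k
    proof (cases "k < d")
      case True
      have "in_span (s k)" unfolding s by (rule combination_in_span)
      then show ?thesis using True coord_sum[of "s k"] by (simp add: val_def x_def I_def)
    qed (simp add: s combination_def val_def)
    then have "s = val x" by (rule ext)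
    ultimately show "s \<in> val ` (I \<rightarrow>\<^sub>E F)" by (simp add: imageI)
  qed
  have "finite (states a)" by (rule finite_subset[OF sub finite_imageI[OF fin]])
  moreover have "card (states a) \<le> card (I \<rightarrow>\<^sub>E F)" by (rule surj_card_le[OF fin sub])
  moreover have "card (I \<rightarrow>\<^sub>E F) = card F ^ (d * n)"
    by (simp add: card_PiE I_def card_cartesian_product)
  moreover have "card F ^ (d * n) \<le> state_bound q (d * n) R H"
    unfolding state_bound_def by (intro power_mono F) simp
  ultimately show ?thesis by simp
qed

end

section \<open>Computable functions between coded types\<close>

text \<open>
  The encodings agree with those of the input and the output of the algorithms. They extend to
  products, lists and polynomials, so that the type of a function determines what it means for it to
  be computable.
\<close>

class coded =
  fixes encode :: "'a \<Rightarrow> nat"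
  assumes inj_encode: "inj encode"

instantiation nat :: coded
begin
definition encode_nat :: "nat \<Rightarrow> nat" where "encode_nat n = n"
instance by standard (simp add: encode_nat_def inj_def)
end

instantiation bool :: coded
begin
definition encode_bool :: "bool \<Rightarrow> nat" where "encode_bool b = of_bool b"
instance by standard (simp add: encode_bool_def inj_def)
end

instantiation prod :: (coded, coded) coded
begin
definition encode_prod :: "'a \<times> 'b \<Rightarrow> nat" where
  "encode_prod x = prod_encode (encode (fst x), encode (snd x))"
instance
  by standard (auto simp: encode_prod_def inj_def prod_eq_iff dest: injD[OF inj_encode])
end

instantiation list :: (coded) coded
begin
definition encode_list :: "'a list \<Rightarrow> nat" where "encode_list xs = code_list encode xs"
instance
proof
  show "inj (encode :: 'a list \<Rightarrow> nat)"
    using inj_map_eq_map[OF inj_encode]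
    by (auto simp: encode_list_def code_list_def inj_def list_encode_eq)
qed
end

instantiation poly :: ("{finite,zero}") coded
begin
definition encode_poly :: "'a poly \<Rightarrow> nat" where "encode_poly p = code_poly p"
instance
proof
  show "inj (encode :: 'a poly \<Rightarrow> nat)"
    by (auto simp: encode_poly_def code_poly_def code_list_def inj_def coeffs_eq_iff list_encode_eq
        dest: injD[OF inj_mapI[OF inj_to_nat]])
qed
end

lemma encode_Pair: "encode (x, y) = prod_encode (encode x, encode y)"
  by (simp add: encode_prod_def)

lemma encode_Nil: "encode [] = 0"
  by (simp add: encode_list_def code_list_def)

lemma encode_Cons: "encode (x # xs) = Suc (prod_encode (encode x, encode xs))"
  by (simp add: encode_list_def code_list_def)

definition computable :: "('a::coded \<Rightarrow> 'b::coded) \<Rightarrow> bool" where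
  "computable f \<longleftrightarrow> (\<exists>g. partial_recursive g \<and> (\<forall>x. g (encode x) = Some (encode (f x))))"

named_theorems computable_intros

text \<open>
  Only codes matter for computability; this also allows one to read a value at another type, for
  instance a polynomial as the list of the numbers of its coefficients.
\<close>

lemma computable_recode:
  assumes "computable f" "\<And>x. encode (h x) = encode (f (k x))" "\<And>x. encode (k x) = encode x"
  shows "computable h"
  using assms unfolding computable_def by metis

text \<open>
  For a fixed function \<open>f\<close>, the instance \<open>computable_comp[OF _]\<close> of this rule handles the occurrences of
  \<open>f\<close> below further bound variables, where the context has been extended by pairing.
\<close>

lemma computable_comp:
  assumes "computable f" "computable g"
  shows "computable (\<lambda>x. f (g x))"
proof -
  obtain f' g' where "partial_recursive f'" "\<And>x. f' (encode x) = Some (encode (f x))"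
    "partial_recursive g'" "\<And>x. g' (encode x) = Some (encode (g x))"
    using assms unfolding computable_def by blast
  then show ?thesis
    unfolding computable_def by (intro exI[of _ "\<lambda>n. Option.bind (g' n) f'"]) (auto intro: pr_comp)
qed

lemma computable_id [computable_intros]: "computable (\<lambda>x. x)"
proof -
  have "partial_recursive (\<lambda>n. Option.bind (Some (fst (prod_decode n))) (\<lambda>x.
    Option.bind (Some (snd (prod_decode n))) (\<lambda>y. Some (prod_encode (x, y)))))"
    by (intro pr_pair pr_left pr_right)
  then show ?thesis unfolding computable_def by (auto intro!: exI)
qed

lemma computable_fst [computable_intros]:
  assumes "computable f" shows "computable (\<lambda>x. fst (f x))"
proof (rule computable_comp[OF _ assms])
  show "computable (fst :: 'b \<times> 'c \<Rightarrow> 'b)"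
    unfolding computable_def by (intro exI[of _ "\<lambda>n. Some (fst (prod_decode n))"])
      (auto simp: encode_prod_def intro: pr_left)
qed

lemma computable_snd [computable_intros]:
  assumes "computable f" shows "computable (\<lambda>x. snd (f x))"
proof (rule computable_comp[OF _ assms])
  show "computable (snd :: 'b \<times> 'c \<Rightarrow> 'c)"
    unfolding computable_def by (intro exI[of _ "\<lambda>n. Some (snd (prod_decode n))"])
      (auto simp: encode_prod_def intro: pr_right)
qed

lemma computable_Pair [computable_intros]:
  assumes "computable f" "computable g" shows "computable (\<lambda>x. (f x, g x))"
proof -
  obtain f' g' where "partial_recursive f'" "\<And>x. f' (encode x) = Some (encode (f x))"
    "partial_recursive g'" "\<And>x. g' (encode x) = Some (encode (g x))"
    using assms unfolding computable_def by blast
  then show ?thesis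
    unfolding computable_def by (intro exI[of _ "\<lambda>n. Option.bind (f' n) (\<lambda>x.
      Option.bind (g' n) (\<lambda>y. Some (prod_encode (x, y))))"])
      (auto simp: encode_Pair intro: pr_pair)
qed

lemma computable_Suc [computable_intros]:
  assumes "computable f" shows "computable (\<lambda>x. Suc (f x))"
proof (rule computable_comp[OF _ assms])
  show "computable Suc"
    unfolding computable_def by (intro exI[of _ "\<lambda>n. Some (Suc n)"])
      (auto simp: encode_nat_def intro: pr_succ)
qed

lemma computable_const [computable_intros]: "computable (\<lambda>_. c)"
proof -
  have *: "\<exists>g. partial_recursive g \<and> (\<forall>n. g n = Some m)" for m
  proof (induction m)
    case 0
    then show ?case using pr_zero by blast
  next
    case (Suc m)
    then obtain g where "partial_recursive g" "\<And>n. g n = Some m" by blast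
    with pr_comp[OF this(1) pr_succ] show ?case
      by (intro exI[of _ "\<lambda>n. Option.bind (g n) (\<lambda>n. Some (Suc n))"]) simp
  qed
  show ?thesis using *[of "encode c"] unfolding computable_def by blast
qed

text \<open>
  The step function gets its context as a nested pair of the argument, the loop counter and the
  previous value. All other loops are instances of this one.
\<close>

lemma computable_rec_nat [computable_intros]:
  assumes "computable f" "computable (\<lambda>p. g (fst p) (fst (snd p)) (snd (snd p)))" "computable n"
  shows "computable (\<lambda>x. rec_nat (f x) (g x) (n x))"
proof -
  obtain f' g' where f': "partial_recursive f'" "\<And>x. f' (encode x) = Some (encode (f x))"
    and g': "partial_recursive g'"
      "\<And>p. g' (encode p) = Some (encode (g (fst p) (fst (snd p)) (snd (snd p))))"
    using assms(1,2) unfolding computable_def by blast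
  have g'': "g' (prod_encode (encode x, prod_encode (i, encode r))) = Some (encode (g x i r))" for x i r
    using g'(2)[of "(x, i, r)"] by (simp add: encode_Pair encode_nat_def)
  define R where "R = (\<lambda>n. case prod_decode n of (a, k) \<Rightarrow> rec_nat (f' a)
     (\<lambda>i r. Option.bind r (\<lambda>y. g' (prod_encode (a, prod_encode (i, y))))) k)"
  have R: "R (prod_encode (encode x, k)) = Some (encode (rec_nat (f x) (g x) k))" for x k
    by (induction k) (simp_all add: R_def f' g'')
  have "computable (\<lambda>(x, k). rec_nat (f x) (g x) k)"
    unfolding computable_def
  proof (intro exI[of _ R] conjI allI)
    show "partial_recursive R" unfolding R_def by (intro pr_prec f' g')
  qed (auto simp: encode_Pair encode_nat_def R)
  from computable_comp[OF this computable_Pair[OF computable_id assms(3)]] show ?thesis by simp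
qed

lemma computable_nat_encode [computable_intros]:
  assumes "computable f" shows "computable (\<lambda>x. encode (f x))"
  by (rule computable_recode[OF assms, where k = "\<lambda>x. x"]) (simp_all add: encode_nat_def)

subsection \<open>Booleans and natural numbers\<close>

lemma computable_if [computable_intros]:
  assumes "computable b" "computable f" "computable g"
  shows "computable (\<lambda>x. if b x then f x else g x)"
proof -
  have "computable (\<lambda>x. rec_nat (g x) (\<lambda>_ _. f x) (encode (b x)))"
    by (intro computable_intros assms computable_comp[OF assms(2)])
  then show ?thesis by (rule computable_recode[where k = "\<lambda>x. x"]) (auto simp: encode_bool_def)
qed

lemma computable_is_0: assumes "computable f" shows "computable (\<lambda>x. f x = (0::nat))"
proof -
  have "computable (\<lambda>x. rec_nat True (\<lambda>_ _. False) (f x))"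
    by (intro computable_intros assms)
  moreover have "rec_nat True (\<lambda>_ _. False) n \<longleftrightarrow> n = 0" for n
    by (cases n) auto
  ultimately show ?thesis by simp
qed

lemma computable_not [computable_intros]:
  assumes "computable b" shows "computable (\<lambda>x. \<not> b x)"
proof -
  have "computable (\<lambda>x. if b x then False else True)" by (intro computable_intros assms)
  then show ?thesis by (rule computable_recode[where k = "\<lambda>x. x"]) auto
qed

lemma computable_conj [computable_intros]:
  assumes "computable b" "computable c" shows "computable (\<lambda>x. b x \<and> c x)"
proof -
  have "computable (\<lambda>x. if b x then c x else False)" by (intro computable_intros assms)
  then show ?thesis by (rule computable_recode[where k = "\<lambda>x. x"]) auto
qed

lemma computable_plus_nat [computable_intros]:
  assumes "computable f" "computable g" shows "computable (\<lambda>x. f x + g x :: nat)"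
proof -
  have "computable (\<lambda>x. rec_nat (f x) (\<lambda>_ r. Suc r) (g x))"
    by (intro computable_intros assms)
  moreover have "rec_nat m (\<lambda>_ r. Suc r) n = m + n" for m n by (induction n) auto
  ultimately show ?thesis by simp
qed

lemma computable_minus_nat [computable_intros]:
  assumes "computable f" "computable g" shows "computable (\<lambda>x. f x - g x :: nat)"
proof -
  have "computable (\<lambda>x. rec_nat (f x) (\<lambda>_ r. rec_nat 0 (\<lambda>i _. i) r) (g x))"
    by (intro computable_intros assms)
  moreover have "rec_nat 0 (\<lambda>i _. i) n = n - 1" for n by (cases n) auto
  moreover have "rec_nat m (\<lambda>_ r. r - 1) n = m - n" for m n :: nat by (induction n) auto
  ultimately show ?thesis by simp
qed

lemma computable_times_nat [computable_intros]:
  assumes "computable f" "computable g" shows "computable (\<lambda>x. f x * g x :: nat)"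
proof -
  have "computable (\<lambda>x. rec_nat 0 (\<lambda>_ r. r + f x) (g x))"
    by (intro computable_intros assms computable_comp[OF assms(1)])
  moreover have "rec_nat 0 (\<lambda>_ r. r + m) n = m * n" for m n :: nat by (induction n) auto
  ultimately show ?thesis by simp
qed

lemma computable_power_nat [computable_intros]:
  assumes "computable f" "computable g" shows "computable (\<lambda>x. f x ^ g x :: nat)"
proof -
  have "computable (\<lambda>x. rec_nat 1 (\<lambda>_ r. r * f x) (g x))"
    by (intro computable_intros assms computable_comp[OF assms(1)])
  moreover have "rec_nat 1 (\<lambda>_ r. r * m) n = m ^ n" for m n :: nat by (induction n) auto
  ultimately show ?thesis by simp
qed

lemma computable_eq [computable_intros]:
  assumes "computable f" "computable g" shows "computable (\<lambda>x. f x = g x)"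
proof -
  have "computable (\<lambda>x. (encode (f x) - encode (g x)) + (encode (g x) - encode (f x)) = 0)"
    by (intro computable_intros assms computable_is_0)
  moreover have "(encode a - encode b) + (encode b - encode a) = 0 \<longleftrightarrow> a = b" for a b :: 'b
    using injD[OF inj_encode, of a b] by auto
  ultimately show ?thesis by simp
qed

lemma computable_less [computable_intros]:
  assumes "computable f" "computable g" shows "computable (\<lambda>x. f x < (g x :: nat))"
proof -
  have "computable (\<lambda>x. \<not> g x - f x = 0)" by (intro computable_intros assms)
  then show ?thesis by (rule computable_recode[where k = "\<lambda>x. x"]) (auto simp: not_le)
qed

lemma computable_div_mod:
  assumes "computable f" "computable g"
  shows "computable (\<lambda>x. (f x div g x, f x mod g x :: nat))"
proof -
  define step where "step n = (\<lambda>(i::nat) r. if Suc (snd r) = n then (Suc (fst r), 0) else (fst r, Suc (snd r)))"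
    for n :: nat
  have "computable (\<lambda>x. rec_nat (0, 0) (step (g x)) (f x))"
    unfolding step_def by (intro computable_intros assms computable_comp[OF assms(2)])
  moreover have "rec_nat (0, 0) (step n) m = (m div n, m mod n)" for m n
    by (induction m) (auto simp: step_def div_Suc mod_Suc)
  ultimately show ?thesis by simp
qed

lemma computable_div [computable_intros]:
  assumes "computable f" "computable g" shows "computable (\<lambda>x. f x div g x :: nat)"
  using computable_fst[OF computable_div_mod[OF assms]] by simp

lemma computable_mod [computable_intros]:
  assumes "computable f" "computable g" shows "computable (\<lambda>x. f x mod g x :: nat)"
  using computable_snd[OF computable_div_mod[OF assms]] by simp

lemma computable_prod_encode [computable_intros]:
  assumes "computable f" "computable g" shows "computable (\<lambda>x. prod_encode (f x, g x))"
  using computable_nat_encode[OF computable_Pair[OF assms]] by (simp add: encode_Pair encode_nat_def)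

subsection \<open>Lists\<close>

lemma computable_Cons [computable_intros]:
  assumes "computable f" "computable g" shows "computable (\<lambda>x. f x # g x)"
proof -
  have "computable (\<lambda>x. Suc (encode (f x, g x)))" by (intro computable_intros assms)
  then show ?thesis
    by (rule computable_recode[where k = "\<lambda>x. x"]) (simp_all add: encode_Cons encode_Pair encode_nat_def)
qed

lemma computable_unCons: 
  assumes "computable f" 
  shows "computable (\<lambda>x. prod_decode (encode (f x) - 1))"
proof -
  have "computable prod_decode"
    by (rule computable_recode[OF computable_id, where k = "prod_decode"])
      (simp_all add: encode_prod_def encode_nat_def)
  then show ?thesis by (rule computable_comp) (intro computable_intros assms)
qed

lemma prod_decode_0: "prod_decode 0 = (0, 0)"
  using prod_encode_inverse[of "(0,0)"] by (simp add: prod_encode_def)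

lemma computable_tl [computable_intros]:
  assumes "computable f" shows "computable (\<lambda>x. tl (f x))"
proof (rule computable_recode[OF computable_snd[OF computable_unCons[OF assms]], where k = "\<lambda>x. x"])
  fix x
  show "encode (tl (f x)) = encode (snd (prod_decode (encode (f x) - 1)))"
    by (cases "f x") (simp_all add: encode_Nil encode_Cons encode_nat_def prod_decode_0)
qed simp

lemma computable_drop [computable_intros]:
  assumes "computable f" "computable n" shows "computable (\<lambda>x. drop (n x) (f x))"
proof -
  have "computable (\<lambda>x. rec_nat (f x) (\<lambda>_ r. tl r) (n x))" by (intro computable_intros assms)
  moreover have "rec_nat xs (\<lambda>_ r. tl r) m = drop m xs" for xs :: "'b list" and m
    by (induction m) (simp_all add: drop_Suc tl_drop)
  ultimately show ?thesis by simp
qed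

lemma computable_nth_default [computable_intros]:
  assumes "computable d" "computable f" "computable n"
  shows "computable (\<lambda>x. nth_default (d x) (f x) (n x))"
proof -
  let ?ys = "\<lambda>x. drop (n x) (f x)"
  have "computable (\<lambda>x. if ?ys x = [] then encode (d x)
    else fst (prod_decode (encode (?ys x) - 1)))"
    by (intro computable_intros computable_unCons assms)
  then show ?thesis
  proof (rule computable_recode[where k = "\<lambda>x. x"])
    fix x
    show "encode (nth_default (d x) (f x) (n x)) = encode (if ?ys x = [] then encode (d x)
      else fst (prod_decode (encode (?ys x) - 1)))"
    proof (cases "n x < length (f x)")
      case True
      then have "?ys x = (f x ! n x) # drop (Suc (n x)) (f x)" by (simp add: Cons_nth_drop_Suc)
      then show ?thesis using True by (simp add: nth_default_nth encode_Cons encode_nat_def)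
    next
      case False
      then show ?thesis by (simp add: nth_default_beyond encode_nat_def)
    qed
  qed simp
qed

text \<open>
  Codes of lists are large. They serve as bounds for loops and, later on, as bounds for degrees.
\<close>

lemma le_encode_list:
  "sum_list (map encode xs) + length xs \<le> encode xs"
proof (induction xs)
  case (Cons x xs)
  have "n \<le> triangle n" for n by (induction n) auto
  then have "encode x + encode xs \<le> prod_encode (encode x, encode xs)"
    by (simp add: prod_encode_def trans_le_add1)
  then show ?case using Cons by (simp add: encode_Cons)
qed simp

lemma computable_length [computable_intros]:
  assumes "computable f" shows "computable (\<lambda>x. length (f x))"
proof -
  have "computable (\<lambda>x. rec_nat 0 (\<lambda>i r. if drop i (f x) = [] then r else Suc r) (encode (f x)))"
    by (intro computable_intros assms computable_comp[OF assms])
  moreover have "rec_nat 0 (\<lambda>i r. if drop i xs = [] then r else Suc r) k = min k (length xs)"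
    for xs :: "'b list" and k by (induction k) auto
  moreover have "length xs \<le> encode xs" for xs :: "'b list"
    using le_encode_list[of xs] by simp
  ultimately show ?thesis by (simp add: min_absorb2)
qed

text \<open>
  The list is built from its end, because a step can only prepend an element.
\<close>

lemma computable_map_upt [computable_intros]:
  assumes "computable (\<lambda>p. g (fst p) (snd p))" "computable n"
  shows "computable (\<lambda>x. map (g x) [0..<n x])"
proof -
  have "computable (\<lambda>p :: 'a \<times> nat \<times> 'b list. (fst p, n (fst p) - 1 - fst (snd p)))"
    by (intro computable_intros computable_comp[OF assms(2)])
  from computable_comp[OF assms(1) this]
  have "computable (\<lambda>p :: 'a \<times> nat \<times> 'b list. g (fst p) (n (fst p) - 1 - fst (snd p)))"
    by simp
  then have "computable (\<lambda>x. rec_nat [] (\<lambda>i r. g x (n x - 1 - i) # r) (n x))"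
    by (intro computable_intros assms)
  moreover have "rec_nat [] (\<lambda>i r. h (m - 1 - i) # r) k = map h [m - k..<m]" if "k \<le> m"
    for h :: "nat \<Rightarrow> 'b" and m k
    using that
  proof (induction k)
    case (Suc k)
    then have "[m - Suc k..<m] = (m - Suc k) # [m - k..<m]"
      by (subst upt_conv_Cons) (auto simp: Suc_diff_Suc)
    then show ?case using Suc by simp
  qed simp
  ultimately show ?thesis by simp
qed

section \<open>Computing with polynomials over a finite ring\<close>

lemma length_coeffs_le_encode: "length (coeffs p) \<le> encode p"
  using le_encode_list[of "map to_nat (coeffs p)"]
  by (simp add: encode_poly_def code_poly_def encode_list_def code_list_def encode_nat_def comp_def)

lemma coeff_beyond_encode: "encode p \<le> i \<Longrightarrow> coeff p i = 0"
  using length_coeffs_le_encode[of p] nth_default_beyond[of "coeffs p" i 0]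
  by (simp add: nth_default_coeffs_eq)

lemma degree_le_encode: "degree p \<le> encode p"
  by (intro degree_le allI impI coeff_beyond_encode) simp

text \<open>
  A function on finitely many values is computed by a table.
\<close>

lemma computable_finite_range:
  assumes "computable h" "finite (range h)"
  shows "computable (\<lambda>x. F (h x))"
proof -
  have "computable (\<lambda>x. if h x \<in> S then F (h x) else undefined)" if "finite S" for S
    using that
  proof induction
    case empty
    then show ?case by (simp add: computable_const)
  next
    case (insert a S)
    have "computable (\<lambda>x. if h x = a then F a else if h x \<in> S then F (h x) else undefined)"
      by (intro computable_intros assms(1) insert.IH)
    then show ?case by (rule computable_recode[where k = "\<lambda>x. x"]) auto
  qed
  from this[OF assms(2)] show ?thesis by simp
qed

text \<open>
  The inverse of \<open>to_nat\<close>, extended by zero. This makes every operation on the finite ring a total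
  function of numbers that is given by a finite table.
\<close>

definition of_digit :: "nat \<Rightarrow> 'f::{finite,zero}" where
  "of_digit n = (if n \<in> range (to_nat :: 'f \<Rightarrow> nat) then from_nat n else 0)"

lemma of_digit_to_nat [simp]: "of_digit (to_nat x) = x"
  by (simp add: of_digit_def)

lemma of_digit_min:
  "\<exists>B. \<forall>n. (of_digit (min n B) :: 'f::{finite,zero}) = of_digit n"
proof -
  define B where "B = Suc (Max (range (to_nat :: 'f \<Rightarrow> nat)))"
  have less: "n < B" if "n \<in> range (to_nat :: 'f \<Rightarrow> nat)" for n
    using Max_ge[OF _ that] by (simp add: B_def less_Suc_eq_le)
  have "of_digit (min n B) = (of_digit n :: 'f)" for n
  proof (cases "n \<le> B")
    case False
    then have "n \<notin> range (to_nat :: 'f \<Rightarrow> nat)" "B \<notin> range (to_nat :: 'f \<Rightarrow> nat)"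
      using less[of n] less[of B] by linarith+
    then show ?thesis using False by (simp only: of_digit_def min_def if_False)
  qed (simp add: min_def)
  then show ?thesis by blast
qed

lemma computable_of_digit2:
  fixes F :: "'f::{finite,zero} \<Rightarrow> 'f \<Rightarrow> 'b::coded"
  assumes "computable f" "computable g"
  shows "computable (\<lambda>x. F (of_digit (f x)) (of_digit (g x)))"
proof -
  obtain B where B: "\<And>n. (of_digit (min n B) :: 'f) = of_digit n" using of_digit_min by blast
  define h where "h = (\<lambda>x. (min (f x) B, min (g x) B))"
  have "range h \<subseteq> {..B} \<times> {..B}" by (auto simp: h_def)
  then have "finite (range h)" by (rule finite_subset) simp
  moreover have "computable h"
    unfolding h_def min_def not_less[symmetric] by (intro computable_intros assms)
  ultimately show ?thesis
    using computable_finite_range[of h "\<lambda>(m, n). F (of_digit m) (of_digit n)"] by (simp add: h_def B)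
qed

lemma computable_of_digit:
  fixes F :: "'f::{finite,zero} \<Rightarrow> 'b::coded"
  assumes "computable f"
  shows "computable (\<lambda>x. F (of_digit (f x)))"
  using computable_of_digit2[OF assms assms, of "\<lambda>a _. F a"] .

lemma computable_to_nat_coeff:
  assumes "computable p" "computable i"
  shows "computable (\<lambda>x. to_nat (coeff (p x) (i x)))"
proof -
  have "computable (\<lambda>x. map to_nat (coeffs (p x)))"
    by (rule computable_recode[OF assms(1), where k = "\<lambda>x. x"])
      (simp_all add: encode_list_def encode_poly_def code_poly_def code_list_def encode_nat_def comp_def)
  then have "computable (\<lambda>x. nth_default (to_nat (0 :: 'b)) (map to_nat (coeffs (p x))) (i x))"
    by (intro computable_intros assms)
  then show ?thesis by (simp add: nth_default_map_eq nth_default_coeffs_eq)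
qed

text \<open>
  The finite ring has no encoding of its own; scalars occur only as arguments of a function \<open>F\<close> with
  coded values, such as \<open>to_nat\<close> or the embedding as constant polynomials.
\<close>

lemma computable_coeff2:
  fixes F :: "'f::{finite,zero} \<Rightarrow> 'f \<Rightarrow> 'b::coded"
  assumes "computable p" "computable i" "computable q" "computable j"
  shows "computable (\<lambda>x. F (coeff (p x) (i x)) (coeff (q x) (j x)))"
  using computable_of_digit2[OF computable_to_nat_coeff[OF assms(1,2)]
      computable_to_nat_coeff[OF assms(3,4)], of F] by simp

lemma computable_coeff:
  fixes F :: "'f::{finite,zero} \<Rightarrow> 'b::coded"
  assumes "computable p" "computable i"
  shows "computable (\<lambda>x. F (coeff (p x) (i x)))"
  using computable_coeff2[OF assms assms, of "\<lambda>a _. F a"] .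

lemma encode_pCons:
  "encode (pCons c p) = (if c = 0 \<and> encode p = 0 then 0
     else Suc (prod_encode (to_nat c, encode p)))"
proof -
  have "encode p = 0 \<longleftrightarrow> p = 0"
    using list_encode_eq[of _ "[]"] by (simp add: encode_poly_def code_poly_def code_list_def)
  then show ?thesis
    by (auto simp: encode_poly_def code_poly_def code_list_def cCons_def)
qed

lemma computable_pCons:
  assumes "computable (\<lambda>x. to_nat (c x))" "computable p"
  shows "computable (\<lambda>x. pCons (c x) (p x))"
proof -
  have "computable (\<lambda>x. if to_nat (c x) = to_nat (0 :: 'b) \<and> encode (p x) = 0 then 0
     else Suc (prod_encode (to_nat (c x), encode (p x))))"
    by (intro computable_intros assms)
  then show ?thesis
    by (rule computable_recode[where k = "\<lambda>x. x"]) (simp_all add: encode_pCons encode_nat_def)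
qed

text \<open>
  Polynomials are built from the top coefficient, because \<open>pCons\<close> removes leading zeros.
\<close>

lemma computable_Poly:
  fixes g :: "'e::coded \<Rightarrow> nat \<Rightarrow> 'f::{finite,zero}"
  assumes "computable (\<lambda>p. to_nat (g (fst p) (snd p)))" "computable n"
  shows "computable (\<lambda>x. Poly (map (g x) [0..<n x]))"
proof -
  have "computable (\<lambda>p :: 'e \<times> nat \<times> 'f poly. (fst p, n (fst p) - 1 - fst (snd p)))"
    by (intro computable_intros computable_comp[OF assms(2)])
  from computable_comp[OF assms(1) this]
  have "computable (\<lambda>p :: 'e \<times> nat \<times> 'f poly. to_nat (g (fst p) (n (fst p) - 1 - fst (snd p))))"
    by simp
  then have "computable (\<lambda>x. rec_nat 0 (\<lambda>i r. pCons (g x (n x - 1 - i)) r) (n x))"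
    by (intro computable_intros assms computable_pCons)
  moreover have "rec_nat 0 (\<lambda>i r. pCons (h (m - 1 - i)) r) k = Poly (map h [m - k..<m])" if "k \<le> m"
    for h :: "nat \<Rightarrow> 'f" and m k
    using that
  proof (induction k)
    case (Suc k)
    then have "[m - Suc k..<m] = (m - Suc k) # [m - k..<m]"
      by (subst upt_conv_Cons) (auto simp: Suc_diff_Suc)
    then show ?case using Suc by simp
  qed simp
  ultimately show ?thesis by simp
qed

lemma nth_default_map_upt: "nth_default 0 (map g [0..<n]) i = (if i < n then g i else 0)"
  by (simp add: nth_default_def)

lemma computable_plus_poly [computable_intros]:
  fixes p q :: "'e::coded \<Rightarrow> 'f::{finite,comm_monoid_add} poly"
  assumes "computable p" "computable q"
  shows "computable (\<lambda>x. p x + q x)"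
proof -
  have "computable (\<lambda>x. Poly (map (\<lambda>i. coeff (p x) i + coeff (q x) i) [0..<encode (p x) + encode (q x)]))"
    by (intro computable_Poly computable_intros assms
        computable_coeff2[where F = "\<lambda>a b. to_nat (a + b)"] computable_comp[OF assms(1)]
        computable_comp[OF assms(2)])
  moreover have "Poly (map (\<lambda>i. coeff p i + coeff q i) [0..<encode p + encode q]) = p + q"
    for p q :: "'f poly"
    by (rule poly_eqI) (simp add: nth_default_map_upt coeff_beyond_encode)
  ultimately show ?thesis by simp
qed

text \<open>
  Horner's scheme in the first factor, started at an index beyond its degree.
\<close>

lemma computable_times_poly [computable_intros]:
  fixes p q :: "'e::coded \<Rightarrow> 'f::{finite,comm_semiring_1} poly"
  assumes "computable p" "computable q"
  shows "computable (\<lambda>x. p x * q x)"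
proof -
  define scale where "scale p i q = Poly (map (\<lambda>j. coeff p i * coeff q j) [0..<encode q])"
    for p q :: "'f poly" and i
  have scale: "scale p i q = Polynomial.smult (coeff p i) q" for p q :: "'f poly" and i
    unfolding scale_def
    by (rule poly_eqI) (simp add: nth_default_map_upt coeff_beyond_encode)
  have "computable (\<lambda>x. rec_nat 0
      (\<lambda>i r. scale (p x) (encode (p x) - 1 - i) (q x) + pCons 0 r) (encode (p x)))"
    unfolding scale_def
    by (intro computable_Poly computable_intros assms computable_pCons
        computable_coeff2[where F = "\<lambda>a b. to_nat (a * b)"] computable_comp[OF assms(1)]
        computable_comp[OF assms(2)])
  moreover have "rec_nat 0 (\<lambda>i r. scale p (encode p - 1 - i) q + pCons 0 r) k
      = poly_shift (encode p - k) p * q" if "k \<le> encode p" for p q :: "'f poly" and k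
    using that
  proof (induction k)
    case 0
    have "poly_shift (encode p) p = 0"
      by (rule poly_eqI) (simp add: coeff_poly_shift coeff_beyond_encode)
    then show ?case by simp
  next
    case (Suc k)
    have "poly_shift (encode p - Suc k) p = pCons (coeff p (encode p - 1 - k)) (poly_shift (encode p - k) p)"
      by (rule poly_eqI) (use Suc.prems in \<open>auto simp: coeff_poly_shift coeff_pCons Suc_diff_Suc split: nat.splits\<close>)
    then show ?case using Suc by (simp add: scale)
  qed
  ultimately show ?thesis by simp
qed

text \<open>
  The decoding functions are total, so that a search may run over all numbers.
\<close>

definition decode_poly :: "nat \<Rightarrow> 'f::{finite,zero} poly" where
  "decode_poly n = Poly (map of_digit (list_decode n))"

lemma decode_poly_encode [simp]: "decode_poly (encode p) = p"
  by (simp add: decode_poly_def encode_poly_def code_poly_def code_list_def comp_def)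

lemma computable_list_decode:
  assumes "computable f" shows "computable (\<lambda>x. list_decode (f x))"
  by (rule computable_recode[OF assms, where k = "\<lambda>x. x"])
    (simp_all add: encode_list_def code_list_def encode_nat_def map_idI)

lemma computable_decode_poly [computable_intros]:
  fixes f :: "'e::coded \<Rightarrow> nat"
  assumes "computable f" shows "computable (\<lambda>x. decode_poly (f x) :: 'f::{finite,zero} poly)"
proof -
  let ?l = "\<lambda>x. list_decode (f x)"
  have "computable (\<lambda>x. Poly (map (\<lambda>i. of_digit (nth_default 0 (?l x) i) :: 'f) [0..<length (?l x)]))"
    by (intro computable_Poly computable_intros computable_list_decode assms
        computable_of_digit[where F = to_nat] computable_comp[OF assms(1)])
  moreover have "map (\<lambda>i. of_digit (nth_default 0 l i) :: 'f) [0..<length l] = map of_digit l" for l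
    by (rule nth_equalityI) (auto simp: nth_default_nth)
  ultimately show ?thesis by (simp add: decode_poly_def)
qed

definition decode_polys :: "nat \<Rightarrow> 'f::{finite,zero} poly list" where
  "decode_polys n = map decode_poly (list_decode n)"

lemma decode_polys_encode [simp]: "decode_polys (encode ps) = ps"
  by (simp add: decode_polys_def encode_list_def code_list_def comp_def)

lemma computable_decode_polys [computable_intros]:
  fixes f :: "'e::coded \<Rightarrow> nat"
  assumes "computable f" shows "computable (\<lambda>x. decode_polys (f x) :: 'f::{finite,zero} poly list)"
proof -
  let ?l = "\<lambda>x. list_decode (f x)"
  have "computable (\<lambda>x. map (\<lambda>i. decode_poly (nth_default 0 (?l x) i) :: 'f poly) [0..<length (?l x)])"
    by (intro computable_intros computable_list_decode assms computable_comp[OF assms(1)])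
  moreover have "map (\<lambda>i. decode_poly (nth_default 0 l i) :: 'f poly) [0..<length l] = map decode_poly l" for l
    by (rule nth_equalityI) (auto simp: nth_default_nth)
  ultimately show ?thesis by (simp add: decode_polys_def)
qed

section \<open>Computing with coordinates\<close>

lemma computable_sum [computable_intros]:
  fixes g :: "'e::coded \<Rightarrow> nat \<Rightarrow> nat"
  assumes "computable (\<lambda>p. g (fst p) (snd p))" "computable n"
  shows "computable (\<lambda>x. \<Sum>i<n x. g x i)"
proof -
  have "computable (\<lambda>p :: 'e \<times> nat \<times> nat. (fst p, fst (snd p)))"
    by (intro computable_intros)
  from computable_comp[OF assms(1) this]
  have "computable (\<lambda>p :: 'e \<times> nat \<times> nat. g (fst p) (fst (snd p)))" by simp
  then have "computable (\<lambda>x. rec_nat 0 (\<lambda>i r. r + g x i) (n x))"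
    by (intro computable_intros assms)
  moreover have "rec_nat 0 (\<lambda>i r. r + h i) m = (\<Sum>i<m. h i)" for h :: "nat \<Rightarrow> nat" and m
    by (induction m) simp_all
  ultimately show ?thesis by simp
qed

lemma computable_all [computable_intros]:
  fixes g :: "'e::coded \<Rightarrow> nat \<Rightarrow> bool"
  assumes "computable (\<lambda>p. g (fst p) (snd p))" "computable n"
  shows "computable (\<lambda>x. \<forall>i<n x. g x i)"
proof -
  have "computable (\<lambda>p :: 'e \<times> nat \<times> bool. (fst p, fst (snd p)))"
    by (intro computable_intros)
  from computable_comp[OF assms(1) this]
  have "computable (\<lambda>p :: 'e \<times> nat \<times> bool. g (fst p) (fst (snd p)))" by simp
  then have "computable (\<lambda>x. rec_nat True (\<lambda>i r. r \<and> g x i) (n x))"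
    by (intro computable_intros assms)
  moreover have "rec_nat True (\<lambda>i r. r \<and> h i) m \<longleftrightarrow> (\<forall>i<m. h i)" for h :: "nat \<Rightarrow> bool" and m
    by (induction m) (auto simp: less_Suc_eq)
  ultimately show ?thesis by simp
qed

definition frac_add :: "'f::comm_ring_1 poly \<times> 'f poly \<Rightarrow> 'f poly \<times> 'f poly \<Rightarrow> 'f poly \<times> 'f poly" where
  "frac_add x y = (fst x * snd y + fst y * snd x, snd x * snd y)"

definition frac_mult :: "'f::comm_ring_1 poly \<times> 'f poly \<Rightarrow> 'f poly \<times> 'f poly \<Rightarrow> 'f poly \<times> 'f poly" where
  "frac_mult x y = (fst x * fst y, snd x * snd y)"

text \<open>
  The operations on elements take the number of basis elements as a parameter and read missing
  coordinates as the fraction \<open>0 / 1\<close>, which makes them total.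
\<close>

definition elt_get :: "'f::comm_ring_1 elt \<Rightarrow> nat \<Rightarrow> 'f poly \<times> 'f poly" where
  "elt_get xs i = nth_default (0, 1) xs i"

definition elt_zero :: "nat \<Rightarrow> 'f::comm_ring_1 elt" where
  "elt_zero n = map (\<lambda>_. (0, 1)) [0..<n]"

definition elt_unit :: "nat \<Rightarrow> nat \<Rightarrow> 'f::comm_ring_1 elt" where
  "elt_unit n e = map (\<lambda>i. if i = e then (1, 1) else (0, 1)) [0..<n]"

definition elt_add :: "nat \<Rightarrow> 'f::comm_ring_1 elt \<Rightarrow> 'f elt \<Rightarrow> 'f elt" where
  "elt_add n xs ys = map (\<lambda>i. frac_add (elt_get xs i) (elt_get ys i)) [0..<n]"

definition elt_scale :: "nat \<Rightarrow> 'f::comm_ring_1 poly \<times> 'f poly \<Rightarrow> 'f elt \<Rightarrow> 'f elt" where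
  "elt_scale n c xs = map (\<lambda>i. frac_mult c (elt_get xs i)) [0..<n]"

definition elt_sum :: "nat \<Rightarrow> (nat \<Rightarrow> 'f::comm_ring_1 elt) \<Rightarrow> nat \<Rightarrow> 'f elt" where
  "elt_sum n f m = rec_nat (elt_zero n) (\<lambda>i r. elt_add n r (f i)) m"

abbreviation get2 :: "'a list list list \<Rightarrow> nat \<Rightarrow> nat \<Rightarrow> 'a list" where
  "get2 xs i j \<equiv> nth_default [] (nth_default [] xs i) j"

definition elt_mult :: "'f::comm_ring_1 elt list list \<Rightarrow> 'f elt \<Rightarrow> 'f elt \<Rightarrow> 'f elt" where
  "elt_mult tab xs ys = elt_sum (length tab) (\<lambda>i. elt_sum (length tab) (\<lambda>j.
     elt_scale (length tab) (frac_mult (elt_get xs i) (elt_get ys j)) (get2 tab i j))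
     (length tab)) (length tab)"

text \<open>Exponents are shifted by one, because the coordinates of \<open>1\<close> are not part of the input.\<close>

definition elt_power_Suc :: "'f::comm_ring_1 elt list list \<Rightarrow> 'f elt \<Rightarrow> nat \<Rightarrow> 'f elt" where
  "elt_power_Suc tab xs k = rec_nat xs (\<lambda>_ r. elt_mult tab r xs) k"

definition elt_frobenius :: "nat \<Rightarrow> 'f::comm_ring_1 elt list list \<Rightarrow> 'f elt \<Rightarrow> nat \<Rightarrow> 'f elt" where
  "elt_frobenius q tab xs r = rec_nat xs (\<lambda>_ ys. elt_power_Suc tab ys (q - 1)) r"

lemma computable_frac_add [computable_intros]:
  fixes f g :: "'e::coded \<Rightarrow> 'f::{finite,comm_ring_1} poly \<times> 'f poly"
  assumes "computable f" "computable g" shows "computable (\<lambda>x. frac_add (f x) (g x))"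
  unfolding frac_add_def by (intro computable_intros assms)

lemma computable_frac_mult [computable_intros]:
  fixes f g :: "'e::coded \<Rightarrow> 'f::{finite,comm_ring_1} poly \<times> 'f poly"
  assumes "computable f" "computable g" shows "computable (\<lambda>x. frac_mult (f x) (g x))"
  unfolding frac_mult_def by (intro computable_intros assms)

lemma computable_elt_get [computable_intros]:
  fixes f :: "'e::coded \<Rightarrow> 'f::{finite,comm_ring_1} elt"
  assumes "computable f" "computable i" shows "computable (\<lambda>x. elt_get (f x) (i x))"
  unfolding elt_get_def by (intro computable_intros assms)

lemma computable_elt_zero [computable_intros]:
  assumes "computable n" shows "computable (\<lambda>x. elt_zero (n x) :: 'f::{finite,comm_ring_1} elt)"
  unfolding elt_zero_def by (intro computable_intros assms)

lemma computable_elt_unit [computable_intros]: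
  assumes "computable n" "computable e"
  shows "computable (\<lambda>x. elt_unit (n x) (e x) :: 'f::{finite,comm_ring_1} elt)"
  unfolding elt_unit_def by (intro computable_intros assms computable_comp[OF assms(2)])

lemma computable_elt_add [computable_intros]:
  fixes f g :: "'e::coded \<Rightarrow> 'f::{finite,comm_ring_1} elt"
  assumes "computable n" "computable f" "computable g"
  shows "computable (\<lambda>x. elt_add (n x) (f x) (g x))"
  unfolding elt_add_def
  by (intro computable_intros assms computable_comp[OF assms(2)] computable_comp[OF assms(3)])

lemma computable_elt_scale [computable_intros]:
  fixes f :: "'e::coded \<Rightarrow> 'f::{finite,comm_ring_1} elt"
  assumes "computable n" "computable c" "computable f"
  shows "computable (\<lambda>x. elt_scale (n x) (c x) (f x))"
  unfolding elt_scale_def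
  by (intro computable_intros assms computable_comp[OF assms(2)] computable_comp[OF assms(3)])

lemma computable_elt_sum [computable_intros]:
  fixes f :: "'e::coded \<Rightarrow> nat \<Rightarrow> 'f::{finite,comm_ring_1} elt"
  assumes "computable n" "computable (\<lambda>p. f (fst p) (snd p))" "computable m"
  shows "computable (\<lambda>x. elt_sum (n x) (f x) (m x))"
proof -
  have "computable (\<lambda>p :: 'e \<times> nat \<times> 'f elt. (fst p, fst (snd p)))"
    by (intro computable_intros)
  from computable_comp[OF assms(2) this]
  have "computable (\<lambda>p :: 'e \<times> nat \<times> 'f elt. f (fst p) (fst (snd p)))" by simp
  then show ?thesis
    unfolding elt_sum_def by (intro computable_intros assms computable_comp[OF assms(1)])
qed

lemma computable_elt_mult [computable_intros]:
  fixes f g :: "'e::coded \<Rightarrow> 'f::{finite,comm_ring_1} elt"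
  assumes "computable tab" "computable f" "computable g"
  shows "computable (\<lambda>x. elt_mult (tab x) (f x) (g x))"
  unfolding elt_mult_def
  by (intro computable_intros computable_comp[OF assms(1)] computable_comp[OF assms(2)]
      computable_comp[OF assms(3)])

lemma computable_elt_power_Suc [computable_intros]:
  fixes f :: "'e::coded \<Rightarrow> 'f::{finite,comm_ring_1} elt"
  assumes "computable tab" "computable f" "computable k"
  shows "computable (\<lambda>x. elt_power_Suc (tab x) (f x) (k x))"
  unfolding elt_power_Suc_def
  by (intro computable_intros assms computable_comp[OF assms(1)] computable_comp[OF assms(2)])

lemma computable_elt_frobenius [computable_intros]:
  fixes f :: "'e::coded \<Rightarrow> 'f::{finite,comm_ring_1} elt"
  assumes "computable tab" "computable f" "computable r"
  shows "computable (\<lambda>x. elt_frobenius q (tab x) (f x) (r x))"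
  unfolding elt_frobenius_def
  by (intro computable_intros assms computable_comp[OF assms(1)])

section \<open>Correctness of the computation in coordinates\<close>

context coordinates
begin

lemma representsI:
  assumes "length xs = length bs" "\<And>i. i < length bs \<Longrightarrow> snd (xs ! i) \<noteq> 0"
    and "x = (\<Sum>i<length bs. ratfun emb (xs ! i) * bs ! i)"
  shows "represents emb bs xs x"
proof -
  have "\<forall>z\<in>set xs. snd z \<noteq> 0"
  proof
    fix z assume "z \<in> set xs"
    then obtain i where "i < length xs" "z = xs ! i" by (auto simp: in_set_conv_nth)
    then show "snd z \<noteq> 0" using assms(1,2) by simp
  qed
  then show ?thesis unfolding represents_def case_prod_unfold using assms(1,3) by simp
qed

lemma represents_length: "represents emb bs xs x \<Longrightarrow> length xs = length bs"
  by (simp add: represents_def)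

lemma represents_sum: "represents emb bs xs x \<Longrightarrow> x = (\<Sum>i<length bs. ratfun emb (xs ! i) * bs ! i)"
  by (simp add: represents_def)

lemma elt_get_represents: "represents emb bs xs x \<Longrightarrow> i < length bs \<Longrightarrow> elt_get xs i = xs ! i"
  by (simp add: elt_get_def nth_default_nth represents_length)

lemma ratfun_frac_add:
  "snd x \<noteq> 0 \<Longrightarrow> snd y \<noteq> 0 \<Longrightarrow> ratfun emb (frac_add x y) = ratfun emb x + ratfun emb y"
  by (cases x; cases y) (simp add: frac_add_def ratfun_eq hom_distribs add_frac_eq)

lemma ratfun_frac_mult: "ratfun emb (frac_mult x y) = ratfun emb x * ratfun emb y"
  by (cases x; cases y) (simp add: frac_mult_def ratfun_eq hom_distribs)

lemma represents_zero: "represents emb bs (elt_zero (length bs)) 0"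
  by (rule representsI) (simp_all add: elt_zero_def ratfun_eq)

lemma represents_unit:
  assumes "e < length bs"
  shows "represents emb bs (elt_unit (length bs) e) (bs ! e)"
proof (rule representsI)
  have "(\<Sum>i<length bs. ratfun emb (elt_unit (length bs) e ! i) * bs ! i)
      = (\<Sum>i<length bs. if i = e then bs ! i else 0)"
    by (intro sum.cong refl) (auto simp: elt_unit_def ratfun_eq)
  then show "bs ! e = (\<Sum>i<length bs. ratfun emb (elt_unit (length bs) e ! i) * bs ! i)"
    using assms by simp
qed (simp_all add: elt_unit_def)

lemma represents_add:
  assumes "represents emb bs xs x" "represents emb bs ys y"
  shows "represents emb bs (elt_add (length bs) xs ys) (x + y)"
proof (rule representsI)
  have *: "elt_add (length bs) xs ys ! i = frac_add (xs ! i) (ys ! i)" if "i < length bs" for i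
    using that by (simp add: elt_add_def elt_get_represents[OF assms(1)] elt_get_represents[OF assms(2)])
  show "snd (elt_add (length bs) xs ys ! i) \<noteq> 0" if "i < length bs" for i
    using represents_snd[OF assms(1) that] represents_snd[OF assms(2) that] *[OF that]
    by (simp add: frac_add_def)
  have "x + y = (\<Sum>i<length bs. (ratfun emb (xs ! i) + ratfun emb (ys ! i)) * bs ! i)"
    unfolding represents_sum[OF assms(1)] represents_sum[OF assms(2)] by (simp add: distrib_right sum.distrib)
  also have "\<dots> = (\<Sum>i<length bs. ratfun emb (elt_add (length bs) xs ys ! i) * bs ! i)"
    by (intro sum.cong refl)
      (simp add: * ratfun_frac_add represents_snd[OF assms(1)] represents_snd[OF assms(2)])
  finally show "x + y = (\<Sum>i<length bs. ratfun emb (elt_add (length bs) xs ys ! i) * bs ! i)" .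
qed (simp add: elt_add_def)

lemma represents_scale:
  assumes "snd c \<noteq> 0" "represents emb bs xs x"
  shows "represents emb bs (elt_scale (length bs) c xs) (ratfun emb c * x)"
proof (rule representsI)
  have *: "elt_scale (length bs) c xs ! i = frac_mult c (xs ! i)" if "i < length bs" for i
    using that by (simp add: elt_scale_def elt_get_represents[OF assms(2)])
  show "snd (elt_scale (length bs) c xs ! i) \<noteq> 0" if "i < length bs" for i
    using represents_snd[OF assms(2) that] assms(1) *[OF that] by (simp add: frac_mult_def)
  have "ratfun emb c * x = (\<Sum>i<length bs. (ratfun emb c * ratfun emb (xs ! i)) * bs ! i)"
    unfolding represents_sum[OF assms(2)] by (simp add: sum_distrib_left mult.assoc)
  also have "\<dots> = (\<Sum>i<length bs. ratfun emb (elt_scale (length bs) c xs ! i) * bs ! i)"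
    by (intro sum.cong refl) (simp add: * ratfun_frac_mult)
  finally show "ratfun emb c * x = (\<Sum>i<length bs. ratfun emb (elt_scale (length bs) c xs ! i) * bs ! i)" .
qed (simp add: elt_scale_def)

lemma represents_elt_sum:
  assumes "\<And>i. i < m \<Longrightarrow> represents emb bs (f i) (x i)"
  shows "represents emb bs (elt_sum (length bs) f m) (\<Sum>i<m. x i)"
  using assms
proof (induction m)
  case 0
  then show ?case by (simp add: elt_sum_def represents_zero)
next
  case (Suc m)
  have "represents emb bs (elt_sum (length bs) f m) (\<Sum>i<m. x i)"
    by (rule Suc.IH, rule Suc.prems) simp
  from represents_add[OF this Suc.prems[OF lessI]] show ?case by (simp add: elt_sum_def)
qed

end

locale coordinates_table = coordinates emb bs
  for emb :: "'f::{finite,field} fls \<Rightarrow> 'c::field" and bs +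
  fixes tab :: "'f elt list list"
  assumes table: "list_all2 (list_all2 (represents emb bs)) tab (map (\<lambda>b. map (\<lambda>b'. b * b') bs) bs)"
begin

lemma length_tab: "length tab = length bs"
  using list_all2_lengthD[OF table] by simp

lemma represents_tab:
  assumes "i < length bs" "j < length bs"
  shows "represents emb bs (get2 tab i j) (bs ! i * bs ! j)"
proof -
  have 1: "list_all2 (represents emb bs) (tab ! i) (map (\<lambda>b'. bs ! i * b') bs)"
    using list_all2_nthD2[OF table, of i] assms by simp
  from list_all2_nthD2[OF this, of j] list_all2_lengthD[OF 1] show ?thesis
    using assms by (simp add: nth_default_nth length_tab)
qed

lemma represents_mult:
  assumes "represents emb bs xs x" "represents emb bs ys y"
  shows "represents emb bs (elt_mult tab xs ys) (x * y)"
proof -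
  have "represents emb bs (elt_mult tab xs ys)
    (\<Sum>i<length bs. \<Sum>j<length bs. ratfun emb (frac_mult (xs ! i) (ys ! j)) * (bs ! i * bs ! j))"
    unfolding elt_mult_def length_tab
  proof (intro represents_elt_sum)
    fix i j assume ij: "i < length bs" "j < length bs"
    have "snd (frac_mult (xs ! i) (ys ! j)) \<noteq> 0"
      using represents_snd[OF assms(1) ij(1)] represents_snd[OF assms(2) ij(2)]
      by (simp add: frac_mult_def)
    from represents_scale[OF this represents_tab[OF ij]]
    show "represents emb bs (elt_scale (length bs) (frac_mult (elt_get xs i) (elt_get ys j)) (get2 tab i j))
        (ratfun emb (frac_mult (xs ! i) (ys ! j)) * (bs ! i * bs ! j))"
      using ij by (simp add: elt_get_represents[OF assms(1)] elt_get_represents[OF assms(2)])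
  qed
  also have "(\<Sum>i<length bs. \<Sum>j<length bs. ratfun emb (frac_mult (xs ! i) (ys ! j)) * (bs ! i * bs ! j)) = x * y"
    unfolding represents_sum[OF assms(1)] represents_sum[OF assms(2)] sum_product
    by (intro sum.cong refl) (simp add: ratfun_frac_mult)
  finally show ?thesis .
qed

lemma represents_power_Suc:
  assumes "represents emb bs xs x"
  shows "represents emb bs (elt_power_Suc tab xs k) (x ^ Suc k)"
proof (induction k)
  case 0
  then show ?case using assms by (simp add: elt_power_Suc_def)
next
  case (Suc k)
  from represents_mult[OF this assms] show ?case by (simp add: elt_power_Suc_def mult.commute)
qed

lemma represents_frobenius:
  assumes "represents emb bs xs x"
  shows "represents emb bs (elt_frobenius q tab xs r) (x ^ q ^ r)"
proof (induction r)
  case 0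
  then show ?case using assms by (simp add: elt_frobenius_def)
next
  case (Suc r)
  have "x ^ q ^ Suc r = (x ^ q ^ r) ^ Suc (q - 1)"
    using q_pos by (simp only: Suc_diff_1 power_Suc2 power_mult)
  with represents_power_Suc[OF Suc, of "q - 1"] show ?case by (simp add: elt_frobenius_def)
qed

end

section \<open>Deciding whether a vector is a relation\<close>

text \<open>
  The components are the dimension, the multiplication table of the basis, the coefficients of the
  action of \<open>t\<close>, and the points.
\<close>

type_synonym 'f input = "nat \<times> 'f elt list list \<times> 'f elt list list list \<times> 'f elt list list"

abbreviation input_dim :: "'f input \<Rightarrow> nat" where "input_dim x \<equiv> fst x"
abbreviation input_table :: "'f input \<Rightarrow> 'f elt list list" where "input_table x \<equiv> fst (snd x)"
abbreviation input_action :: "'f input \<Rightarrow> 'f elt list list list" where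
  "input_action x \<equiv> fst (snd (snd x))"
abbreviation input_points :: "'f input \<Rightarrow> 'f elt list list" where "input_points x \<equiv> snd (snd (snd x))"
abbreviation input_degree :: "'f input \<Rightarrow> nat" where "input_degree x \<equiv> length (input_table x)"

abbreviation action_entry :: "'f input \<Rightarrow> nat \<Rightarrow> nat \<Rightarrow> nat \<Rightarrow> 'f elt" where
  "action_entry x r k j \<equiv> nth_default [] (get2 (input_action x) r k) j"

definition horner_step :: "'f::{finite,field} input \<Rightarrow> 'f poly list \<Rightarrow> nat \<Rightarrow> 'f elt list \<Rightarrow> 'f elt list" where
  "horner_step x a m v = map (\<lambda>k. elt_add (input_degree x)
      (elt_sum (input_degree x) (\<lambda>i. elt_scale (input_degree x)
         ([:coeff (nth_default 0 a i) m:], 1) (get2 (input_points x) i k)) (length (input_points x)))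
      (elt_sum (input_degree x) (\<lambda>r. elt_sum (input_degree x) (\<lambda>j.
         elt_mult (input_table x) (action_entry x r k j)
           (elt_frobenius CARD('f) (input_table x) (nth_default [] v j) r)) (input_dim x))
         (length (input_action x)))) [0..<input_dim x]"

text \<open>
  The first \<open>m\<close> steps of the scheme for a polynomial vector of degree less than \<open>N\<close>.
\<close>

definition horner :: "'f::{finite,field} input \<Rightarrow> 'f poly list \<Rightarrow> nat \<Rightarrow> nat \<Rightarrow> 'f elt list" where
  "horner x a N m = rec_nat (map (\<lambda>_. elt_zero (input_degree x)) [0..<input_dim x])
     (\<lambda>i v. horner_step x a (N - 1 - i) v) m"

text \<open>
  The code of \<open>a\<close> is at least the number of coefficients of each entry, so that it may serve as the
  length of the scheme.
\<close>

definition is_relation :: "'f::{finite,field} input \<Rightarrow> 'f poly list \<Rightarrow> bool" where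
  "is_relation x a \<longleftrightarrow> length a = length (input_points x) \<and>
     (\<forall>k<input_dim x. \<forall>e<input_degree x.
        fst (elt_get (nth_default [] (horner x a (encode a) (encode a)) k) e) = 0)"

definition action_elt :: "'f::{finite,field} input \<Rightarrow> nat \<Rightarrow> nat \<Rightarrow> nat \<Rightarrow> nat \<Rightarrow> 'f elt" where
  "action_elt x r k j e = elt_mult (input_table x) (action_entry x r k j)
     (elt_frobenius CARD('f) (input_table x) (elt_unit (input_degree x) e) r)"

text \<open>
  Codes dominate the sizes of the fractions that they contain, so this is a bound for the sum of all
  degrees in the matrices of the action and in the points.
\<close>

definition input_size :: "'f::{finite,field} input \<Rightarrow> nat" where
  "input_size x =
     (\<Sum>r<length (input_action x). \<Sum>k<input_dim x. \<Sum>j<input_dim x. \<Sum>e<input_degree x.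
        encode (action_elt x r k j e))
     + (\<Sum>i<length (input_points x). \<Sum>k<input_dim x. encode (get2 (input_points x) i k))"

definition relation_degree :: "'f::{finite,field} input \<Rightarrow> nat" where
  "relation_degree x = state_bound CARD('f) (input_dim x * input_degree x)
     (length (input_action x)) (input_size x)"

text \<open>
  A bound for the codes of lists with at most \<open>k\<close> entries, whose codes are at most \<open>y\<close>.
\<close>

definition list_code_bound :: "nat \<Rightarrow> nat \<Rightarrow> nat" where
  "list_code_bound y k = rec_nat 0 (\<lambda>_ c. Suc (prod_encode (y, c))) k"

definition relation_code_bound :: "'f::{finite,field} input \<Rightarrow> nat" where
  "relation_code_bound x = Suc (list_code_bound
     (list_code_bound (Max (range (to_nat :: 'f \<Rightarrow> nat))) (Suc (relation_degree x)))
     (length (input_points x)))"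

text \<open>
  Numbers that do not code a relation contribute the zero vector. Every entry of the list is a
  relation, and every relation of degree at most \<open>relation_degree\<close> occurs.
\<close>

definition relation_generators :: "'f::{finite,field} input \<Rightarrow> 'f poly list list" where
  "relation_generators x = map (\<lambda>m. if is_relation x (decode_polys m) then decode_polys m
     else map (\<lambda>_. 0) [0..<length (input_points x)]) [0..<relation_code_bound x]"

lemma computable_horner:
  "computable (\<lambda>p :: 'f::{finite,field} input \<times> 'f poly list. horner (fst p) (snd p) (encode (snd p)) (encode (snd p)))"
  unfolding horner_def horner_step_def
  by (intro computable_intros computable_coeff[where F = "\<lambda>c. [:c:]"])

lemma computable_is_relation [computable_intros]:
  fixes f :: "'e::coded \<Rightarrow> 'f::{finite,field} input"
  assumes "computable f" "computable g"
  shows "computable (\<lambda>x. is_relation (f x) (g x))"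
proof -
  have h: "computable (\<lambda>x. horner (f x) (g x) (encode (g x)) (encode (g x)))"
    using computable_comp[OF computable_horner computable_Pair[OF assms]] by simp
  show ?thesis
    unfolding is_relation_def
    by (intro computable_intros assms computable_comp[OF assms(1)] computable_comp[OF assms(2)]
        computable_comp[OF h])
qed

lemma computable_relation_degree: "computable (\<lambda>x :: 'f::{finite,field} input. relation_degree x)"
  unfolding relation_degree_def state_bound_def solution_height_def elim_height_def
    elim_conditions_def elim_length_def input_size_def action_elt_def
  by (intro computable_intros)

lemma computable_list_code_bound [computable_intros]:
  assumes "computable f" "computable g"
  shows "computable (\<lambda>x. list_code_bound (f x) (g x))"
  unfolding list_code_bound_def by (intro computable_intros assms computable_comp[OF assms(1)])

lemma computable_relation_code_bound:
  "computable (\<lambda>x :: 'f::{finite,field} input. relation_code_bound x)"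
  unfolding relation_code_bound_def by (intro computable_intros computable_relation_degree)

lemma computable_relation_generators:
  "computable (\<lambda>x :: 'f::{finite,field} input. relation_generators x)"
  unfolding relation_generators_def by (intro computable_intros computable_relation_code_bound)

lemma prod_encode_mono: "a \<le> b \<Longrightarrow> c \<le> e \<Longrightarrow> prod_encode (a, c) \<le> prod_encode (b, e)"
proof -
  have "triangle m \<le> triangle n" if "m \<le> n" for m n
    by (rule lift_Suc_mono_le[OF _ that]) simp
  then show "a \<le> b \<Longrightarrow> c \<le> e \<Longrightarrow> prod_encode (a, c) \<le> prod_encode (b, e)"
    by (simp add: prod_encode_def add_mono)
qed

lemma encode_le_list_code_bound:
  assumes "\<And>z. z \<in> set xs \<Longrightarrow> encode z \<le> y" "length xs \<le> k"
  shows "encode xs \<le> list_code_bound y k"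
  using assms
proof (induction xs arbitrary: k)
  case Nil
  then show ?case by (simp add: encode_Nil)
next
  case (Cons z xs)
  then obtain k' where k: "k = Suc k'" "length xs \<le> k'" by (cases k) auto
  have "encode xs \<le> list_code_bound y k'" using Cons k by simp
  then have "prod_encode (encode z, encode xs) \<le> prod_encode (y, list_code_bound y k')"
    using Cons.prems(1)[of z] by (intro prod_encode_mono) auto
  then show ?case by (simp add: encode_Cons k list_code_bound_def)
qed

lemma encode_poly_le:
  fixes p :: "'f::{finite,zero} poly"
  assumes "degree p \<le> N"
  shows "encode p \<le> list_code_bound (Max (range (to_nat :: 'f \<Rightarrow> nat))) (Suc N)"
proof -
  have "encode p = encode (map to_nat (coeffs p) :: nat list)"
    by (simp add: encode_poly_def code_poly_def encode_list_def code_list_def encode_nat_def comp_def)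
  also have "\<dots> \<le> list_code_bound (Max (range (to_nat :: 'f \<Rightarrow> nat))) (Suc N)"
  proof (rule encode_le_list_code_bound)
    show "length (map to_nat (coeffs p)) \<le> Suc N"
      using assms by (cases "p = 0") (simp_all add: length_coeffs_degree)
    fix z assume "z \<in> set (map (to_nat :: 'f \<Rightarrow> nat) (coeffs p))"
    then have "z \<in> range (to_nat :: 'f \<Rightarrow> nat)" by auto
    then show "encode z \<le> Max (range (to_nat :: 'f \<Rightarrow> nat))"
      unfolding encode_nat_def by (intro Max_ge) auto
  qed
  finally show ?thesis .
qed

lemma fraction_size_le_encode: "fraction_size x \<le> encode x"
proof -
  have "n \<le> triangle n" for n by (induction n) auto
  then have "encode (fst x) + encode (snd x) \<le> encode x"
    by (simp add: encode_prod_def prod_encode_def trans_le_add1)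
  then show ?thesis
    using degree_le_encode[of "fst x"] degree_le_encode[of "snd x"] by (simp add: fraction_size_def)
qed

lemma fraction_sizes_le_encode: "(\<Sum>i<length xs. fraction_size (xs ! i)) \<le> encode xs"
proof -
  have "(\<Sum>i<length xs. fraction_size (xs ! i)) \<le> (\<Sum>i<length xs. encode (xs ! i))"
    by (intro sum_mono fraction_size_le_encode)
  also have "\<dots> = sum_list (map encode xs)" by (simp add: sum_list_sum_nth atLeast0LessThan)
  also have "\<dots> \<le> encode xs" using le_encode_list[of xs] by simp
  finally show ?thesis .
qed

locale presented_t_module = t_action emb bs L d \<phi> P + coordinates_table emb bs tab
  for emb :: "'f::{finite,field} fls \<Rightarrow> 'c::field" and bs L d \<phi> P tab +
  fixes T X
  assumes presents_action: "presents_t_module emb bs T \<phi>"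
    and presents_P: "presents_points emb bs X P"
begin

definition input :: "'f input" where "input = (d, tab, T, X)"

lemma length_X: "length X = length P"
  using presents_P list_all2_lengthD by (fastforce simp: presents_points_def)

lemma represents_point:
  assumes "i < length P" "k < d"
  shows "represents emb bs (get2 X i k) (P ! i $ k)"
proof -
  have "P ! i \<in> carrier_vec d" using points assms(1) nth_mem by blast
  then have dim: "dim_vec (P ! i) = d" by simp
  have 1: "list_all2 (represents emb bs) (X ! i) (list_of_vec (P ! i))"
    using presents_P list_all2_nthD2[of _ X "map list_of_vec P" i] assms(1)
    by (simp add: presents_points_def)
  from list_all2_lengthD[OF this] have "length (X ! i) = d" using dim by simp
  moreover have "list_of_vec (P ! i) ! k = P ! i $ k" using dim assms(2) by (simp add: list_of_vec_index)
  ultimately show ?thesis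
    using list_all2_nthD[OF 1, of k] assms by (simp add: nth_default_nth length_X)
qed

lemma represents_action:
  assumes "r < length T" "k < d" "j < d"
  shows "represents emb bs (nth_default [] (get2 T r k) j) (coeff (\<phi> [:0, 1:] $$ (k, j)) r)"
proof -
  let ?A = "tau_coeff (\<phi> [:0, 1:]) r"
  have A: "?A \<in> carrier_mat d d" using \<phi>_carrier by (simp add: tau_coeff_def)
  have 1: "list_all2 (list_all2 (represents emb bs)) (T ! r) (mat_to_list ?A)"
    using presents_action list_all2_nthD[of _ T _ r] assms(1)
    by (fastforce simp: presents_t_module_def)
  have len: "length (mat_to_list ?A) = d" using A by (simp add: mat_to_list_def)
  have row: "mat_to_list ?A ! k = map (\<lambda>j. ?A $$ (k, j)) [0..<d]"
    using A assms by (simp add: mat_to_list_def)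
  have 2: "list_all2 (represents emb bs) (T ! r ! k) (map (\<lambda>j. ?A $$ (k, j)) [0..<d])"
    using list_all2_nthD2[OF 1, of k] assms(2) len row by simp
  have 3: "represents emb bs (T ! r ! k ! j) (?A $$ (k, j))"
    using list_all2_nthD2[OF 2, of j] assms(3) by simp
  have "?A $$ (k, j) = coeff (\<phi> [:0, 1:] $$ (k, j)) r"
    using A assms \<phi>_carrier[of "[:0, 1:]"] by (simp add: tau_coeff_def)
  then show ?thesis
    using 3 assms list_all2_lengthD[OF 1] list_all2_lengthD[OF 2] len by (simp add: nth_default_nth)
qed

lemma action_degree: "k < d \<Longrightarrow> j < d \<Longrightarrow> degree (\<phi> [:0, 1:] $$ (k, j)) < length T"
  using degree_le_mat_degree[OF \<phi>_carrier, of k j "[:0, 1:]"] presents_action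
  by (simp add: presents_t_module_def)

sublocale t_coordinates emb bs L d \<phi> P "length T" "action_elt input" "get2 X"
proof
  fix r k j e assume *: "r < length T" "k < d" "j < d" "e < length bs"
  show "represents emb bs (action_elt input r k j e) (coeff (\<phi> [:0, 1:] $$ (k, j)) r * bs ! e ^ q ^ r)"
    using represents_mult[OF represents_action[OF *(1-3)] represents_frobenius[OF represents_unit[OF *(4)]]]
    by (simp add: action_elt_def input_def length_tab q_def)
qed (fact action_degree represents_point)+

lemma size_bound_le: "size_bound \<le> input_size input"
proof -
  have 1: "(\<Sum>e'<length bs. fraction_size (xs ! e')) \<le> encode xs" if "represents emb bs xs v" for xs v
    using fraction_sizes_le_encode[of xs] represents_length[OF that] by simp
  show ?thesis
    unfolding size_bound_def input_size_def
    by (intro add_mono)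
      (auto simp: input_def length_tab length_X intro!: sum_mono 1[OF \<alpha>[unfolded input_def]] 1[OF \<xi>])
qed

text \<open>
  This combines the bound for the states with the pigeonhole argument.
\<close>

lemma relations_in_closure:
  assumes "\<And>x y. C x \<Longrightarrow> C y \<Longrightarrow> C (\<lambda>i. x i + y i)" "\<And>b x. C x \<Longrightarrow> C (\<lambda>i. b * x i)"
    and "\<And>g. combination g = (\<lambda>_. 0) \<Longrightarrow> (\<And>i. i < length P \<Longrightarrow> degree (g i) \<le> relation_degree input) \<Longrightarrow> C g"
    and "combination a = (\<lambda>_. 0)"
  shows "C a"
proof (rule small_relations_generate[where N = "relation_degree input", OF _ assms(1,2,3,4)])
  fix a assume "combination a = (\<lambda>_. 0)"
  from states_bound[OF this size_bound_le]
  show "finite (states a) \<and> card (states a) \<le> relation_degree input"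
    by (simp add: relation_degree_def input_def q_def length_tab)
qed

definition represents_vec :: "'f elt list \<Rightarrow> (nat \<Rightarrow> 'c) \<Rightarrow> bool" where
  "represents_vec v s \<longleftrightarrow> (\<forall>k<d. represents emb bs (nth_default [] v k) (s k))"

lemma represents_horner_step:
  assumes "represents_vec v (combination b)" "length a = length P"
  shows "represents_vec (horner_step input a m v) (combination (\<lambda>i. pCons (coeff (a ! i) m) (b i)))"
  unfolding represents_vec_def
proof (intro allI impI)
  fix k assume k: "k < d"
  have 1: "represents emb bs (elt_sum (length bs) (\<lambda>i. elt_scale (length bs)
         ([:coeff (nth_default 0 a i) m:], 1) (get2 X i k)) (length P))
      (\<Sum>i<length P. const emb (coeff (a ! i) m) * P ! i $ k)"
  proof (rule represents_elt_sum)
    fix i assume i: "i < length P"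
    have "ratfun emb ([:coeff (a ! i) m:], 1) = const emb (coeff (a ! i) m)"
      by (simp add: ratfun_eq const_eq_num)
    then show "represents emb bs (elt_scale (length bs) ([:coeff (nth_default 0 a i) m:], 1) (get2 X i k))
        (const emb (coeff (a ! i) m) * P ! i $ k)"
      using represents_scale[OF _ represents_point[OF i k], of "([:coeff (a ! i) m:], 1)"] i assms(2)
      by (simp add: nth_default_nth)
  qed
  have 2: "represents emb bs (elt_sum (length bs) (\<lambda>r. elt_sum (length bs) (\<lambda>j.
         elt_mult tab (nth_default [] (get2 T r k) j) (elt_frobenius q tab (nth_default [] v j) r)) d) (length T))
      (\<Sum>r<length T. \<Sum>j<d. coeff (\<phi> [:0, 1:] $$ (k, j)) r * combination b j ^ q ^ r)"
    by (intro represents_elt_sum represents_mult represents_action represents_frobenius k)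
      (use assms(1) in \<open>auto simp: represents_vec_def\<close>)
  have "tau_eval (\<phi> [:0, 1:] $$ (k, j)) x = (\<Sum>r<length T. coeff (\<phi> [:0, 1:] $$ (k, j)) r * x ^ q ^ r)"
    if "j < d" for j x
  proof -
    have "degree (\<phi> [:0, 1:] $$ (k, j)) \<le> length T - 1" "length T > 0"
      using action_degree[OF k that] by linarith+
    then show ?thesis by (simp add: tau_eval_bound[of _ "length T - 1"] lessThan_Suc_atMost[symmetric])
  qed
  then have "act [:0, 1:] (combination b) k
      = (\<Sum>j<d. \<Sum>r<length T. coeff (\<phi> [:0, 1:] $$ (k, j)) r * combination b j ^ q ^ r)"
    by (simp add: act_def)
  also have "\<dots> = (\<Sum>r<length T. \<Sum>j<d. coeff (\<phi> [:0, 1:] $$ (k, j)) r * combination b j ^ q ^ r)"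
    by (rule sum.swap)
  finally show "represents emb bs (nth_default [] (horner_step input a m v) k)
      (combination (\<lambda>i. pCons (coeff (a ! i) m) (b i)) k)"
    using represents_add[OF 1 2] k
    by (simp add: combination_pCons[OF k] horner_step_def input_def length_tab length_X nth_default_nth q_def)
qed

text \<open>
  After \<open>m\<close> steps the scheme has reached the truncation of \<open>a\<close> at \<open>t\<^sup>N\<^sup>-\<^sup>m\<close>.
\<close>

lemma represents_horner:
  assumes "length a = length P" "\<And>i j. i < length P \<Longrightarrow> N \<le> j \<Longrightarrow> coeff (a ! i) j = 0" "m \<le> N"
  shows "represents_vec (horner input a N m) (combination (\<lambda>i. poly_shift (N - m) (a ! i)))"
  using assms(3)
proof (induction m)
  case 0
  have "poly_shift N (a ! i) = 0" if "i < length P" for i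
    by (rule poly_eqI) (simp add: coeff_poly_shift assms(2)[OF that])
  then have "combination (\<lambda>i. poly_shift N (a ! i)) = combination (\<lambda>_. 0)"
    by (intro combination_cong) simp
  then show ?case
    by (simp add: combination_0 represents_vec_def horner_def input_def length_tab nth_default_nth
        represents_zero)
next
  case (Suc m)
  have "poly_shift (N - Suc m) (a ! i) = pCons (coeff (a ! i) (N - 1 - m)) (poly_shift (N - m) (a ! i))" for i
    by (rule poly_eqI) (use Suc.prems in \<open>auto simp: coeff_poly_shift coeff_pCons Suc_diff_Suc split: nat.splits\<close>)
  with represents_horner_step[OF Suc.IH[OF Suc_leD[OF Suc.prems]] assms(1), of "N - 1 - m"]
  show ?case by (simp add: horner_def)
qed

lemma is_relation_iff:
  "is_relation input a \<longleftrightarrow> length a = length P \<and> combination (\<lambda>i. a ! i) = (\<lambda>_. 0)"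
proof (cases "length a = length P")
  case True
  define v where "v = horner input a (encode a) (encode a)"
  have "coeff (a ! i) j = 0" if "i < length P" "encode a \<le> j" for i j
  proof (rule coeff_beyond_encode)
    have "encode (a ! i) \<le> sum_list (map encode a)"
      using that(1) True by (intro member_le_sum_list) auto
    then show "encode (a ! i) \<le> j" using le_encode_list[of a] that(2) by linarith
  qed
  from represents_horner[OF True this order_refl]
  have v: "represents_vec v (combination (\<lambda>i. a ! i))"
    by (simp add: v_def poly_shift_0)
  have coords: "(\<forall>e<length bs. fst (elt_get (nth_default [] v k) e) = 0) \<longleftrightarrow> combination (\<lambda>i. a ! i) k = 0"
    if k: "k < d" for k
  proof -
    have rep: "represents emb bs (nth_default [] v k) (combination (\<lambda>i. a ! i) k)"
      using v k by (simp add: represents_vec_def)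
    have iff: "ratfun emb z = 0 \<longleftrightarrow> fst z = 0" if "snd z \<noteq> 0" for z
      using that by (cases z) (simp add: ratfun_eq)
    have get: "elt_get (nth_default [] v k) e = nth_default [] v k ! e" if "e < length bs" for e
      by (rule elt_get_represents[OF rep that])
    show ?thesis
    proof
      assume zero: "\<forall>e<length bs. fst (elt_get (nth_default [] v k) e) = 0"
      have "ratfun emb (nth_default [] v k ! e) = 0" if "e < length bs" for e
        using zero[rule_format, OF that] iff[OF represents_snd[OF rep that]] get[OF that] by simp
      then show "combination (\<lambda>i. a ! i) k = 0" using represents_sum[OF rep] by simp
    next
      assume "combination (\<lambda>i. a ! i) k = 0"
      then have "ratfun emb (nth_default [] v k ! e) = 0" if "e < length bs" for e
        using in_span_represents(2)[OF rep that] coord_0[OF that] by simp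
      then show "\<forall>e<length bs. fst (elt_get (nth_default [] v k) e) = 0"
        using iff[OF represents_snd[OF rep]] get by simp
    qed
  qed
  have "is_relation input a \<longleftrightarrow> (\<forall>k<d. \<forall>e<length bs. fst (elt_get (nth_default [] v k) e) = 0)"
    using True by (simp add: is_relation_def v_def input_def length_tab length_X)
  also have "\<dots> \<longleftrightarrow> (\<forall>k<d. combination (\<lambda>i. a ! i) k = 0)" by (simp only: coords cong: imp_cong)
  also have "\<dots> \<longleftrightarrow> combination (\<lambda>i. a ! i) = (\<lambda>_. 0)" by (auto simp: fun_eq_iff combination_def)
  finally show ?thesis using True by simp
qed (simp add: is_relation_def input_def length_X)

lemma relation_generators_relation:
  assumes "g \<in> set (relation_generators input)"
  shows "length g = length P \<and> combination (\<lambda>i. g ! i) = (\<lambda>_. 0)"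
proof -
  have "combination (\<lambda>i. map (\<lambda>_. 0) [0..<length P] ! i) = combination (\<lambda>_. 0)"
    by (intro combination_cong) simp
  then have "combination (\<lambda>i. map (\<lambda>_. 0) [0..<length P] ! i) = (\<lambda>_. 0)" by (simp add: combination_0)
  with assms show ?thesis
    by (auto simp: relation_generators_def is_relation_iff input_def[symmetric] length_X split: if_splits)
      (simp_all add: input_def length_X)
qed

lemma small_relation_generator:
  assumes "combination g = (\<lambda>_. 0)" "\<And>i. i < length P \<Longrightarrow> degree (g i) \<le> relation_degree input"
  shows "map g [0..<length P] \<in> set (relation_generators input)"
proof -
  let ?g = "map g [0..<length P]"
  have "combination (\<lambda>i. ?g ! i) = combination g" by (intro combination_cong) simp
  then have rel: "is_relation input ?g" using assms(1) by (simp add: is_relation_iff)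
  have "encode ?g \<le> list_code_bound
     (list_code_bound (Max (range (to_nat :: 'f \<Rightarrow> nat))) (Suc (relation_degree input))) (length P)"
    using assms(2) by (intro encode_le_list_code_bound) (auto intro: encode_poly_le)
  then have "encode ?g < relation_code_bound input"
    by (simp add: relation_code_bound_def input_def length_X)
  moreover have "?g = (if is_relation input (decode_polys (encode ?g)) then decode_polys (encode ?g)
     else map (\<lambda>_. 0) [0..<length (input_points input)])" using rel by simp
  ultimately show ?thesis
    unfolding relation_generators_def set_map by (intro image_eqI[of _ _ "encode ?g"]) auto
qed

lemma relation_generator_degree:
  assumes "g \<in> set (relation_generators input)" "i < length P"
  shows "degree (g ! i) < relation_code_bound input"
proof -
  obtain m where m: "m < relation_code_bound input" and g: "g = (if is_relation input (decode_polys m)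
      then decode_polys m else map (\<lambda>_. 0) [0..<length (input_points input)])"
    using assms(1) by (auto simp: relation_generators_def)
  show ?thesis
  proof (cases "is_relation input (decode_polys m)")
    case True
    define l where "l = list_decode m"
    have enc: "list_encode l = m" by (simp add: l_def)
    have len: "i < length l" using True assms(2) by (simp add: is_relation_iff decode_polys_def l_def)
    have "degree (decode_poly c :: 'f poly) \<le> c" for c
    proof -
      have "degree (decode_poly c :: 'f poly) \<le> length (list_decode c)"
        by (rule degree_le) (auto simp: decode_poly_def nth_default_def)
      also have "\<dots> \<le> c" using le_encode_list[of "list_decode c"]
        by (simp add: encode_list_def code_list_def encode_nat_def map_idI)
      finally show ?thesis .
    qed
    then have "degree (g ! i) \<le> l ! i" using g True len by (simp add: decode_polys_def l_def)
    also have "\<dots> \<le> sum_list l" using len by (intro member_le_sum_list) auto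
    also have "\<dots> \<le> m" using le_encode_list[of l] enc
      by (simp add: encode_list_def code_list_def encode_nat_def map_idI)
    finally show ?thesis using m by simp
  next
    case False
    then show ?thesis using g assms(2) m by (simp add: input_def length_X)
  qed
qed

end

section \<open>A matrix of degree one\<close>

text \<open>
  The unknown with index \<open>j w + s\<close>, where \<open>s < w\<close>, stands for \<open>t\<^sup>s y\<^sub>j\<close>; the last unknowns are the entries of \<open>a\<close>.
  The row with index \<open>j w + s\<close> is the equation \<open>t\<^sup>s y\<^sub>j = t (t\<^sup>s\<^sup>-\<^sup>1 y\<^sub>j)\<close>, which is empty for \<open>s = 0\<close>, and the
  last rows are the equations \<open>a\<^sub>i = \<Sum>\<^sub>j g\<^sub>j\<^sub>i y\<^sub>j\<close>, expanded into the coefficients of the \<open>g\<^sub>j\<^sub>i\<close>. The empty rows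
  keep the matrix square.
\<close>

definition linear_entry :: "'f::comm_ring_1 poly list list \<Rightarrow> nat \<Rightarrow> nat \<Rightarrow> nat \<Rightarrow> 'f poly" where
  "linear_entry gs w r c =
     (if r < length gs * w then
        if r mod w = 0 then 0 else if c = r then 1 else if Suc c = r then [:0, -1:] else 0
      else if c < length gs * w then
        [:- coeff (nth_default 0 (nth_default [] gs (c div w)) (r - length gs * w)) (c mod w):]
      else if c = r then 1 else 0)"

definition linear_matrix :: "'f::comm_ring_1 poly list list \<Rightarrow> nat \<Rightarrow> nat \<Rightarrow> 'f poly mat" where
  "linear_matrix gs w l =
     mat (length gs * w + l) (length gs * w + l) (\<lambda>(r, c). linear_entry gs w r c)"

lemma sum_lessThan_add: "(\<Sum>c<a + (w::nat). f c) = (\<Sum>c<a. f c) + (\<Sum>s<w. f (a + s) :: 'a::comm_monoid_add)"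
  by (induction w) (simp_all add: add.assoc)

lemma sum_lessThan_mult: "(\<Sum>c<(g::nat) * w. f c) = (\<Sum>j<g. \<Sum>s<w. f (j * w + s) :: 'a::comm_monoid_add)"
proof (induction g)
  case (Suc g)
  have "(\<Sum>c<Suc g * w. f c) = (\<Sum>c<g * w + w. f c)" by (simp add: add.commute)
  then show ?case by (simp add: sum_lessThan_add Suc)
qed simp

lemma sum_coeffs_mult:
  fixes p :: "'a::comm_ring_1 poly"
  assumes "degree p < w"
  shows "(\<Sum>s<w. [:coeff p s:] * ([:0, 1:] ^ s * x)) = p * x"
proof -
  have "(\<Sum>s<w. [:coeff p s:] * ([:0, 1:] ^ s * x)) = (\<Sum>s<w. monom (coeff p s) s) * x"
    by (simp add: monom_altdef sum_distrib_right)
  also have "(\<Sum>s<w. monom (coeff p s) s) = p"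
    using poly_as_sum_of_monoms'[of p "w - 1"] assms by (simp flip: lessThan_Suc_atMost)
  finally show ?thesis .
qed

locale bounded_generators =
  fixes gs :: "'f::comm_ring_1 poly list list" and w l :: nat
  assumes w: "w > 0"
    and degree_gs: "\<And>j i. j < length gs \<Longrightarrow> i < l \<Longrightarrow> degree (gs ! j ! i) < w"
    and length_gs: "\<And>j. j < length gs \<Longrightarrow> length (gs ! j) = l"
begin

lemma linear_matrix_chain_row:
  assumes v: "v \<in> carrier_vec (length gs * w + l)" and r: "r < length gs * w"
  shows "(linear_matrix gs w l *\<^sub>v v) $ r = (if r mod w = 0 then 0 else v $ r - [:0, 1:] * v $ (r - 1))"
proof -
  let ?N = "length gs * w + l"
  have "(linear_matrix gs w l *\<^sub>v v) $ r = (\<Sum>c<?N. linear_entry gs w r c * v $ c)"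
    using v r by (simp add: linear_matrix_def scalar_prod_def atLeast0LessThan)
  also have "\<dots> = (if r mod w = 0 then 0 else v $ r - [:0, 1:] * v $ (r - 1))"
  proof (cases "r mod w = 0")
    case True
    then show ?thesis using r by (simp add: linear_entry_def)
  next
    case False
    then have "r > 0" by (cases r) auto
    have "(\<Sum>c<?N. linear_entry gs w r c * v $ c)
        = (\<Sum>c<?N. (if c = r then v $ c else 0) + (if c = r - 1 then - [:0, 1:] * v $ c else 0))"
      using r False \<open>r > 0\<close> by (intro sum.cong refl) (auto simp: linear_entry_def)
    also have "\<dots> = v $ r - [:0, 1:] * v $ (r - 1)"
      using r \<open>r > 0\<close> unfolding sum.distrib by (simp add: sum.delta)
    finally show ?thesis using False by simp
  qed
  finally show ?thesis .
qed

lemma linear_matrix_sum_row: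
  assumes v: "v \<in> carrier_vec (length gs * w + l)" and i: "i < l"
  shows "(linear_matrix gs w l *\<^sub>v v) $ (length gs * w + i) = v $ (length gs * w + i)
    - (\<Sum>j<length gs. \<Sum>s<w. [:coeff (gs ! j ! i) s:] * v $ (j * w + s))"
proof -
  let ?M = "length gs * w"
  have "(linear_matrix gs w l *\<^sub>v v) $ (?M + i) = (\<Sum>c<?M + l. linear_entry gs w (?M + i) c * v $ c)"
    using v i by (simp add: linear_matrix_def scalar_prod_def atLeast0LessThan)
  also have "\<dots> = (\<Sum>c<?M. linear_entry gs w (?M + i) c * v $ c)
      + (\<Sum>s<l. linear_entry gs w (?M + i) (?M + s) * v $ (?M + s))"
    by (rule sum_lessThan_add)
  also have "(\<Sum>s<l. linear_entry gs w (?M + i) (?M + s) * v $ (?M + s))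
      = (\<Sum>s<l. if s = i then v $ (?M + s) else 0)"
    by (intro sum.cong refl) (simp add: linear_entry_def)
  also have "\<dots> = v $ (?M + i)" using i by simp
  also have "(\<Sum>c<?M. linear_entry gs w (?M + i) c * v $ c)
      = (\<Sum>j<length gs. \<Sum>s<w. - ([:coeff (gs ! j ! i) s:] * v $ (j * w + s)))"
    unfolding sum_lessThan_mult
  proof (intro sum.cong refl)
    fix j s assume j: "j \<in> {..<length gs}" and s: "s \<in> {..<w}"
    have "j * w + s < Suc j * w" using s by simp
    also have "\<dots> \<le> ?M" using j by (intro mult_le_mono1) simp
    finally have "j * w + s < ?M" .
    then show "linear_entry gs w (?M + i) (j * w + s) * v $ (j * w + s)
        = - ([:coeff (gs ! j ! i) s:] * v $ (j * w + s))"
      using j s i by (simp add: linear_entry_def nth_default_nth length_gs)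
  qed
  finally show ?thesis by (simp add: sum_negf)
qed

lemma dim_linear_matrix: "linear_matrix gs w l \<in> carrier_mat (length gs * w + l) (length gs * w + l)"
  by (simp add: linear_matrix_def)

text \<open>
  The rows of the chains force the unknown with index \<open>j w + s\<close> to be \<open>t\<^sup>s\<close> times the one with index \<open>j w\<close>, so
  the coefficients of a generator reassemble in the last rows.
\<close>

lemma kernel_linear_matrix:
  assumes v: "v \<in> mat_kernel (linear_matrix gs w l)"
  shows "vec_last v l = vec l (\<lambda>i. \<Sum>j<length gs. gs ! j ! i * v $ (j * w))"
proof (rule eq_vecI)
  let ?M = "length gs * w"
  note v = mat_kernelD[OF dim_linear_matrix v]
  have chain: "v $ (j * w + s) = [:0, 1:] ^ s * v $ (j * w)" if "j < length gs" "s < w" for j s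
    using that(2)
  proof (induction s)
    case (Suc s)
    have "j * w + Suc s < Suc j * w" using Suc.prems by simp
    also have "\<dots> \<le> ?M" using that(1) by (intro mult_le_mono1) simp
    finally have less: "j * w + Suc s < ?M" .
    have "(linear_matrix gs w l *\<^sub>v v) $ (j * w + Suc s) = 0" using v(2) less by simp
    moreover have "(j * w + Suc s) mod w = Suc s" using Suc.prems by simp
    ultimately have "v $ (j * w + Suc s) = [:0, 1:] * v $ (j * w + s)"
      using linear_matrix_chain_row[OF v(1) less] by simp
    then show ?case using Suc by (simp only: Suc_lessD power_Suc mult.assoc)
  qed simp
  fix i assume "i < dim_vec (vec l (\<lambda>i. \<Sum>j<length gs. gs ! j ! i * v $ (j * w)))"
  then have i: "i < l" by simp
  have "(linear_matrix gs w l *\<^sub>v v) $ (?M + i) = 0" using v(2) i by simp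
  then have "v $ (?M + i) = (\<Sum>j<length gs. \<Sum>s<w. [:coeff (gs ! j ! i) s:] * v $ (j * w + s))"
    using linear_matrix_sum_row[OF v(1) i] by simp
  also have "\<dots> = (\<Sum>j<length gs. \<Sum>s<w. [:coeff (gs ! j ! i) s:] * ([:0, 1:] ^ s * v $ (j * w)))"
    by (intro sum.cong refl) (simp only: chain lessThan_iff)
  also have "\<dots> = (\<Sum>j<length gs. gs ! j ! i * v $ (j * w))"
    using i degree_gs by (intro sum.cong refl sum_coeffs_mult) simp
  finally show "vec_last v l $ i = vec l (\<lambda>i. \<Sum>j<length gs. gs ! j ! i * v $ (j * w)) $ i"
    using i v(1) by (simp add: vec_last_def)
qed simp

lemma ex_kernel_linear_matrix:
  "\<exists>v\<in>mat_kernel (linear_matrix gs w l). vec_last v l = vec l (\<lambda>i. \<Sum>j<length gs. gs ! j ! i * y j)"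
proof -
  let ?M = "length gs * w"
  define v where "v = vec (?M + l) (\<lambda>c. if c < ?M then [:0, 1:] ^ (c mod w) * y (c div w)
    else \<Sum>j<length gs. gs ! j ! (c - ?M) * y j)"
  have v: "v \<in> carrier_vec (?M + l)" by (simp add: v_def)
  have v_chain: "v $ (j * w + s) = [:0, 1:] ^ s * y j" if "j < length gs" "s < w" for j s
  proof -
    have "j * w + s < Suc j * w" using that by simp
    also have "\<dots> \<le> ?M" using that(1) by (intro mult_le_mono1) simp
    finally show ?thesis using that by (simp add: v_def)
  qed
  have "linear_matrix gs w l *\<^sub>v v = 0\<^sub>v (?M + l)"
  proof (rule eq_vecI)
    fix r assume "r < dim_vec (0\<^sub>v (?M + l))"
    then have r: "r < ?M + l" by simp
    show "(linear_matrix gs w l *\<^sub>v v) $ r = 0\<^sub>v (?M + l) $ r"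
    proof (cases "r < ?M")
      case True
      define j s where "j = r div w" and "s = r mod w"
      have rjs: "r = j * w + s" "s < w" using w by (simp_all add: j_def s_def)
      have "j < length gs" using True w by (simp add: j_def less_mult_imp_div_less)
      show ?thesis
      proof (cases "s = 0")
        case True
        then show ?thesis
          using linear_matrix_chain_row[OF v \<open>r < ?M\<close>] r by (simp add: s_def)
      next
        case False
        then obtain s' where s': "s = Suc s'" by (cases s) auto
        have "v $ r = [:0, 1:] * v $ (r - 1)"
          using v_chain[OF \<open>j < length gs\<close> \<open>s < w\<close>] v_chain[OF \<open>j < length gs\<close>, of s'] rjs s'
          by (simp del: mult_pCons_left add: mult.assoc)
        then show ?thesis
          using linear_matrix_chain_row[OF v \<open>r < ?M\<close>] r by simp
      qed
    next
      case False
      define i where "i = r - ?M"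
      have i: "r = ?M + i" "i < l" using False r by (auto simp: i_def)
      have "(\<Sum>j<length gs. \<Sum>s<w. [:coeff (gs ! j ! i) s:] * v $ (j * w + s))
          = (\<Sum>j<length gs. \<Sum>s<w. [:coeff (gs ! j ! i) s:] * ([:0, 1:] ^ s * y j))"
        by (intro sum.cong refl) (simp only: v_chain lessThan_iff)
      also have "\<dots> = (\<Sum>j<length gs. gs ! j ! i * y j)"
        using i degree_gs by (intro sum.cong refl sum_coeffs_mult) simp
      finally show ?thesis
        using linear_matrix_sum_row[OF v i(2)] i by (simp add: v_def)
    qed
  qed (simp add: linear_matrix_def)
  then have "v \<in> mat_kernel (linear_matrix gs w l)"
    by (intro mat_kernelI[OF dim_linear_matrix v])
  moreover have "vec_last v l = vec l (\<lambda>i. \<Sum>j<length gs. gs ! j ! i * y j)"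
    by (rule eq_vecI) (simp_all add: vec_last_def v_def)
  ultimately show ?thesis by blast
qed

lemma mat_degree_linear_matrix: "mat_degree (linear_matrix gs w l) \<le> 1"
proof -
  have "degree (linear_entry gs w r c) \<le> 1" for r c
    by (simp add: linear_entry_def)
  then have "\<forall>f\<in>elements_mat (linear_matrix gs w l). degree f \<le> 1"
    by (auto simp: elements_mat_def linear_matrix_def)
  moreover have "finite (elements_mat (linear_matrix gs w l))" by (simp add: elements_mat_def)
  ultimately show ?thesis unfolding mat_degree_def by (intro Max.boundedI) auto
qed

end

section \<open>The relation module\<close>

lemma submodule_mat_kernel:
  fixes B :: "'a::comm_ring_1 mat"
  shows "submodule class_ring (mat_kernel B) (module_vec TYPE('a) (dim_col B))"
proof -
  interpret V: vec_module "TYPE('a)" "dim_col B" .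
  show ?thesis
  proof
    fix v w assume "v \<in> mat_kernel B" "w \<in> mat_kernel B"
    then show "v \<oplus>\<^bsub>module_vec TYPE('a) (dim_col B)\<^esub> w \<in> mat_kernel B"
      by (auto simp: mat_kernel_def module_vec_simps mult_add_distrib_mat_vec[of _ "dim_row B" "dim_col B"])
  next
    fix c v assume "v \<in> mat_kernel B"
    then have v: "v \<in> carrier_vec (dim_col B)" "B *\<^sub>v v = 0\<^sub>v (dim_row B)" by (auto simp: mat_kernel_def)
    have "B *\<^sub>v (c \<cdot>\<^sub>v v) = c \<cdot>\<^sub>v (B *\<^sub>v v)"
      using v(1) by (intro eq_vecI) (auto simp: scalar_prod_def sum_distrib_left mult.left_commute)
    also have "\<dots> = 0\<^sub>v (dim_row B)" unfolding v(2) by (rule eq_vecI) simp_all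
    finally show "c \<odot>\<^bsub>module_vec TYPE('a) (dim_col B)\<^esub> v \<in> mat_kernel B"
      using v(1) by (simp add: mat_kernel_def module_vec_simps)
  qed (auto simp: mat_kernel_def module_vec_simps)
qed

context presented_t_module
begin

lemma submodule_relation_set:
  "submodule class_ring (relation_set d \<phi> P) (module_vec TYPE('f poly) (length P))"
proof -
  interpret V: vec_module "TYPE('f poly)" "length P" .
  show ?thesis
  proof
    fix v w assume vw: "v \<in> relation_set d \<phi> P" "w \<in> relation_set d \<phi> P"
    have "combination (\<lambda>i. (v + w) $ i) = combination (\<lambda>i. v $ i + w $ i)"
      using vw by (intro combination_cong) (auto simp: relation_set_iff)
    then show "v \<oplus>\<^bsub>module_vec TYPE('f poly) (length P)\<^esub> w \<in> relation_set d \<phi> P"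
      using vw by (auto simp: relation_set_iff module_vec_simps combination_add fun_eq_iff)
  next
    fix c v assume v: "v \<in> relation_set d \<phi> P"
    have "combination (\<lambda>i. (c \<cdot>\<^sub>v v) $ i) = combination (\<lambda>i. c * v $ i)"
      using v by (intro combination_cong) (auto simp: relation_set_iff)
    also have "\<dots> = (\<lambda>_. 0)" using v by (intro combination_mult_zero) (simp add: relation_set_iff)
    finally show "c \<odot>\<^bsub>module_vec TYPE('f poly) (length P)\<^esub> v \<in> relation_set d \<phi> P"
      using v by (simp add: relation_set_iff module_vec_simps)
  next
    have "combination (\<lambda>i. 0\<^sub>v (length P) $ i) = combination (\<lambda>_. 0)"
      by (intro combination_cong) simp
    then show "\<zero>\<^bsub>module_vec TYPE('f poly) (length P)\<^esub> \<in> relation_set d \<phi> P"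
      by (simp add: relation_set_iff module_vec_simps combination_0)
  qed (auto simp: relation_set_iff module_vec_simps)
qed

abbreviation gens :: "'f poly list list" where "gens \<equiv> relation_generators input"
abbreviation width :: nat where "width \<equiv> relation_code_bound input"

lemma length_gens: "j < length gens \<Longrightarrow> length (gens ! j) = length P"
  using relation_generators_relation nth_mem by blast

lemma gens_carrier: "set (map vec_of_list gens) \<subseteq> carrier_vec (length P)"
  using relation_generators_relation by (auto intro!: carrier_vecI)

lemma gens_relation: "set (map vec_of_list gens) \<subseteq> relation_set d \<phi> P"
proof
  fix v assume "v \<in> set (map vec_of_list gens)"
  then obtain g where g: "g \<in> set gens" "v = vec_of_list g" by auto
  have "combination (\<lambda>i. vec_of_list g $ i) = combination (\<lambda>i. g ! i)"
    using relation_generators_relation[OF g(1)] by (intro combination_cong) (simp add: vec_of_list_index)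
  then show "v \<in> relation_set d \<phi> P"
    using relation_generators_relation[OF g(1)] g(2) by (simp add: relation_set_iff carrier_vecI)
qed

text \<open>
  The span is a submodule that contains all small relations, hence all relations.
\<close>

lemma span_gens:
  "LinearCombinations.module.span class_ring (module_vec TYPE('f poly) (length P)) (set (map vec_of_list gens))
    = relation_set d \<phi> P"
proof -
  interpret V: vec_module "TYPE('f poly)" "length P" .
  define S where "S = LinearCombinations.module.span class_ring (module_vec TYPE('f poly) (length P))
    (set (map vec_of_list gens))"
  have "S \<subseteq> relation_set d \<phi> P"
    unfolding S_def by (rule V.span_is_subset[OF gens_relation submodule_relation_set])
  moreover have "relation_set d \<phi> P \<subseteq> S"
  proof
    have sub: "submodule class_ring S (module_vec TYPE('f poly) (length P))"
      unfolding S_def using gens_carrier by (intro V.span_is_submodule) (simp add: module_vec_simps)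
    interpret S: submodule class_ring S "module_vec TYPE('f poly) (length P)" by (rule sub)
    define C where "C a \<longleftrightarrow> vec (length P) a \<in> S" for a
    fix v assume v: "v \<in> relation_set d \<phi> P"
    have "C (\<lambda>i. v $ i)"
    proof (rule relations_in_closure[where C = C and a = "\<lambda>i. v $ i"])
      fix x y assume "C x" "C y"
      moreover have "vec (length P) (\<lambda>i. x i + y i) = vec (length P) x + vec (length P) y" by auto
      ultimately show "C (\<lambda>i. x i + y i)"
        using S.m_closed[of "vec (length P) x" "vec (length P) y"] by (simp add: C_def module_vec_simps)
    next
      fix b x assume "C x"
      moreover have "vec (length P) (\<lambda>i. b * x i) = b \<cdot>\<^sub>v vec (length P) x" by auto
      ultimately show "C (\<lambda>i. b * x i)"
        using S.smult_closed[of b "vec (length P) x"] by (simp add: C_def module_vec_simps)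
    next
      fix g assume "combination g = (\<lambda>_. 0)" "\<And>i. i < length P \<Longrightarrow> degree (g i) \<le> relation_degree input"
      then have "map g [0..<length P] \<in> set gens" by (rule small_relation_generator)
      then have "vec_of_list (map g [0..<length P]) \<in> S"
        using V.in_own_span[OF gens_carrier] by (auto simp: S_def)
      moreover have "vec_of_list (map g [0..<length P]) = vec (length P) g"
        by (intro eq_vecI) (simp_all add: vec_of_list_index)
      ultimately show "C g" by (simp add: C_def)
    qed (use v in \<open>simp add: relation_set_iff\<close>)
    moreover have "vec (length P) (\<lambda>i. v $ i) = v" using v by (auto simp: relation_set_iff)
    ultimately show "v \<in> S" by (simp add: C_def)
  qed
  ultimately show ?thesis by (simp add: S_def)
qed

text \<open>
  The same statement as a linear system with one unknown for each generator, which is the form that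
  the matrix encodes.
\<close>

lemma relation_iff_combination_of_gens:
  "relation_set d \<phi> P = {vec (length P) (\<lambda>i. \<Sum>j<length gens. gens ! j ! i * y j) |y. True}"
proof (intro equalityI subsetI)
  fix v assume v: "v \<in> relation_set d \<phi> P"
  define C where "C a \<longleftrightarrow> (\<exists>y. \<forall>i<length P. a i = (\<Sum>j<length gens. gens ! j ! i * y j))" for a
  have "C (\<lambda>i. v $ i)"
  proof (rule relations_in_closure[where C = C and a = "\<lambda>i. v $ i"])
    fix x y assume C: "C x" "C y"
    obtain y1 where y1: "\<forall>i<length P. x i = (\<Sum>j<length gens. gens ! j ! i * y1 j)"
      using C(1) by (auto simp: C_def)
    obtain y2 where y2: "\<forall>i<length P. y i = (\<Sum>j<length gens. gens ! j ! i * y2 j)"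
      using C(2) by (auto simp: C_def)
    show "C (\<lambda>i. x i + y i)"
      unfolding C_def using y1 y2
      by (intro exI[of _ "\<lambda>j. y1 j + y2 j"]) (simp add: distrib_left sum.distrib)
  next
    fix b x assume "C x"
    then obtain y where y: "\<forall>i<length P. x i = (\<Sum>j<length gens. gens ! j ! i * y j)"
      by (auto simp: C_def)
    show "C (\<lambda>i. b * x i)"
      unfolding C_def using y
      by (intro exI[of _ "\<lambda>j. b * y j"]) (simp add: sum_distrib_left mult.left_commute)
  next
    fix g assume "combination g = (\<lambda>_. 0)" "\<And>i. i < length P \<Longrightarrow> degree (g i) \<le> relation_degree input"
    then have "map g [0..<length P] \<in> set gens" by (rule small_relation_generator)
    then obtain j0 where j0: "j0 < length gens" "gens ! j0 = map g [0..<length P]"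
      by (auto simp: in_set_conv_nth)
    have "g i = (\<Sum>j<length gens. gens ! j ! i * (if j = j0 then 1 else 0))" if "i < length P" for i
    proof -
      have "(\<Sum>j<length gens. gens ! j ! i * (if j = j0 then 1 else 0)) = gens ! j0 ! i"
        using j0(1) by (simp add: if_distrib sum.delta cong: if_cong)
      then show ?thesis using that j0(2) by simp
    qed
    then show "C g"
      unfolding C_def by (intro exI[of _ "\<lambda>j. if j = j0 then 1 else 0"]) simp
  qed (use v in \<open>simp add: relation_set_iff\<close>)
  then obtain y where y: "\<forall>i<length P. v $ i = (\<Sum>j<length gens. gens ! j ! i * y j)"
    by (auto simp: C_def)
  have "v = vec (length P) (\<lambda>i. \<Sum>j<length gens. gens ! j ! i * y j)"
    using v y by (intro eq_vecI) (auto simp: relation_set_iff)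
  then show "v \<in> {vec (length P) (\<lambda>i. \<Sum>j<length gens. gens ! j ! i * y j) |y. True}" by blast
next
  fix v assume "v \<in> {vec (length P) (\<lambda>i. \<Sum>j<length gens. gens ! j ! i * y j) |y. True}"
  then obtain y where v: "v = vec (length P) (\<lambda>i. \<Sum>j<length gens. gens ! j ! i * y j)" by blast
  have "combination (\<lambda>i. \<Sum>j<m. gens ! j ! i * y j) = (\<lambda>_. 0)" if "m \<le> length gens" for m
    using that
  proof (induction m)
    case 0
    then show ?case by (simp add: combination_0)
  next
    case (Suc m)
    have "combination (\<lambda>i. gens ! m ! i) = (\<lambda>_. 0)"
      using relation_generators_relation[of "gens ! m"] Suc.prems by simp
    from combination_mult_zero[OF this, of "y m"] Suc show ?case
      by (simp add: combination_add mult.commute fun_eq_iff)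
  qed
  from this[OF order_refl] show "v \<in> relation_set d \<phi> P"
    using combination_cong[of "\<lambda>i. v $ i" "\<lambda>i. \<Sum>j<length gens. gens ! j ! i * y j"]
    by (simp add: relation_set_iff v)
qed

definition relation_matrix :: "'f poly mat" where
  "relation_matrix = linear_matrix gens width (length P)"

sublocale bounded: bounded_generators gens width "length P"
  using relation_generator_degree length_gens by unfold_locales (simp_all add: relation_code_bound_def)

lemma vec_last_relation_matrix:
  "(\<lambda>v. vec_last v (length P)) ` mat_kernel relation_matrix = relation_set d \<phi> P"
proof (intro equalityI subsetI)
  fix u assume "u \<in> (\<lambda>v. vec_last v (length P)) ` mat_kernel relation_matrix"
  then obtain v where v: "v \<in> mat_kernel relation_matrix" "u = vec_last v (length P)" by auto
  have "u = vec (length P) (\<lambda>i. \<Sum>j<length gens. gens ! j ! i * v $ (j * width))"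
    unfolding v(2)
    using v(1)[unfolded relation_matrix_def] by (rule bounded.kernel_linear_matrix)
  then show "u \<in> relation_set d \<phi> P"
    unfolding relation_iff_combination_of_gens mem_Collect_eq
    by (intro exI[of _ "\<lambda>j. v $ (j * width)"]) simp
next
  fix u assume "u \<in> relation_set d \<phi> P"
  then obtain y where u: "u = vec (length P) (\<lambda>i. \<Sum>j<length gens. gens ! j ! i * y j)"
    unfolding relation_iff_combination_of_gens mem_Collect_eq by (elim exE conjE)
  obtain v where "v \<in> mat_kernel relation_matrix"
      "vec_last v (length P) = vec (length P) (\<lambda>i. \<Sum>j<length gens. gens ! j ! i * y j)"
    unfolding relation_matrix_def
    using bounded.ex_kernel_linear_matrix[of y] by (elim bexE)
  then show "u \<in> (\<lambda>v. vec_last v (length P)) ` mat_kernel relation_matrix"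
    unfolding u by (intro image_eqI[where x = v]) simp_all
qed

lemma mod_hom_relation_matrix:
  "mod_hom class_ring (kernel_module relation_matrix) (relation_module d \<phi> P) (\<lambda>v. vec_last v (length P))"
proof -
  let ?n = "dim_col relation_matrix"
  interpret V: vec_module "TYPE('f poly)" ?n .
  interpret W: vec_module "TYPE('f poly)" "length P" .
  have n: "?n = length gens * width + length P" by (simp add: relation_matrix_def linear_matrix_def)
  have 1: "module class_ring (kernel_module relation_matrix)"
    unfolding kernel_module_def by (rule V.submodule_is_module[OF submodule_mat_kernel])
  have 2: "module class_ring (relation_module d \<phi> P)"
    unfolding relation_module_def by (rule W.submodule_is_module[OF submodule_relation_set])
  have "(\<lambda>v. vec_last v (length P)) \<in> module_hom class_ring (kernel_module relation_matrix) (relation_module d \<phi> P)"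
    unfolding module_hom_def
    using vec_last_relation_matrix n
    by (auto simp: kernel_module_def relation_module_def module_vec_simps vec_last_def mat_kernel_def intro!: eq_vecI)
  with 1 2 show ?thesis by (simp add: mod_hom_def mod_hom_axioms_def)
qed

end

section \<open>The algorithms\<close>

definition linearization :: "'f::{finite,field} input \<Rightarrow> nat \<times> 'f poly list list" where
  "linearization x =
     (length (relation_generators x) * relation_code_bound x + length (input_points x),
      map (\<lambda>r. map (\<lambda>c. linear_entry (relation_generators x) (relation_code_bound x) r c)
          [0..<length (relation_generators x) * relation_code_bound x + length (input_points x)])
        [0..<length (relation_generators x) * relation_code_bound x + length (input_points x)])"

lemma computable_linearization: "computable (\<lambda>x :: 'f::{finite,field} input. linearization x)"
  unfolding linearization_def linear_entry_def
  by (intro computable_intros computable_comp[OF computable_relation_generators]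
      computable_comp[OF computable_relation_code_bound] computable_coeff[where F = "\<lambda>c. [:- c:]"])

lemma encode_polys: "encode (gs :: 'f::{finite,zero} poly list list) = code_list (code_list code_poly) gs"
  by (simp add: encode_list_def[abs_def] encode_poly_def[abs_def])

lemma encode_elt: "encode (xs :: 'f::{finite,zero} elt) = code_elt xs"
  by (simp add: encode_list_def code_elt_def encode_prod_def[abs_def] encode_poly_def[abs_def] case_prod_unfold)

lemma code_input_eq:
  "code_input d tab T X = encode [d, encode tab, encode T, encode (X :: 'f::{finite,field} elt list list)]"
  by (simp add: code_input_def encode_elt[abs_def] code_list_def[abs_def] encode_list_def[abs_def]
      encode_nat_def[abs_def])

text \<open>
  The input is coded as a list of four numbers; it only remains to recode it as a tuple.
\<close>

lemma algorithm_of_computable: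
  fixes F :: "'f::{finite,field} input \<Rightarrow> 'b::coded"
  assumes "computable F"
  shows "\<exists>alg. partial_recursive alg \<and>
    (\<forall>d tab T X. alg (code_input d tab T X) = Some (encode (F (d, tab, T, X))))"
proof -
  obtain g where g: "partial_recursive g" "\<And>x. g (encode x) = Some (encode (F x))"
    using assms unfolding computable_def by blast
  have "computable (\<lambda>l :: nat list. (nth_default 0 l 0, nth_default 0 l 1, nth_default 0 l 2, nth_default 0 l 3))"
    by (intro computable_intros)
  then obtain g' where g': "partial_recursive g'" "\<And>l :: nat list. g' (encode l)
      = Some (encode (nth_default 0 l 0, nth_default 0 l 1, nth_default 0 l 2, nth_default 0 l 3))"
    unfolding computable_def by blast
  have "g' (code_input d tab T X) = Some (encode (d, tab, T, X :: 'f elt list list))" for d tab T X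
    unfolding code_input_eq g'(2)
    by (simp add: encode_Pair encode_nat_def numeral_2_eq_2 numeral_3_eq_3)
  then show ?thesis
    using g g' by (intro exI[of _ "\<lambda>n. Option.bind (g' n) g"]) (simp add: pr_comp)
qed


lemma presented_t_moduleI:
  assumes C: "C_infinity emb absv" and "t_module emb L d \<phi>" and "set P \<subseteq> rational_points L d"
    and "presents_field emb bs tab L" "presents_t_module emb bs T \<phi>" "presents_points emb bs X P"
  shows "presented_t_module emb bs L d \<phi> P tab T X"
proof -
  have "field_hom emb" using C by (simp add: C_infinity_def)
  moreover have "set P \<subseteq> carrier_vec d" using assms(3) by (auto simp: rational_points_def)
  ultimately show ?thesis
    using assms
    by (intro presented_t_module.intro t_action.intro coordinates_table.intro coordinates.intro
        t_action_axioms.intro coordinates_table_axioms.intro presented_t_module_axioms.intro)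
      (simp_all add: presents_field_def)
qed

theorem theorem1p1p3:
  fixes emb :: "'f::{finite,field} fls \<Rightarrow> 'c::field" and absv :: "'c \<Rightarrow> real"
  assumes "C_infinity emb absv"
  shows
    "(\<exists>alg. partial_recursive alg \<and>
       (\<forall>L d \<phi> P c. global_function_field emb L \<longrightarrow> t_module emb L d \<phi> \<longrightarrow>
          set P \<subseteq> rational_points L d \<longrightarrow> valid_input emb L d \<phi> P c \<longrightarrow>
          (\<exists>m n (B :: 'f poly mat).
             alg c = Some (code_poly_mat B) \<and>
             B \<in> carrier_mat m n \<and> length P \<le> n \<and> mat_degree B \<le> 1 \<and>
             mod_hom class_ring (kernel_module B) (relation_module d \<phi> P)
               (\<lambda>x. vec_last x (length P)) \<and>
             (\<lambda>x. vec_last x (length P)) ` mat_kernel B = relation_set d \<phi> P)))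
     \<and>
     (\<exists>alg. partial_recursive alg \<and>
       (\<forall>L d \<phi> P c. global_function_field emb L \<longrightarrow> t_module emb L d \<phi> \<longrightarrow>
          set P \<subseteq> rational_points L d \<longrightarrow> valid_input emb L d \<phi> P c \<longrightarrow>
          (\<exists>gs :: 'f poly vec list.
             alg c = Some (code_poly_vecs gs) \<and>
             set gs \<subseteq> carrier_vec (length P) \<and>
             LinearCombinations.module.span class_ring (module_vec TYPE('f poly) (length P)) (set gs)
               = relation_set d \<phi> P)))"
proof (intro conjI)
  obtain alg where alg: "partial_recursive alg"
    "\<And>d tab T X. alg (code_input d tab T X) = Some (encode (linearization (d, tab, T, X :: 'f elt list list)))"
    using algorithm_of_computable[OF computable_linearization] by blast
  show "\<exists>alg. partial_recursive alg \<and>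
       (\<forall>L d \<phi> P c. global_function_field emb L \<longrightarrow> t_module emb L d \<phi> \<longrightarrow>
          set P \<subseteq> rational_points L d \<longrightarrow> valid_input emb L d \<phi> P c \<longrightarrow>
          (\<exists>m n (B :: 'f poly mat).
             alg c = Some (code_poly_mat B) \<and>
             B \<in> carrier_mat m n \<and> length P \<le> n \<and> mat_degree B \<le> 1 \<and>
             mod_hom class_ring (kernel_module B) (relation_module d \<phi> P)
               (\<lambda>x. vec_last x (length P)) \<and>
             (\<lambda>x. vec_last x (length P)) ` mat_kernel B = relation_set d \<phi> P))"
  proof (intro exI[of _ alg] conjI allI impI alg(1))
    fix L d \<phi> P c
    assume *: "t_module emb L d \<phi>" "set P \<subseteq> rational_points L d" and "valid_input emb L d \<phi> P c"
    then obtain bs tab T X where pres: "presents_field emb bs tab L" "presents_t_module emb bs T \<phi>"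
        "presents_points emb bs X P" and c: "c = code_input d tab T X"
      unfolding valid_input_def by (elim exE conjE)
    interpret presented_t_module emb bs L d \<phi> P tab T X
      by (rule presented_t_moduleI[OF assms * pres])
    let ?n = "length gens * width + length P"
    have carrier: "relation_matrix \<in> carrier_mat ?n ?n"
      by (simp add: relation_matrix_def linear_matrix_def)
    have "mat_to_list relation_matrix = snd (linearization input)"
      by (simp add: mat_to_list_def linearization_def relation_matrix_def linear_matrix_def input_def
          length_X cong: map_cong)
    moreover have "dim_col relation_matrix = fst (linearization input)"
      using carrier by (simp add: linearization_def input_def length_X)
    ultimately have "code_poly_mat relation_matrix = encode (linearization input)"
      by (simp add: code_poly_mat_def encode_prod_def encode_polys encode_nat_def)
    then have "alg c = Some (code_poly_mat relation_matrix)"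
      by (simp add: c alg(2) input_def)
    moreover have "mat_degree relation_matrix \<le> 1"
      unfolding relation_matrix_def by (rule bounded.mat_degree_linear_matrix)
    ultimately show "\<exists>m n (B :: 'f poly mat).
             alg c = Some (code_poly_mat B) \<and>
             B \<in> carrier_mat m n \<and> length P \<le> n \<and> mat_degree B \<le> 1 \<and>
             mod_hom class_ring (kernel_module B) (relation_module d \<phi> P)
               (\<lambda>x. vec_last x (length P)) \<and>
             (\<lambda>x. vec_last x (length P)) ` mat_kernel B = relation_set d \<phi> P"
      using carrier mod_hom_relation_matrix vec_last_relation_matrix
      by (intro exI[of _ ?n] exI[of _ relation_matrix] conjI) simp_all
  qed
next
  obtain alg where alg: "partial_recursive alg"
    "\<And>d tab T X. alg (code_input d tab T X) = Some (encode (relation_generators (d, tab, T, X :: 'f elt list list)))"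
    using algorithm_of_computable[OF computable_relation_generators] by blast
  show "\<exists>alg. partial_recursive alg \<and>
       (\<forall>L d \<phi> P c. global_function_field emb L \<longrightarrow> t_module emb L d \<phi> \<longrightarrow>
          set P \<subseteq> rational_points L d \<longrightarrow> valid_input emb L d \<phi> P c \<longrightarrow>
          (\<exists>gs :: 'f poly vec list.
             alg c = Some (code_poly_vecs gs) \<and>
             set gs \<subseteq> carrier_vec (length P) \<and>
             LinearCombinations.module.span class_ring (module_vec TYPE('f poly) (length P)) (set gs)
               = relation_set d \<phi> P))"
  proof (intro exI[of _ alg] conjI allI impI alg(1))
    fix L d \<phi> P c
    assume *: "t_module emb L d \<phi>" "set P \<subseteq> rational_points L d" and "valid_input emb L d \<phi> P c"
    then obtain bs tab T X where pres: "presents_field emb bs tab L" "presents_t_module emb bs T \<phi>"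
        "presents_points emb bs X P" and c: "c = code_input d tab T X"
      unfolding valid_input_def by (elim exE conjE)
    interpret presented_t_module emb bs L d \<phi> P tab T X
      by (rule presented_t_moduleI[OF assms * pres])
    have "map list_of_vec (map vec_of_list gens) = gens"
      by (simp add: comp_def list_vec)
    then have "alg c = Some (code_poly_vecs (map vec_of_list gens))"
      by (simp add: c alg(2) input_def code_poly_vecs_def encode_polys)
    then show "\<exists>gs :: 'f poly vec list.
             alg c = Some (code_poly_vecs gs) \<and>
             set gs \<subseteq> carrier_vec (length P) \<and>
             LinearCombinations.module.span class_ring (module_vec TYPE('f poly) (length P)) (set gs)
               = relation_set d \<phi> P"
      using gens_carrier span_gens by (intro exI[of _ "map vec_of_list gens"] conjI)
  qed
qed

end
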